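(* Let $B$ be a separable C*-algebra, let $D$ be a C*-algebra, $I\subseteq D$ a closed two-sided ideal and $q:D\to D/I$ the quotient map. Let $\phi,\psi:B\to D/I$ be homotopic $*$-homomorphisms, and suppose $\psi$ lifts to an asymptotic homomorphism (respectively, to a discrete asymptotic homomorphism) from $B$ to $D$. Then $\phi$ lifts to an asymptotic homomorphism (respectively, to a discrete asymptotic homomorphism) from $B$ to $D$. Moreover the whole homotopy lifts: if $\Phi:B\to (D/I)\otimes C[0,1]$ is a $*$-homomorphism which is a homotopy between $\phi$ and $\psi$, then there is an asymptotic homomorphism (respectively, a discrete asymptotic homomorphism) $(\Psi_\lambda)_\lambda$ from $B$ to $D\otimes C[0,1]$ with $(q\otimes \mathrm{id}_{C[0,1]})\circ\Psi_\lambda=\Phi$ for every $\lambda$.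
   Context: An asymptotic homomorphism from a C*-algebra $A$ to a C*-algebra $E$ is a family of maps $f_\lambda:A\to E$, $\lambda\in[0,\infty)$ (not assumed linear), such that $\lambda\mapsto f_\lambda(a)$ is continuous for each $a\in A$, and for all $a,b\in A$, $\mu_1,\mu_2\in\mathbb C$: $\lim_{\lambda\to\infty}\|f_\lambda(a^* )-f_\lambda(a)^*\|=0$, $\lim_{\lambda\to\infty}\|f_\lambda(\mu_1a+\mu_2b)-\mu_1f_\lambda(a)-\mu_2f_\lambda(b)\|=0$, $\lim_{\lambda\to\infty}\|f_\lambda(ab)-f_\lambda(a)f_\lambda(b)\|=0$. A discrete asymptotic homomorphism is a sequence of maps $f_n:A\to E$, $n\in\mathbb N$, satisfying the same three limit conditions (as $n\to\infty$) and $\sup_n\|f_n(a)\|<\infty$ for each $a\in A$. A $*$-homomorphism $f:B\to D/I$ lifts to a (discrete) asymptotic homomorphism $(\phi_\lambda)$ from $B$ to $D$ if $q\circ\phi_\lambda=f$ for every $\lambda$. Two $*$-homomorphisms $\phi,\psi:B\to E$ are homotopic if there is a $*$-homomorphism $\Phi:B\to E\otimes C[0,1]$ (a homotopy between them) with $\mathrm{ev}_1\circ\Phi=\phi$ and $\mathrm{ev}_0\circ\Phi=\psi$. *)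

theory Defs
  imports "HOL-Analysis.Analysis"
begin

section \<open>C*-algebras\<close>

text \<open>C*-algebras are complex and not assumed to be unital.\<close>

class cstar_algebra = real_normed_algebra + banach +
  fixes scaleC :: "complex \<Rightarrow> 'a \<Rightarrow> 'a" (infixr \<open>*\<^sub>C\<close> 75)
    and star :: "'a \<Rightarrow> 'a"
  assumes scaleC_add_right: "c *\<^sub>C (x + y) = c *\<^sub>C x + c *\<^sub>C y"
    and scaleC_add_left: "(c + d) *\<^sub>C x = c *\<^sub>C x + d *\<^sub>C x"
    and scaleC_scaleC: "c *\<^sub>C d *\<^sub>C x = (c * d) *\<^sub>C x"
    and scaleC_of_real: "complex_of_real r *\<^sub>C x = r *\<^sub>R x"
    and scaleC_mult_left: "(c *\<^sub>C x) * y = c *\<^sub>C (x * y)"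
    and scaleC_mult_right: "x * (c *\<^sub>C y) = c *\<^sub>C (x * y)"
    and norm_scaleC: "norm (c *\<^sub>C x) = cmod c * norm x"
    and star_add: "star (x + y) = star x + star y"
    and star_scaleC: "star (c *\<^sub>C x) = cnj c *\<^sub>C star x"
    and star_mult: "star (x * y) = star y * star x"
    and star_star: "star (star x) = x"
    and cstar_identity: "norm (star x * x) = (norm x)\<^sup>2"

instantiation complex :: cstar_algebra
begin
definition "scaleC_complex (c :: complex) (x :: complex) = c * x"
definition "star_complex (x :: complex) = cnj x"
instance
  by standard
    (auto simp: scaleC_complex_def star_complex_def algebra_simps norm_mult power2_eq_square
      scaleR_conv_of_real)
end

text \<open>
  A quotient \<open>D/I\<close> depends on the term \<open>I\<close> and so cannot be a type.  Quotients and
  algebras of continuous functions are therefore given by their operations on an explicit carrier;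
  the type \<open>'a::cstar_algebra\<close> itself is regarded as such a structure through \<open>full\<close>.
\<close>

record 'a star_alg =
  carr :: "'a set"
  add :: "'a \<Rightarrow> 'a \<Rightarrow> 'a"
  scl :: "complex \<Rightarrow> 'a \<Rightarrow> 'a"
  mul :: "'a \<Rightarrow> 'a \<Rightarrow> 'a"
  adj :: "'a \<Rightarrow> 'a"
  nrm :: "'a \<Rightarrow> real"

definition full :: "'a::cstar_algebra star_alg" where
  "full = \<lparr>carr = UNIV, add = (+), scl = (*\<^sub>C), mul = (*), adj = star, nrm = norm\<rparr>"

definition ndist :: "'a star_alg \<Rightarrow> 'a \<Rightarrow> 'a \<Rightarrow> real" where
  "ndist E x y = nrm E (add E x (scl E (-1) y))"

definition continuous_into :: "'a star_alg \<Rightarrow> real set \<Rightarrow> (real \<Rightarrow> 'a) \<Rightarrow> bool" where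
  "continuous_into E S F \<longleftrightarrow>
    (\<forall>t\<in>S. F t \<in> carr E) \<and>
    (\<forall>s\<in>S. ((\<lambda>t. ndist E (F t) (F s)) \<longlongrightarrow> 0) (at s within S))"

lemma ndist_full: "ndist full x y = dist x y"
proof -
  have "(-1) *\<^sub>C y = - y"
    using scaleC_of_real[of "-1" y] by simp
  thus ?thesis by (simp add: ndist_def full_def dist_norm)
qed

lemma continuous_into_full: "continuous_into full S F \<longleftrightarrow> continuous_on S F"
  unfolding continuous_into_def ndist_full continuous_on_def
  by (subst tendsto_dist_iff) (simp add: full_def)


section \<open>Quotients by closed two-sided ideals\<close>

definition closed_two_sided_ideal :: "'d::cstar_algebra set \<Rightarrow> bool" where
  "closed_two_sided_ideal I \<longleftrightarrow>
    closed I \<and> 0 \<in> I \<and> (\<forall>x\<in>I. \<forall>y\<in>I. x + y \<in> I) \<and> (\<forall>c. \<forall>x\<in>I. c *\<^sub>C x \<in> I) \<and>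
    (\<forall>d. \<forall>x\<in>I. d * x \<in> I \<and> x * d \<in> I)"

definition qmap :: "'d::cstar_algebra set \<Rightarrow> 'd \<Rightarrow> 'd set" where
  "qmap I d = (\<lambda>x. d + x) ` I"

text \<open>
  The operations on cosets are unions over all representatives; for an ideal \<open>I\<close> all members
  of such a union coincide, see \<open>quotient_ops\<close> below.  For \<open>adj\<close> this uses that closed
  two-sided ideals of C*-algebras are self-adjoint.
\<close>

definition quotient_alg :: "'d::cstar_algebra set \<Rightarrow> 'd set star_alg" where
  "quotient_alg I = \<lparr>
    carr = range (qmap I),
    add = (\<lambda>X Y. \<Union>x\<in>X. \<Union>y\<in>Y. qmap I (x + y)),
    scl = (\<lambda>c X. \<Union>x\<in>X. qmap I (c *\<^sub>C x)),
    mul = (\<lambda>X Y. \<Union>x\<in>X. \<Union>y\<in>Y. qmap I (x * y)),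
    adj = (\<lambda>X. \<Union>x\<in>X. qmap I (star x)),
    nrm = (\<lambda>X. INF x\<in>X. norm x)\<rparr>"

lemma quotient_ops:
  fixes I :: "'a::cstar_algebra set"
  assumes I: "closed_two_sided_ideal I"
  shows qmap_eq_iff: "qmap I x = qmap I y \<longleftrightarrow> x - y \<in> I"
    and "add (quotient_alg I) (qmap I x) (qmap I y) = qmap I (x + y)"
    and "scl (quotient_alg I) c (qmap I x) = qmap I (c *\<^sub>C x)"
    and "mul (quotient_alg I) (qmap I x) (qmap I y) = qmap I (x * y)"
    and "star ` I \<subseteq> I \<Longrightarrow> adj (quotient_alg I) (qmap I x) = qmap I (star x)"
    and "nrm (quotient_alg I) (qmap I x) = infdist x I"
proof -
  have zero: "0 \<in> I" and plus: "\<And>x y. x \<in> I \<Longrightarrow> y \<in> I \<Longrightarrow> x + y \<in> I"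
    and scale: "\<And>c x. x \<in> I \<Longrightarrow> c *\<^sub>C x \<in> I"
    and left: "\<And>d x. x \<in> I \<Longrightarrow> d * x \<in> I" and right: "\<And>d x. x \<in> I \<Longrightarrow> x * d \<in> I"
    using I by (auto simp: closed_two_sided_ideal_def)
  have neg: "- x \<in> I" if "x \<in> I" for x
    using scale[OF that, of "-1"] scaleC_of_real[of "-1" x] by simp
  have mem: "z \<in> qmap I x \<longleftrightarrow> z - x \<in> I" for z x
    unfolding qmap_def by (auto simp: image_iff intro!: bexI[of _ "z - x"])
  have eq: "qmap I x = qmap I y \<longleftrightarrow> x - y \<in> I" for x y
  proof
    assume "qmap I x = qmap I y"
    thus "x - y \<in> I" using mem[of x x] mem[of x y] zero by simp
  next
    assume xy: "x - y \<in> I"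
    have "z - x \<in> I \<longleftrightarrow> z - y \<in> I" for z
      using plus[OF _ xy, of "z - x"] plus[OF _ neg[OF xy], of "z - y"] by auto
    thus "qmap I x = qmap I y" by (auto simp: mem)
  qed
  show "qmap I x = qmap I y \<longleftrightarrow> x - y \<in> I" by (rule eq)
  have ne: "x \<in> qmap I x" for x using mem zero by simp
  have U1: "(\<Union>x'\<in>qmap I x. qmap I (f x')) = qmap I (f x)"
    if f: "\<And>x'. x' - x \<in> I \<Longrightarrow> f x' - f x \<in> I" for f :: "'a \<Rightarrow> 'a" and x
  proof -
    have "qmap I (f x') = qmap I (f x)" if "x' \<in> qmap I x" for x'
      using f that by (simp add: eq mem)
    thus ?thesis using ne[of x] by blast
  qed
  have U2: "(\<Union>x'\<in>qmap I x. \<Union>y'\<in>qmap I y. qmap I (f x' y')) = qmap I (f x y)"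
    if f: "\<And>x' y'. x' - x \<in> I \<Longrightarrow> y' - y \<in> I \<Longrightarrow> f x' y' - f x y \<in> I" for f :: "'a \<Rightarrow> 'a \<Rightarrow> 'a" and x y
  proof -
    have "qmap I (f x' y') = qmap I (f x y)" if "x' \<in> qmap I x" "y' \<in> qmap I y" for x' y'
      using f that by (simp add: eq mem)
    thus ?thesis using ne[of x] ne[of y] by blast
  qed
  have d: "c *\<^sub>C u - c *\<^sub>C v = c *\<^sub>C (u - v)" for c and u v :: 'a
    by (metis add_diff_cancel diff_add_cancel scaleC_add_right)
  have s: "star u - star v = star (u - v)" for u v :: 'a
    by (metis add_diff_cancel diff_add_cancel star_add)
  show "add (quotient_alg I) (qmap I x) (qmap I y) = qmap I (x + y)"
    unfolding quotient_alg_def star_alg.simps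
    by (rule U2) (simp add: add_diff_add plus)
  show "scl (quotient_alg I) c (qmap I x) = qmap I (c *\<^sub>C x)"
    unfolding quotient_alg_def star_alg.simps by (rule U1) (simp add: d scale)
  show "mul (quotient_alg I) (qmap I x) (qmap I y) = qmap I (x * y)"
    unfolding quotient_alg_def star_alg.simps
  proof (rule U2)
    fix x' y' assume "x' - x \<in> I" "y' - y \<in> I"
    hence "(x' - x) * y' + x * (y' - y) \<in> I" by (intro plus left right)
    thus "x' * y' - x * y \<in> I" by (simp add: algebra_simps)
  qed
  show "adj (quotient_alg I) (qmap I x) = qmap I (star x)" if "star ` I \<subseteq> I"
    unfolding quotient_alg_def star_alg.simps by (rule U1) (use that s in auto)
  have "(\<lambda>z. norm (x + z)) ` I = dist x ` I"
  proof -
    have "norm (x + z) = dist x (- z)" for z by (simp add: dist_norm)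
    hence "(\<lambda>z. norm (x + z)) ` I = dist x ` uminus ` I" by (simp add: image_image)
    also have "uminus ` I = I" using neg by (force simp: image_iff)
    finally show ?thesis .
  qed
  thus "nrm (quotient_alg I) (qmap I x) = infdist x I"
    using zero by (auto simp: quotient_alg_def qmap_def infdist_def image_image)
qed


section \<open>Continuous functions on the unit interval\<close>

text \<open>
  \<open>E \<otimes> C[0,1]\<close> in its standard form \<open>C([0,1], E)\<close>, where \<open>e \<otimes> g\<close> is the function
  \<open>t \<mapsto> g(t) e\<close> and \<open>ev\<^sub>t\<close> is evaluation at \<open>t\<close>.  Functions are \<open>undefined\<close> outside of \<open>[0,1]\<close>.
\<close>

definition C01 :: "'e star_alg \<Rightarrow> (real \<Rightarrow> 'e) star_alg" where
  "C01 E = \<lparr>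
    carr = {F. F \<in> extensional {0..1} \<and> continuous_into E {0..1} F},
    add = (\<lambda>F G. \<lambda>t\<in>{0..1}. add E (F t) (G t)),
    scl = (\<lambda>c F. \<lambda>t\<in>{0..1}. scl E c (F t)),
    mul = (\<lambda>F G. \<lambda>t\<in>{0..1}. mul E (F t) (G t)),
    adj = (\<lambda>F. \<lambda>t\<in>{0..1}. adj E (F t)),
    nrm = (\<lambda>F. SUP t\<in>{0..1}. nrm E (F t))\<rparr>"

definition ev :: "real \<Rightarrow> (real \<Rightarrow> 'e) \<Rightarrow> 'e" where
  "ev t F = F t"

text \<open>The map \<open>h \<otimes> id\<close> on \<open>C[0,1]\<close>-valued functions.\<close>

definition tensor_id :: "('d \<Rightarrow> 'e) \<Rightarrow> (real \<Rightarrow> 'd) \<Rightarrow> real \<Rightarrow> 'e" where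
  "tensor_id h F = (\<lambda>t\<in>{0..1}. h (F t))"


section \<open>Homomorphisms, homotopies and asymptotic homomorphisms\<close>

definition star_hom :: "'a star_alg \<Rightarrow> 'e star_alg \<Rightarrow> ('a \<Rightarrow> 'e) \<Rightarrow> bool" where
  "star_hom A E f \<longleftrightarrow>
    (\<forall>a\<in>carr A. f a \<in> carr E) \<and>
    (\<forall>a\<in>carr A. \<forall>b\<in>carr A. f (add A a b) = add E (f a) (f b)) \<and>
    (\<forall>c. \<forall>a\<in>carr A. f (scl A c a) = scl E c (f a)) \<and>
    (\<forall>a\<in>carr A. \<forall>b\<in>carr A. f (mul A a b) = mul E (f a) (f b)) \<and>
    (\<forall>a\<in>carr A. f (adj A a) = adj E (f a))"

definition homotopy_between ::
  "'b star_alg \<Rightarrow> 'e star_alg \<Rightarrow> ('b \<Rightarrow> real \<Rightarrow> 'e) \<Rightarrow> ('b \<Rightarrow> 'e) \<Rightarrow> ('b \<Rightarrow> 'e) \<Rightarrow> bool" where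
  "homotopy_between B E \<Phi> \<phi> \<psi> \<longleftrightarrow>
    star_hom B (C01 E) \<Phi> \<and> (\<forall>b\<in>carr B. ev 1 (\<Phi> b) = \<phi> b) \<and> (\<forall>b\<in>carr B. ev 0 (\<Phi> b) = \<psi> b)"

definition homotopic ::
  "'b star_alg \<Rightarrow> 'e star_alg \<Rightarrow> ('b \<Rightarrow> 'e) \<Rightarrow> ('b \<Rightarrow> 'e) \<Rightarrow> bool" where
  "homotopic B E \<phi> \<psi> \<longleftrightarrow> (\<exists>\<Phi>. homotopy_between B E \<Phi> \<phi> \<psi>)"

text \<open>The three limit conditions along an arbitrary filter on the parameter set.\<close>

definition asymptotically_star_hom ::
  "'i filter \<Rightarrow> 'a star_alg \<Rightarrow> 'e star_alg \<Rightarrow> ('i \<Rightarrow> 'a \<Rightarrow> 'e) \<Rightarrow> bool" where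
  "asymptotically_star_hom \<F> A E f \<longleftrightarrow>
    (\<forall>a\<in>carr A. ((\<lambda>i. ndist E (f i (adj A a)) (adj E (f i a))) \<longlongrightarrow> 0) \<F>) \<and>
    (\<forall>a\<in>carr A. \<forall>b\<in>carr A. \<forall>\<mu>\<^sub>1 \<mu>\<^sub>2.
      ((\<lambda>i. ndist E (f i (add A (scl A \<mu>\<^sub>1 a) (scl A \<mu>\<^sub>2 b)))
                   (add E (scl E \<mu>\<^sub>1 (f i a)) (scl E \<mu>\<^sub>2 (f i b)))) \<longlongrightarrow> 0) \<F>) \<and>
    (\<forall>a\<in>carr A. \<forall>b\<in>carr A.
      ((\<lambda>i. ndist E (f i (mul A a b)) (mul E (f i a) (f i b))) \<longlongrightarrow> 0) \<F>)"

text \<open>Only the values at parameters in \<open>[0,\<infinity>)\<close> are relevant.\<close>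

definition asymptotic_hom ::
  "'a star_alg \<Rightarrow> 'e star_alg \<Rightarrow> (real \<Rightarrow> 'a \<Rightarrow> 'e) \<Rightarrow> bool" where
  "asymptotic_hom A E f \<longleftrightarrow>
    (\<forall>a\<in>carr A. continuous_into E {0..} (\<lambda>l. f l a)) \<and> asymptotically_star_hom at_top A E f"

definition discrete_asymptotic_hom ::
  "'a star_alg \<Rightarrow> 'e star_alg \<Rightarrow> (nat \<Rightarrow> 'a \<Rightarrow> 'e) \<Rightarrow> bool" where
  "discrete_asymptotic_hom A E f \<longleftrightarrow>
    (\<forall>n. \<forall>a\<in>carr A. f n a \<in> carr E) \<and>
    (\<forall>a\<in>carr A. bdd_above (range (\<lambda>n. nrm E (f n a)))) \<and>
    asymptotically_star_hom sequentially A E f"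

text \<open>Lifting of \<open>f\<close> along a map \<open>q\<close> that is defined on \<open>D\<close>.\<close>

definition lifts_to_asymptotic_hom ::
  "'b star_alg \<Rightarrow> 'd star_alg \<Rightarrow> ('d \<Rightarrow> 'e) \<Rightarrow> ('b \<Rightarrow> 'e) \<Rightarrow> bool" where
  "lifts_to_asymptotic_hom B D q f \<longleftrightarrow>
    (\<exists>h. asymptotic_hom B D h \<and> (\<forall>l\<ge>0. \<forall>b\<in>carr B. q (h l b) = f b))"

definition lifts_to_discrete_asymptotic_hom ::
  "'b star_alg \<Rightarrow> 'd star_alg \<Rightarrow> ('d \<Rightarrow> 'e) \<Rightarrow> ('b \<Rightarrow> 'e) \<Rightarrow> bool" where
  "lifts_to_discrete_asymptotic_hom B D q f \<longleftrightarrow>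
    (\<exists>h. discrete_asymptotic_hom B D h \<and> (\<forall>n. \<forall>b\<in>carr B. q (h n b) = f b))"

end

theory Submission
  imports Defs
begin

text \<open>
  Let \<open>\<Phi>\<close> be the homotopy, \<open>\<sigma> b\<close> a continuous path in \<open>D\<close> over the path \<open>t \<mapsto> \<Phi> b t\<close>, and \<open>h\<close> the
  given lift of \<open>\<psi>\<close>.  Take an approximate unit \<open>e\<^sub>0, e\<^sub>1, \<dots>\<close> of \<open>I\<close> in which every member is almost a
  unit for its predecessors and which almost commutes with all elements that occur, and put
  \<open>\<Psi>\<^sub>l(b)(t) = \<Sum>\<^sub>k (e\<^sub>k - e\<^bsub>k-1\<^esub>) v\<^sub>k\<close>.  The sequence \<open>v\<close> depends on \<open>b, l, t\<close>: it is \<open>h\<^sub>l(b)\<close> for small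
  \<open>k\<close>, then passes to \<open>\<sigma> b 0\<close>, which lies in the same coset, and afterwards follows \<open>\<sigma> b\<close> from \<open>0\<close> to
  \<open>t\<close> in small steps, where it stays.  As the \<open>e\<^sub>k\<close> lie in \<open>I\<close>, only this last value is seen in the quotient,
  so \<open>\<Psi>\<^sub>l\<close> lifts \<open>\<Phi>\<close> exactly (\<open>spliced_lift\<close>).

  \<open>\<Psi>\<close> is almost multiplicative for the following reasons.  Distant layers \<open>e\<^sub>k - e\<^bsub>k-1\<^esub>\<close> are almost orthogonal,
  so products may be computed in each layer.  In the inner layers the defect is that of \<open>h\<^sub>l\<close>, which
  tends to \<open>0\<close>.  In the other layers the defect of \<open>v\<^sub>k\<close> lies in \<open>I\<close>, and the layer annihilates it, because
  \<open>e\<^bsub>k-1\<^esub>\<close> was chosen as an almost unit for it (\<open>norm_splice_killed\<close>).  Neighbouring layers overlap,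
  and this leaves \<open>\<Sum>\<^sub>k (e\<^sub>k - e\<^sub>k\<^sup>2) D\<^sub>k D'\<^sub>k\<close> with \<open>D\<^sub>k, D'\<^sub>k\<close> the steps of the two sequences.  The number of
  terms grows while the steps shrink at an uncontrolled rate, but the terms are almost orthogonal, so
  the norm of the sum is about that of its largest term (\<open>norm_layer_sum\<close>, \<open>norm_splice_mult\<close>).

  All facts on C*-algebras come from the C*-identity.  It yields \<open>\<parallel>x\<^sup>n\<parallel> = \<parallel>x\<parallel>\<^sup>n\<close> for self-adjoint \<open>x\<close> and \<open>n\<close> a
  power of \<open>2\<close>, hence the norm of sums of almost orthogonal elements (\<open>max_norm_tolerance_exists\<close>).  A
  self-adjoint \<open>a\<close> with \<open>\<parallel>a\<parallel> < 1\<close> is the real part of the unitary \<open>a + \<i>(1 - a\<^sup>2)\<^bsup>1/2\<^esup>\<close>, which gives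
  contractivity of homomorphisms, also asymptotically (\<open>asymptotic_on_bound\<close>), and
  \<open>\<parallel>1 - a\<^sup>2\<parallel> \<le> 1\<close>, from which approximate units arise as ergodic means (\<open>approximate_unit_single\<close>).  Averaging
  over an approximate unit makes it quasicentral (\<open>quasicentral_finite\<close>).

  An approximate unit can be adapted to countably many families only.  The construction is therefore carried
  out on a countable dense subalgebra that is closed under \<open>a \<mapsto> 1 - (1 - a\<^sup>2)\<^bsup>1/2\<^esup>\<close>; asymptotic
  contractivity holds on it, and \<open>\<Psi>\<close> extends by convergent series (\<open>extend_at\<close>).  The parameters range over a
  closed unbounded set \<open>S\<close> of nonnegative reals, which is the half line for asymptotic homomorphisms
  and the set of natural numbers for discrete ones.
\<close>

section \<open>Elementary facts on C*-algebras\<close>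

lemma scaleC_one [simp]: "1 *\<^sub>C (x::'a::cstar_algebra) = x"
  using scaleC_of_real[of 1 x] by simp

lemma scaleC_minus1 [simp]: "(-1) *\<^sub>C (x::'a::cstar_algebra) = - x"
  using scaleC_of_real[of "-1" x] by simp

lemma scaleC_zero_right [simp]: "c *\<^sub>C (0::'a::cstar_algebra) = 0"
  using scaleC_add_right[of c 0 "0::'a"] by simp

lemma scaleC_zero_left [simp]: "0 *\<^sub>C (x::'a::cstar_algebra) = 0"
  using norm_scaleC[of 0 x] by simp

lemma scaleC_minus_right: "c *\<^sub>C (- (x::'a::cstar_algebra)) = - (c *\<^sub>C x)"
  using scaleC_add_right[of c x "-x"] by (simp add: eq_neg_iff_add_eq_0 add.commute)

lemma scaleC_diff_right: "c *\<^sub>C ((x::'a::cstar_algebra) - y) = c *\<^sub>C x - c *\<^sub>C y"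
  using scaleC_add_right[of c x "-y"] by (simp add: scaleC_minus_right)

lemma star_zero [simp]: "star (0::'a::cstar_algebra) = 0"
  using star_add[of 0 "0::'a"] by simp

lemma star_minus: "star (- (x::'a::cstar_algebra)) = - star x"
  using star_add[of x "-x"] by (simp add: eq_neg_iff_add_eq_0 add.commute)

lemma star_diff: "star ((x::'a::cstar_algebra) - y) = star x - star y"
  using star_add[of x "-y"] by (simp add: star_minus)

lemma star_scaleR: "star (r *\<^sub>R (x::'a::cstar_algebra)) = r *\<^sub>R star x"
  using star_scaleC[of "complex_of_real r" x] by (simp add: scaleC_of_real)

lemma star_sum: "star (\<Sum>i\<in>A. f i) = (\<Sum>i\<in>A. star (f i :: 'a::cstar_algebra))"
  by (induction A rule: infinite_finite_induct) (auto simp: star_add)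

lemma norm_star [simp]: "norm (star (x::'a::cstar_algebra)) = norm x"
proof -
  have le: "norm z \<le> norm (star z)" for z :: 'a
  proof (cases "norm z = 0")
    case False
    have "(norm z)\<^sup>2 \<le> norm (star z) * norm z"
      using cstar_identity[of z] norm_mult_ineq[of "star z" z] by simp
    thus ?thesis using False by (simp add: power2_eq_square)
  qed simp
  show ?thesis using le[of x] le[of "star x"] by (simp add: star_star)
qed

lemma norm_mult_star: "norm (x * star x) = (norm (x::'a::cstar_algebra))\<^sup>2"
  using cstar_identity[of "star x"] by (simp add: star_star)

lemma norm_selfadjoint_square:
  "star x = x \<Longrightarrow> norm (x * x) = (norm (x::'a::cstar_algebra))\<^sup>2"
  using cstar_identity[of x] by simp

lemma bounded_linear_star: "bounded_linear (star :: 'a::cstar_algebra \<Rightarrow> 'a)"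
  by (rule bounded_linear_intro[of _ 1]) (auto simp: star_add star_scaleR)

lemma bounded_linear_scaleC: "bounded_linear ((*\<^sub>C) c :: 'a::cstar_algebra \<Rightarrow> 'a)"
  by (rule bounded_linear_intro[of _ "cmod c"])
     (auto simp: scaleC_add_right norm_scaleC mult.commute scaleC_scaleC simp flip: scaleC_of_real)

lemmas continuous_on_star [continuous_intros] =
  bounded_linear.continuous_on[OF bounded_linear_star]
lemmas continuous_on_scaleC [continuous_intros] =
  bounded_linear.continuous_on[OF bounded_linear_scaleC]

lemma norm_mult_le:
  "norm (x::'a::real_normed_algebra) \<le> r \<Longrightarrow> norm y \<le> s \<Longrightarrow> norm (x * y) \<le> r * s"
  by (smt (verit, best) mult_mono norm_ge_zero norm_mult_ineq)

section \<open>Almost orthogonal elements\<close>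

text \<open>
  For self-adjoint elements \<open>p, q\<close> with \<open>p q = 0\<close> one has \<open>(p + q)\<^sup>n = p\<^sup>n + q\<^sup>n\<close>, so the
  C*-identity, which gives \<open>\<parallel>x\<parallel>\<^sup>n = \<parallel>x\<^sup>n\<parallel>\<close> for \<open>n = 2\<^sup>r\<close>, bounds \<open>\<parallel>p + q\<parallel>\<close> by
  \<open>2\<^bsup>1/n\<^esup> max \<parallel>p\<parallel> \<parallel>q\<parallel>\<close>.  Squaring replaces \<open>(p, q)\<close> by \<open>(p\<^sup>2, q\<^sup>2)\<close>, which is the induction on \<open>r\<close>.
\<close>

lemma norm_add_selfadjoint_power:
  fixes R \<eta> :: real
  assumes "\<eta> > 0" "R \<ge> 0"
  shows "\<exists>\<delta>>0. \<forall>p q::'a::cstar_algebra. star p = p \<longrightarrow> star q = q \<longrightarrow> norm p \<le> R \<longrightarrow> norm q \<le> R \<longrightarrow>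
     norm (p * q) \<le> \<delta> \<longrightarrow> norm (p + q) ^ (2^r) \<le> norm p ^ (2^r) + norm q ^ (2^r) + \<eta>"
  using assms
proof (induction r arbitrary: R \<eta>)
  case 0
  have "norm (p + q) \<le> norm p + norm q + \<eta>" for p q :: 'a
    using norm_triangle_ineq[of p q] 0 by linarith
  thus ?case by (auto intro!: exI[of _ 1])
next
  case (Suc r)
  from Suc.IH[of "\<eta>/2" "R\<^sup>2"] Suc.prems obtain \<delta>1 where \<delta>1: "\<delta>1 > 0"
    "\<And>p q::'a. star p = p \<Longrightarrow> star q = q \<Longrightarrow> norm p \<le> R\<^sup>2 \<Longrightarrow> norm q \<le> R\<^sup>2 \<Longrightarrow>
     norm (p * q) \<le> \<delta>1 \<Longrightarrow> norm (p + q) ^ (2^r) \<le> norm p ^ (2^r) + norm q ^ (2^r) + \<eta>/2"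
    by auto
  have "uniformly_continuous_on {0..2*R\<^sup>2+1} (\<lambda>s::real. s ^ (2^r))"
    by (intro compact_uniformly_continuous continuous_intros compact_Icc)
  then obtain \<delta>2 where \<delta>2: "\<delta>2 > 0"
    "\<And>s t. s \<in> {0..2*R\<^sup>2+1} \<Longrightarrow> t \<in> {0..2*R\<^sup>2+1} \<Longrightarrow> dist t s < \<delta>2 \<Longrightarrow> dist (t^(2^r)) (s^(2^r)) < \<eta>/2"
    unfolding uniformly_continuous_on_def using Suc.prems
    by (metis half_gt_zero)
  define \<delta> where "\<delta> = min (\<delta>1 / (R\<^sup>2 + 1)) (min (\<delta>2/4) (1/2))"
  have \<delta>: "\<delta> > 0" using \<delta>1 \<delta>2 by (auto simp: \<delta>_def intro!: divide_pos_pos add_nonneg_pos)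
  show ?case
  proof (intro exI[of _ \<delta>] conjI \<delta> allI impI)
    fix p q :: 'a
    assume p: "star p = p" and q: "star q = q" and R: "norm p \<le> R" "norm q \<le> R"
      and pq: "norm (p * q) \<le> \<delta>"
    have np: "norm (p * p) = (norm p)\<^sup>2" "norm (q * q) = (norm q)\<^sup>2"
      using p q by (auto simp: norm_selfadjoint_square)
    have qp: "norm (q * p) \<le> \<delta>"
      using pq norm_star[of "p * q"] by (simp add: star_mult p q del: norm_star)
    have "norm ((p * p) * (q * q)) = norm (p * (p * q) * q)" by (simp add: mult.assoc)
    also have "\<dots> \<le> R * \<delta> * R" by (intro norm_mult_le R pq)
    also have "\<dots> \<le> \<delta>1"
    proof -
      have "R\<^sup>2 * \<delta> \<le> R\<^sup>2 * (\<delta>1 / (R\<^sup>2+1))" unfolding \<delta>_def by (intro mult_left_mono) auto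
      also have "\<dots> = \<delta>1 * (R\<^sup>2 / (R\<^sup>2+1))" by simp
      also have "\<dots> \<le> \<delta>1 * 1" using \<delta>1(1)
        by (intro mult_left_mono) (auto simp: divide_le_eq add_nonneg_pos)
      finally show ?thesis by (simp add: power2_eq_square mult_ac)
    qed
    finally have small: "norm ((p * p) * (q * q)) \<le> \<delta>1" .
    have IH: "norm (p*p + q*q) ^ (2^r) \<le> norm (p*p) ^ (2^r) + norm (q*q) ^ (2^r) + \<eta>/2"
      by (rule \<delta>1(2)[OF _ _ _ _ small]) (auto simp: star_mult p q np R power_mono)
    have sq: "(norm (p+q))\<^sup>2 \<le> norm (p*p + q*q) + 2*\<delta>"
    proof -
      have "(norm (p+q))\<^sup>2 = norm ((p+q)*(p+q))"
        by (rule norm_selfadjoint_square[symmetric]) (simp add: star_add p q)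
      also have "(p+q)*(p+q) = (p*p+q*q) + (p*q + q*p)" by (simp add: algebra_simps)
      also have "norm \<dots> \<le> norm (p*p+q*q) + (norm (p*q) + norm (q*p))"
        by (meson norm_triangle_ineq norm_triangle_mono order.refl order_trans)
      finally show ?thesis using pq qp by linarith
    qed
    define s where "s = norm (p*p + q*q)"
    have s: "0 \<le> s" "s \<le> 2*R\<^sup>2"
    proof -
      have "(norm p)\<^sup>2 \<le> R\<^sup>2" "(norm q)\<^sup>2 \<le> R\<^sup>2" using R by (auto intro: power_mono)
      thus "s \<le> 2*R\<^sup>2" unfolding s_def
        using norm_triangle_ineq[of "p*p" "q*q"] np by linarith
    qed (simp add: s_def)
    have "\<delta> \<le> \<delta>2/4" "\<delta> \<le> 1/2" unfolding \<delta>_def by linarith+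
    hence "dist ((s+2*\<delta>)^(2^r)) (s^(2^r)) < \<eta>/2"
      by (intro \<delta>2(2)) (use s \<delta> \<delta>2(1) in \<open>auto simp: dist_real_def\<close>)
    hence "(s+2*\<delta>)^(2^r) \<le> s^(2^r) + \<eta>/2" unfolding dist_real_def by linarith
    moreover have "(norm (p+q))^(2^Suc r) \<le> (s+2*\<delta>)^(2^r)"
    proof -
      have "(norm (p+q))^(2^Suc r) = ((norm (p+q))\<^sup>2)^(2^r)" by (simp flip: power_mult)
      also have "\<dots> \<le> (s+2*\<delta>)^(2^r)" using sq by (intro power_mono) (auto simp: s_def)
      finally show ?thesis .
    qed
    ultimately show "norm (p + q) ^ (2^Suc r) \<le> norm p ^ (2^Suc r) + norm q ^ (2^Suc r) + \<eta>"
      using IH by (simp add: s_def np flip: power_mult)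
  qed
qed

lemma power_add_power_le:
  assumes "(x::real) \<ge> 0" "y \<ge> 0" "n > 0"
  shows "x ^ n + y ^ n \<le> (x + y) ^ n"
  using \<open>n > 0\<close>
proof (induction n rule: nat_induct_non_zero)
  case (Suc n)
  have "x ^ Suc n + y ^ Suc n \<le> (x ^ n + y ^ n) * (x + y)"
    using assms by (simp add: algebra_simps)
  also have "\<dots> \<le> (x + y) ^ n * (x + y)" using Suc assms by (intro mult_right_mono) auto
  finally show ?case by (simp add: mult.commute)
qed simp

lemma norm_add_almost_orthogonal_selfadjoint:
  fixes R \<eta> :: real
  assumes "\<eta> > 0" "R > 0"
  shows "\<exists>\<delta>>0. \<forall>p q::'a::cstar_algebra. star p = p \<longrightarrow> star q = q \<longrightarrow> norm p \<le> R \<longrightarrow> norm q \<le> R \<longrightarrow>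
     norm (p * q) \<le> \<delta> \<longrightarrow> norm (p + q) \<le> max (norm p) (norm q) + \<eta>"
proof -
  define e where "e = \<eta>/2"
  have e: "e > 0" using assms by (simp add: e_def)
  obtain r :: nat where r: "R / e < 2^r"
    using real_arch_pow[of 2 "R/e"] by auto
  define n where "n = (2::nat)^r"
  have n: "R / e \<le> real n" "n > 0" using r by (auto simp: n_def)
  obtain \<delta> where \<delta>: "\<delta> > 0"
    "\<And>p q::'a. star p = p \<Longrightarrow> star q = q \<Longrightarrow> norm p \<le> R \<Longrightarrow> norm q \<le> R \<Longrightarrow>
     norm (p * q) \<le> \<delta> \<Longrightarrow> norm (p + q) ^ n \<le> norm p ^ n + norm q ^ n + e^n"
    using norm_add_selfadjoint_power[of "e^n" R r, where 'a='a] assms e unfolding n_def by auto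
  show ?thesis
  proof (intro exI[of _ \<delta>] conjI \<delta>(1) allI impI)
    fix p q :: 'a
    assume p: "star p = p" and q: "star q = q" and R: "norm p \<le> R" "norm q \<le> R"
      and pq: "norm (p * q) \<le> \<delta>"
    define M where "M = max (norm p) (norm q)"
    have M: "0 \<le> M" "M \<le> R" using R by (auto simp: M_def le_max_iff_disj)
    have "norm p ^ n \<le> M^n" "norm q ^ n \<le> M^n" by (auto simp: M_def intro!: power_mono)
    hence 1: "norm (p+q)^n \<le> 2 * M^n + e^n" using \<delta>(2)[OF p q R pq] by linarith
    \<comment> \<open>by Bernoulli's inequality \<open>n\<close> is large enough to absorb the factor 2\<close>
    have "1 + real n * (e/R) \<le> (1 + e/R)^n"
      by (rule Bernoulli_inequality) (use assms e in \<open>simp add: order_trans[of _ 0]\<close>)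
    moreover have "1 \<le> real n * (e/R)" using n e assms by (simp add: field_simps)
    ultimately have "2 * M^n \<le> (1 + e/R)^n * M^n" using M
      by (intro mult_right_mono) auto
    also have "\<dots> = (M + M/R * e)^n" by (simp flip: power_mult_distrib add: algebra_simps)
    also have "\<dots> \<le> (M + e)^n"
    proof (intro power_mono add_left_mono)
      have "M/R*e \<le> 1*e" using M assms e by (intro mult_right_mono) auto
      thus "M/R*e \<le> e" by simp
    qed (use M e assms in auto)
    finally have "norm (p+q)^n \<le> (M+e)^n + e^n" using 1 by linarith
    also have "\<dots> \<le> (M + e + e)^n" using M e n by (intro power_add_power_le) auto
    finally have "norm (p+q) \<le> M + e + e"
      using M e n(2) by (meson add_nonneg_nonneg less_imp_le power_mono_iff norm_ge_zero)
    thus "norm (p+q) \<le> max (norm p) (norm q) + \<eta>" by (simp add: M_def e_def)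
  qed
qed

text \<open>
  A predicate rather than an existential statement, because approximate units are chosen to meet
  tolerances that have been fixed beforehand.
\<close>

definition max_norm_tolerance :: "'a::cstar_algebra itself \<Rightarrow> real \<Rightarrow> real \<Rightarrow> real \<Rightarrow> bool" where
  "max_norm_tolerance T R \<eta> \<delta> \<longleftrightarrow> \<delta> > 0 \<and>
     (\<forall>a b::'a. norm a \<le> R \<longrightarrow> norm b \<le> R \<longrightarrow> norm (star a * b) \<le> \<delta> \<longrightarrow>
     norm (a * star b) \<le> \<delta> \<longrightarrow> norm (a + b) \<le> max (norm a) (norm b) + \<eta>)"

text \<open>
  The general case follows from \<open>\<parallel>a + b\<parallel>\<^sup>2 \<approx> \<parallel>a\<^sup>*a + b\<^sup>*b\<parallel>\<close> and
  \<open>(a\<^sup>*a) (b\<^sup>*b) = a\<^sup>* (a b\<^sup>*) b \<approx> 0\<close>.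
\<close>

lemma max_norm_tolerance_exists:
  fixes R \<eta> :: real
  assumes "\<eta> > 0" "R > 0"
  shows "\<exists>\<delta>. max_norm_tolerance TYPE('a::cstar_algebra) R \<eta> \<delta>"
proof -
  define e where "e = \<eta>\<^sup>2/2"
  have e: "e > 0" using assms by (simp add: e_def)
  obtain \<delta>1 where \<delta>1: "\<delta>1 > 0"
    "\<And>p q::'a. star p = p \<Longrightarrow> star q = q \<Longrightarrow> norm p \<le> R\<^sup>2 \<Longrightarrow> norm q \<le> R\<^sup>2 \<Longrightarrow>
     norm (p * q) \<le> \<delta>1 \<Longrightarrow> norm (p + q) \<le> max (norm p) (norm q) + e"
    using norm_add_almost_orthogonal_selfadjoint[of e "R\<^sup>2", where 'a='a] assms e by auto
  define \<delta> where "\<delta> = min (\<delta>1 / R\<^sup>2) (e/2)"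
  have \<delta>: "\<delta> > 0" using \<delta>1 e assms by (auto simp: \<delta>_def)
  show ?thesis unfolding max_norm_tolerance_def
  proof (intro exI[of _ \<delta>] conjI \<delta> allI impI)
    fix a b :: 'a
    assume R: "norm a \<le> R" "norm b \<le> R" and ab: "norm (star a * b) \<le> \<delta>" "norm (a * star b) \<le> \<delta>"
    define p q where "p = star a * a" and "q = star b * b"
    have np: "norm p = (norm a)\<^sup>2" "norm q = (norm b)\<^sup>2" by (auto simp: p_def q_def cstar_identity)
    have "norm (p * q) = norm (star a * (a * star b) * b)" by (simp add: p_def q_def mult.assoc)
    also have "\<dots> \<le> R * \<delta> * R" by (intro norm_mult_le) (auto simp: R ab)
    also have "\<dots> \<le> \<delta>1"
    proof -
      have "R\<^sup>2 * \<delta> \<le> R\<^sup>2 * (\<delta>1 / R\<^sup>2)" unfolding \<delta>_def by (intro mult_left_mono) auto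
      thus ?thesis using assms by (simp add: power2_eq_square mult_ac)
    qed
    finally have pq: "norm (p + q) \<le> max (norm p) (norm q) + e"
      by (intro \<delta>1(2)) (auto simp: np p_def q_def star_mult star_star R cstar_identity intro!: power_mono)
    have ba: "norm (star b * a) \<le> \<delta>"
      using ab(1) norm_star[of "star a * b"] by (simp add: star_mult star_star del: norm_star)
    have "(norm (a+b))\<^sup>2 = norm (star (a+b) * (a+b))" by (simp add: cstar_identity)
    also have "star (a+b) * (a+b) = (p+q) + (star a * b + star b * a)"
      by (simp add: star_add algebra_simps p_def q_def)
    also have "norm \<dots> \<le> norm (p+q) + (norm (star a * b) + norm (star b * a))"
      by (meson norm_triangle_ineq norm_triangle_mono order.refl order_trans)
    also have "\<dots> \<le> max (norm p) (norm q) + e + 2*\<delta>" using pq ab ba by linarith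
    also have "\<dots> \<le> max (norm p) (norm q) + \<eta>\<^sup>2" by (simp add: \<delta>_def e_def)
    also have "max (norm p) (norm q) = (max (norm a) (norm b))\<^sup>2"
      unfolding np by (smt (verit, best) max_def norm_ge_zero power_mono)
    also have "\<dots> + \<eta>\<^sup>2 \<le> (max (norm a) (norm b) + \<eta>)\<^sup>2"
      using assms by (simp add: power2_sum le_max_iff_disj)
    finally show "norm (a+b) \<le> max (norm a) (norm b) + \<eta>"
      using assms by (smt (verit, best) norm_ge_zero power2_le_imp_le)
  qed
qed

lemma norm_sum_almost_orthogonal:
  fixes w :: "nat \<Rightarrow> 'a::cstar_algebra"
  assumes "\<And>k. k < n \<Longrightarrow> max_norm_tolerance TYPE('a) (R k) (\<eta> k) (\<delta> k)"
    and "\<And>k. k < n \<Longrightarrow> norm (\<Sum>j<k. w j) \<le> R k" "\<And>k. k < n \<Longrightarrow> norm (w k) \<le> R k"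
    and "\<And>k. k < n \<Longrightarrow> norm (star (\<Sum>j<k. w j) * w k) \<le> \<delta> k"
    and "\<And>k. k < n \<Longrightarrow> norm ((\<Sum>j<k. w j) * star (w k)) \<le> \<delta> k"
    and "\<And>k. k < n \<Longrightarrow> norm (w k) \<le> \<rho>" "\<rho> \<ge> 0" "\<And>k. k < n \<Longrightarrow> \<eta> k \<ge> 0"
  shows "norm (\<Sum>k<n. w k) \<le> \<rho> + (\<Sum>k<n. \<eta> k)"
  using assms
proof (induction n)
  case (Suc n)
  have "norm (\<Sum>k<Suc n. w k) \<le> max (norm (\<Sum>k<n. w k)) (norm (w n)) + \<eta> n"
    using Suc.prems(1)[of n] Suc.prems(2-5)[of n] by (simp add: max_norm_tolerance_def)
  also have "\<dots> \<le> (\<rho> + (\<Sum>k<n. \<eta> k)) + \<eta> n"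
  proof -
    have "norm (\<Sum>k<n. w k) \<le> \<rho> + (\<Sum>k<n. \<eta> k)" by (rule Suc.IH) (use Suc.prems in auto)
    moreover have "0 \<le> (\<Sum>k<n. \<eta> k)" by (intro sum_nonneg Suc.prems) auto
    ultimately show ?thesis using Suc.prems(6)[of n] by simp
  qed
  finally show ?case by simp
qed simp

section \<open>Square roots and C*-seminorms\<close>

text \<open>
  If \<open>b\<close> solves \<open>2b - b\<^sup>2 = a\<^sup>2\<close> then formally \<open>1 - b = (1 - a\<^sup>2)\<^bsup>1/2\<^esup>\<close>, so that
  \<open>a \<plusminus> \<i>(1 - b)\<close> are unitaries with mean \<open>a\<close>.
\<close>

definition is_cosine_complement :: "'a::cstar_algebra \<Rightarrow> 'a \<Rightarrow> bool" where
  "is_cosine_complement a b \<longleftrightarrow> star b = b \<and> a * b = b * a \<and> b + b - b * b = a * a"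

text \<open>The solution is the fixed point of the contraction \<open>b \<mapsto> (a\<^sup>2 + b\<^sup>2)/2\<close>.\<close>

lemma cosine_complement_exists:
  fixes a :: "'a::cstar_algebra"
  assumes a: "star a = a" "norm a < 1"
  shows "\<exists>b. is_cosine_complement a b"
proof -
  define r where "r = 1 - sqrt (1 - (norm a)\<^sup>2)"
  have na: "(norm a)\<^sup>2 < 1" using a by (simp add: abs_square_less_1)
  have r: "0 \<le> r" "r < 1" using na by (auto simp: r_def)
  have "(1 - r)\<^sup>2 = 1 - (norm a)\<^sup>2" using na by (simp add: r_def)
  hence r2: "(norm a)\<^sup>2 + r\<^sup>2 = 2 * r" by (simp add: power2_eq_square algebra_simps)
  define S where "S = {b. norm b \<le> r \<and> star b = b \<and> a * b = b * a}"
  define T where "T = (\<lambda>b. (1/2::real) *\<^sub>R (a * a + b * b))"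
  have "closed S"
    unfolding S_def
    by (intro closed_Collect_conj closed_Collect_le closed_Collect_eq continuous_intros)
  hence 1: "complete S" by (simp add: complete_eq_closed)
  have 2: "S \<noteq> {}" using r by (auto simp: S_def intro!: exI[of _ 0])
  have 3: "T ` S \<subseteq> S"
  proof (safe)
    fix b assume "b \<in> S"
    hence b: "norm b \<le> r" "star b = b" "a * b = b * a" by (auto simp: S_def)
    have "norm (a*a + b*b) \<le> norm a * norm a + r * r"
      by (rule norm_triangle_le, rule add_mono) (auto simp: norm_mult_ineq intro: norm_mult_le b)
    hence "norm (T b) \<le> r" using r2 by (simp add: T_def power2_eq_square)
    moreover have "star (T b) = T b" by (simp add: T_def star_scaleR star_add star_mult a b)
    moreover have "a * (b * b) = b * b * a"
      by (metis b(3) mult.assoc)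
    hence "a * T b = T b * a" by (simp add: T_def algebra_simps mult.assoc)
    ultimately show "T b \<in> S" by (simp add: S_def)
  qed
  have 4: "dist (T x) (T y) \<le> r * dist x y" if "x \<in> S" "y \<in> S" for x y
  proof -
    have "T x - T y = (1/2::real) *\<^sub>R ((x - y) * x + y * (x - y))"
      by (simp add: T_def algebra_simps)
    moreover have "norm ((x - y) * x + y * (x - y)) \<le> norm (x-y) * r + r * norm (x-y)"
      by (rule norm_triangle_le, rule add_mono) (use that in \<open>auto simp: S_def intro!: norm_mult_le\<close>)
    ultimately show ?thesis by (simp add: dist_norm)
  qed
  obtain b where b: "b \<in> S" "T b = b"
    using Banach_fix[OF 1 2 r 3] 4 by blast
  have "b + b = (2::real) *\<^sub>R T b" using b by (simp add: scaleR_2)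
  also have "\<dots> = a * a + b * b" by (simp add: T_def)
  finally show ?thesis using b by (intro exI[of _ b]) (auto simp: is_cosine_complement_def S_def)
qed

text \<open>
  The instances are the norm and, below, the quotient norm seen on the algebra itself, so that
  homomorphisms into a quotient and asymptotic homomorphisms have a common treatment.
\<close>

locale cstar_seminorm =
  fixes p :: "'d::cstar_algebra \<Rightarrow> real"
  assumes p_nonneg: "0 \<le> p x"
    and p_add: "p (x + y) \<le> p x + p y"
    and p_mult: "p (x * y) \<le> p x * p y"
    and p_scaleC: "p (c *\<^sub>C x) = cmod c * p x"
    and p_star: "p (star x) \<le> p x"
    and p_cstar: "(p x)\<^sup>2 \<le> p (star x * x)"
begin

lemma p_minus: "p (- x) = p x"
  using p_scaleC[of "-1" x] by simp

lemma p_diff: "p (x - y) \<le> p x + p y"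
  using p_add[of x "-y"] by (simp add: p_minus)

lemma p_triangle_ge: "p x \<le> p y + p (x - y)"
  using p_add[of y "x - y"] by simp

lemma p_star_eq: "p (star x) = p x"
  using p_star[of x] p_star[of "star x"] by (simp add: star_star)

text \<open>
  With \<open>U = d + \<i>(1 - g)\<close> the defect \<open>U\<^sup>*U - 1\<close> is
  \<open>(d\<^sup>2 + g\<^sup>2 - 2g) + \<i>(gd - dg)\<close>, so \<open>U\<close> is almost isometric for \<open>p\<close>; likewise its adjoint,
  and \<open>d\<close> is their mean.  The element \<open>x\<close> gives a meaning to \<open>1 - g\<close> without a unit.
\<close>

lemma seminorm_cosine_sine:
  assumes "star d = d" "star g = g"
    and "p (d * d + g * g - (g + g)) \<le> \<delta>" "p (d * g - g * d) \<le> \<delta>"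
  shows "p (d * x) \<le> sqrt (1 + 2*\<delta>) * p x" "p (x - g * x) \<le> sqrt (1 + 2*\<delta>) * p x"
proof -
  have \<delta>: "\<delta> \<ge> 0" using assms(3) p_nonneg order_trans by blast
  define s where "s = sqrt (1 + 2*\<delta>)"
  have bound: "p (d * x + c *\<^sub>C (x - g * x)) \<le> s * p x" if c: "c = \<i> \<or> c = -\<i>" for c
  proof -
    define u where "u = d * x + c *\<^sub>C (x - g * x)"
    define D where "D = (d * d + g * g - (g + g)) + c *\<^sub>C (g * d - d * g)"
    have cc: "cnj c * c = 1" "cnj c = - c" using c by auto
    have star_u: "star u = star x * d - c *\<^sub>C (star x - star x * g)"
    proof -
      have "star (c *\<^sub>C (x - g * x)) = (-1 * c) *\<^sub>C (star x - star x * g)"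
        using cc by (simp add: star_scaleC star_diff star_mult assms)
      also have "\<dots> = - (c *\<^sub>C (star x - star x * g))"
        unfolding scaleC_scaleC[symmetric] by simp
      finally show ?thesis by (simp add: u_def star_add star_mult assms)
    qed
    have c2: "c *\<^sub>C c *\<^sub>C z = - z" for z :: 'd
      using c by (auto simp: scaleC_scaleC)
    have expand: "(A - c *\<^sub>C B) * (C + c *\<^sub>C E)
        = A * C + c *\<^sub>C (A * E) - c *\<^sub>C (B * C) + B * E" for A B C E :: 'd
      by (simp add: algebra_simps scaleC_mult_left scaleC_mult_right scaleC_diff_right c2)
    have "star u * u = star x * d * (d * x) + c *\<^sub>C (star x * d * (x - g * x))
        - c *\<^sub>C ((star x - star x * g) * (d * x)) + (star x - star x * g) * (x - g * x)"
      unfolding star_u unfolding u_def by (rule expand)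
    also have "\<dots> = star x * x + star x * D * x"
      unfolding D_def
      by (simp add: algebra_simps scaleC_mult_left scaleC_mult_right
          scaleC_add_right scaleC_diff_right)
    finally have uu: "star u * u = star x * x + star x * D * x" .
    have "p D \<le> 2 * \<delta>"
    proof -
      have "p D \<le> p (d * d + g * g - (g + g)) + p (c *\<^sub>C (g * d - d * g))"
        unfolding D_def by (rule p_add)
      also have "p (c *\<^sub>C (g * d - d * g)) = p (d * g - g * d)"
        using c p_minus[of "d * g - g * d"] by (auto simp: p_scaleC)
      finally show ?thesis using assms by linarith
    qed
    have "(p u)\<^sup>2 \<le> p (star u * u)" by (rule p_cstar)
    also have "\<dots> \<le> p (star x * x) + p (star x * D * x)" unfolding uu by (rule p_add)
    also have "\<dots> \<le> p x * p x + p x * (2*\<delta>) * p x"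
    proof (rule add_mono)
      show "p (star x * x) \<le> p x * p x" using p_mult[of "star x" x] by (simp add: p_star_eq)
      have "p (star x * D * x) \<le> p (star x * D) * p x" by (rule p_mult)
      also have "\<dots> \<le> (p x * p D) * p x"
        using p_mult[of "star x" D] by (intro mult_right_mono) (auto simp: p_star_eq p_nonneg)
      also have "\<dots> \<le> (p x * (2*\<delta>)) * p x"
        using \<open>p D \<le> 2*\<delta>\<close> by (intro mult_right_mono mult_left_mono) (auto simp: p_nonneg)
      finally show "p (star x * D * x) \<le> p x * (2*\<delta>) * p x" .
    qed
    also have "\<dots> = (s * p x)\<^sup>2" using \<delta> by (simp add: s_def power2_eq_square algebra_simps)
    finally show ?thesis
      unfolding u_def by (rule power2_le_imp_le) (use \<delta> in \<open>auto simp: s_def p_nonneg\<close>)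
  qed
  define u v where "u = d * x + \<i> *\<^sub>C (x - g * x)" and "v = d * x + (-\<i>) *\<^sub>C (x - g * x)"
  have uv: "p u \<le> s * p x" "p v \<le> s * p x" unfolding u_def v_def by (auto intro: bound)
  have v: "v = d * x - \<i> *\<^sub>C (x - g * x)"
    using scaleC_scaleC[of "-1" \<i> "x - g * x"] by (simp add: v_def)
  have half: "(1/2) *\<^sub>C (z + z) = z" for z :: 'd
    by (simp add: scaleC_add_right flip: scaleC_add_left)
  have "d * x = (1/2) *\<^sub>C (u + v)"
    using half[of "d * x"] by (simp add: u_def v algebra_simps)
  moreover have "p (u + v) \<le> 2 * (s * p x)" using uv p_add[of u v] by linarith
  ultimately show "p (d * x) \<le> sqrt (1 + 2*\<delta>) * p x" by (simp add: p_scaleC s_def)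
  have "\<i> *\<^sub>C (x - g * x) = (1/2) *\<^sub>C (u - v)"
    using half[of "\<i> *\<^sub>C (x - g * x)"] by (simp add: u_def v algebra_simps)
  hence "cmod \<i> * p (x - g * x) = 1/2 * p (u - v)"
    using p_scaleC[of \<i> "x - g * x"] p_scaleC[of "1/2" "u - v"] by simp
  moreover have "p (u - v) \<le> 2 * (s * p x)" using uv p_diff[of u v] by linarith
  ultimately show "p (x - g * x) \<le> sqrt (1 + 2*\<delta>) * p x" by (simp add: s_def)
qed

lemma seminorm_cosine_sine_norms:
  assumes "star d = d" "star g = g"
    and "p (d * d + g * g - (g + g)) \<le> \<delta>" "p (d * g - g * d) \<le> \<delta>"
  shows "p d \<le> sqrt (1 + 2*\<delta>)" "p g \<le> 1 + sqrt (1 + 2*\<delta>)"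
proof -
  have \<delta>: "\<delta> \<ge> 0" using assms(3) p_nonneg order_trans by blast
  note * = seminorm_cosine_sine[OF assms]
  have "p d * p d \<le> p (d * d)" using p_cstar[of d] by (simp add: assms power2_eq_square)
  also have "\<dots> \<le> sqrt (1 + 2*\<delta>) * p d" by (rule *)
  finally show "p d \<le> sqrt (1 + 2*\<delta>)"
    by (cases "p d = 0") (use \<delta> p_nonneg[of d] in auto)
  have "p g * p g \<le> p (g * g)" using p_cstar[of g] by (simp add: assms power2_eq_square)
  also have "\<dots> \<le> p g + p (g * g - g)" by (rule p_triangle_ge)
  also have "p (g * g - g) = p (g - g * g)" using p_minus[of "g - g * g"] by simp
  also have "\<dots> \<le> sqrt (1 + 2*\<delta>) * p g" by (rule *)
  finally have "p g * p g \<le> (1 + sqrt (1 + 2*\<delta>)) * p g" by (simp add: algebra_simps)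
  thus "p g \<le> 1 + sqrt (1 + 2*\<delta>)"
    by (cases "p g = 0") (use \<delta> p_nonneg[of g] in auto)
qed

end

interpretation norm: cstar_seminorm "norm :: 'd::cstar_algebra \<Rightarrow> real"
  by unfold_locales (auto simp: norm_triangle_ineq norm_mult_ineq norm_scaleC cstar_identity)

text \<open>This says \<open>\<parallel>1 - e\<parallel> \<le> 1\<close>, with \<open>1 - e\<close> as a multiplier.\<close>

definition unit_contraction :: "'a::cstar_algebra \<Rightarrow> bool" where
  "unit_contraction e \<longleftrightarrow> (\<forall>x. norm (x - e * x) \<le> norm x)"

text \<open>\<open>1 - x\<^sup>2\<close> is the square of the contraction \<open>1 - b\<close>.\<close>

lemma unit_contraction_square:
  assumes "star x = x" "norm (x::'a::cstar_algebra) < 1"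
  shows "unit_contraction (x * x)"
  unfolding unit_contraction_def
proof
  fix z
  obtain b where b: "star b = b" "x * b = b * x" "b + b - b * b = x * x"
    using cosine_complement_exists[OF assms] by (auto simp: is_cosine_complement_def)
  have 0: "x * x + b * b - (b + b) = 0" "x * b - b * x = 0" using b by (auto simp: algebra_simps)
  have contr: "norm (y - b * y) \<le> norm y" for y
    using norm.seminorm_cosine_sine(2)[OF assms(1) b(1), of 0 y] unfolding 0 by simp
  have "z - x * x * z = (z - b * z) - b * (z - b * z)"
    unfolding b(3)[symmetric] by (simp add: algebra_simps)
  hence "norm (z - x * x * z) = norm ((z - b * z) - b * (z - b * z))" by (rule arg_cong)
  thus "norm (z - x * x * z) \<le> norm z" using contr[of z] contr[of "z - b * z"] by linarith
qed

section \<open>Quasicentral approximate units\<close>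

lemma norm_diff_le: "norm (a::'a::real_normed_vector) \<le> r \<Longrightarrow> norm b \<le> s \<Longrightarrow> norm (a - b) \<le> r + s"
  using norm_triangle_ineq4[of a b] by linarith

lemma unit_contractionD: "unit_contraction e \<Longrightarrow> norm (x - e * x) \<le> norm x"
  by (simp add: unit_contraction_def)

lemma norm_unit_contraction_mult: "unit_contraction e \<Longrightarrow> norm (e * x) \<le> 2 * norm x"
  using unit_contractionD[of e x] norm_triangle_sub[of "e * x" x] by (simp add: norm_minus_commute)

lemma norm_unit_contraction: "unit_contraction e \<Longrightarrow> norm e \<le> 2"
  using norm_unit_contraction_mult[of e "star e"]
  by (cases "norm e = 0") (auto simp: norm_mult_star power2_eq_square)

lemma unit_contraction_zero: "unit_contraction 0"
  by (simp add: unit_contraction_def)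

text \<open>The new element \<open>e\<close> satisfies \<open>1 - e = (1 - e\<^sub>2)(1 - e\<^sub>1)\<close>.\<close>

lemma unit_contraction_compose:
  assumes "unit_contraction e1" "unit_contraction e2"
  shows "unit_contraction (e1 + e2 - e2 * e1)"
  unfolding unit_contraction_def
proof
  fix x
  have "x - (e1 + e2 - e2 * e1) * x = (x - e1 * x) - e2 * (x - e1 * x)"
    by (simp add: algebra_simps)
  hence "norm (x - (e1 + e2 - e2 * e1) * x) = norm ((x - e1 * x) - e2 * (x - e1 * x))"
    by (rule arg_cong)
  thus "norm (x - (e1 + e2 - e2 * e1) * x) \<le> norm x"
    using assms unit_contractionD[of e1 x] unit_contractionD[of e2 "x - e1 * x"] by linarith
qed

text \<open>The multipliers \<open>1 - e\<close> and \<open>1 - e\<^sup>*\<close> are adjoint to each other.\<close>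

lemma unit_contraction_star:
  assumes "unit_contraction e"
  shows "unit_contraction (star e)"
  unfolding unit_contraction_def
proof
  fix x
  define y where "y = x - star e * x"
  have "(norm y)\<^sup>2 = norm (star x * (y - e * y))"
    unfolding cstar_identity[symmetric]
    by (simp add: y_def star_diff star_mult star_star algebra_simps)
  also have "\<dots> \<le> norm x * norm y"
    using unit_contractionD[OF assms, of y] by (intro norm_mult_le) auto
  finally show "norm (x - star e * x) \<le> norm x"
    unfolding y_def[symmetric] by (cases "norm y = 0") (auto simp: power2_eq_square)
qed

lemma unit_contraction_right:
  assumes "unit_contraction e"
  shows "norm (x - x * e) \<le> norm x"
proof -
  have "norm (x - x * e) = norm (star (x - x * e))" by (rule norm_star[symmetric])
  thus ?thesis using unit_contractionD[OF unit_contraction_star[OF assms], of "star x"]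
    by (simp only: star_diff star_mult norm_star)
qed

lemma mean_defect_eq:
  assumes "n > 0"
  shows "x - (1 / real n) *\<^sub>R (\<Sum>k<n. e k) * (x::'a::cstar_algebra) = (1 / real n) *\<^sub>R (\<Sum>k<n. x - e k * x)"
  using assms by (simp add: sum_subtractf sum_distrib_right scaleR_diff_right sum_constant_scaleR)

lemma norm_mean_le:
  assumes "n > 0" "\<And>k. k < n \<Longrightarrow> norm (f k) \<le> \<epsilon>"
  shows "norm ((1 / real n) *\<^sub>R (\<Sum>k<n. f k)) \<le> \<epsilon>"
proof -
  have "norm (\<Sum>k<n. f k) \<le> (\<Sum>k<n. \<epsilon>)" using assms by (intro sum_norm_le) auto
  thus ?thesis using assms(1) by (simp add: divide_le_eq mult.commute)
qed

lemma unit_contraction_mean: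
  assumes "n > 0" "\<And>k. k < n \<Longrightarrow> unit_contraction (e k)"
  shows "unit_contraction ((1 / real n) *\<^sub>R (\<Sum>k<n. e k))"
  unfolding unit_contraction_def mean_defect_eq[OF assms(1)]
  using assms by (intro allI norm_mean_le unit_contractionD) auto

lemma norm_mean_defect_le:
  assumes "n > 0" "\<And>k. k < n \<Longrightarrow> norm (x - e k * x) \<le> \<epsilon>"
  shows "norm (x - (1 / real n) *\<^sub>R (\<Sum>k<n. e k) * (x::'a::cstar_algebra)) \<le> \<epsilon>"
  unfolding mean_defect_eq[OF assms(1)] using assms by (intro norm_mean_le) auto

text \<open>Smallness of \<open>(1 - e) i\<close> may be tested on \<open>i i\<^sup>*\<close>, by the C*-identity.\<close>

lemma norm_defect_square_le:
  assumes "unit_contraction e"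
  shows "(norm (i - e * i))\<^sup>2 \<le> norm (i * star i - e * (i * star i))"
proof -
  define w where "w = i * star i - e * (i * star i)"
  have "(norm (i - e * i))\<^sup>2 = norm ((i - e * i) * star (i - e * i))" by (rule norm_mult_star[symmetric])
  also have "(i - e * i) * star (i - e * i) = w - w * star e"
    by (simp add: w_def star_diff star_mult algebra_simps)
  also have "norm \<dots> \<le> norm w"
    by (rule unit_contraction_right) (rule unit_contraction_star[OF assms])
  finally show ?thesis by (simp add: w_def)
qed

locale star_ideal =
  fixes I :: "'d::cstar_algebra set"
  assumes ideal: "closed_two_sided_ideal I" and star_closed: "star ` I \<subseteq> I"
begin

lemma closed_I: "closed I" and zero_I [simp]: "0 \<in> I"
  and add_I: "x \<in> I \<Longrightarrow> y \<in> I \<Longrightarrow> x + y \<in> I"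
  and scaleC_I: "x \<in> I \<Longrightarrow> c *\<^sub>C x \<in> I"
  and left_I: "x \<in> I \<Longrightarrow> d * x \<in> I" and right_I: "x \<in> I \<Longrightarrow> x * d \<in> I"
  using ideal by (auto simp: closed_two_sided_ideal_def)

lemma star_I: "x \<in> I \<Longrightarrow> star x \<in> I" using star_closed by auto

lemma minus_I: "x \<in> I \<Longrightarrow> - x \<in> I" using scaleC_I[of x "-1"] by simp

lemma diff_I: "x \<in> I \<Longrightarrow> y \<in> I \<Longrightarrow> x - y \<in> I" using add_I[of x "-y"] minus_I by simp

lemma scaleR_I: "x \<in> I \<Longrightarrow> r *\<^sub>R x \<in> I" using scaleC_I[of x "of_real r"] by (simp add: scaleC_of_real)

lemma sum_I: "(\<And>k. k \<in> A \<Longrightarrow> f k \<in> I) \<Longrightarrow> (\<Sum>k\<in>A. f k) \<in> I"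
  by (induction A rule: infinite_finite_induct) (auto intro: add_I)

lemma commutator_I: "x \<in> I \<Longrightarrow> x * d - d * x \<in> I" by (intro diff_I left_I right_I)

text \<open>
  Choose \<open>y = x\<^sup>2\<close> with \<open>x\<close> a small multiple of \<open>i i\<^sup>*\<close>, so that \<open>1 - y\<close> is a contraction, and let
  \<open>1 - e\<close> be the mean of \<open>(1 - y)\<^sup>k\<close> over \<open>k < n\<close>.  As in the mean ergodic theorem
  \<open>(1 - e) y = (1 - (1 - y)\<^sup>n)/n\<close> telescopes to something small.
\<close>

lemma approximate_unit_single:
  assumes i: "i \<in> I" and \<epsilon>: "\<epsilon> > 0"
  shows "\<exists>e\<in>I. unit_contraction e \<and> norm (i - e * i) < \<epsilon>"
proof -
  define s where "s = 1 / (2 * ((norm i)\<^sup>2 + 1))"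
  have s: "s > 0" by (auto simp: s_def intro!: divide_pos_pos add_nonneg_pos)
  define x where "x = s *\<^sub>R (i * star i)"
  define y where "y = x * x"
  have x: "star x = x" by (simp add: x_def star_scaleR star_mult star_star)
  have "norm x = s * (norm i)\<^sup>2" using s by (simp add: x_def norm_mult_star)
  also have "\<dots> < 1" by (simp add: s_def divide_less_eq add_nonneg_pos)
  finally have "unit_contraction y" unfolding y_def by (intro unit_contraction_square x)
  have yI: "y \<in> I" unfolding y_def x_def by (intro right_I scaleR_I i)
  define u where "u = rec_nat 0 (\<lambda>_ u. u + y - u * y)"
  have u_Suc: "u (Suc k) = u k + y - u k * y" and u_0: "u 0 = 0" for k by (auto simp: u_def)
  have u: "u k \<in> I \<and> unit_contraction (u k)" for k
  proof (induction k)
    case 0 thus ?case by (simp add: u_0 unit_contraction_zero)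
  next
    case (Suc k)
    have "unit_contraction (y + u k - u k * y)"
      using Suc \<open>unit_contraction y\<close> by (intro unit_contraction_compose) auto
    moreover have "u (Suc k) \<in> I" unfolding u_Suc using Suc by (intro diff_I add_I right_I yI) auto
    ultimately show ?case by (simp add: u_Suc add.commute)
  qed
  obtain n :: nat where n: "4 / (\<epsilon>\<^sup>2 * s)\<^sup>2 < real n" using reals_Archimedean2 by blast
  moreover have "0 \<le> 4 / (\<epsilon>\<^sup>2 * s)\<^sup>2" by simp
  ultimately have n0: "n > 0" by (cases n) auto
  define e where "e = (1 / real n) *\<^sub>R (\<Sum>k<n. u k)"
  have e: "unit_contraction e" unfolding e_def using u n0 by (intro unit_contraction_mean) auto
  have eI: "e \<in> I" unfolding e_def using u by (intro scaleR_I sum_I) auto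
  have "y - e * y = (1 / real n) *\<^sub>R (\<Sum>k<n. y - u k * y)"
    unfolding e_def by (rule mean_defect_eq[OF n0])
  also have "(\<Sum>k<n. y - u k * y) = (\<Sum>k<n. u (Suc k) - u k)"
    by (simp add: u_Suc algebra_simps)
  also have "\<dots> = u n" by (simp add: sum_lessThan_telescope u_0)
  finally have "norm (y - e * y) = norm (u n) / real n" by simp
  also have "\<dots> \<le> 2 / real n" using u norm_unit_contraction by (intro divide_right_mono) auto
  finally have 1: "norm (y - e * y) \<le> 2 / real n" .
  have "(norm (x - e * x))\<^sup>2 \<le> norm (y - e * y)"
    using norm_defect_square_le[OF e, of x] by (simp add: x y_def)
  also have "\<dots> < (\<epsilon>\<^sup>2 * s)\<^sup>2"
  proof -
    have pos: "0 < (\<epsilon>\<^sup>2 * s)\<^sup>2" using s \<epsilon> by simp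
    have "4 < real n * (\<epsilon>\<^sup>2 * s)\<^sup>2" using n unfolding pos_divide_less_eq[OF pos] .
    hence "2 < real n * (\<epsilon>\<^sup>2 * s)\<^sup>2" by linarith
    hence "2 / real n < (\<epsilon>\<^sup>2 * s)\<^sup>2" using n0 by (simp add: divide_less_eq mult.commute)
    thus ?thesis using 1 by linarith
  qed
  finally have 2: "norm (x - e * x) < \<epsilon>\<^sup>2 * s"
    by (rule power2_less_imp_less) (use s in auto)
  have "x - e * x = s *\<^sub>R (i * star i - e * (i * star i))" by (simp add: x_def scaleR_diff_right)
  hence "norm (i * star i - e * (i * star i)) = norm (x - e * x) / s" using s by simp
  also have "\<dots> < \<epsilon>\<^sup>2" using 2 s by (simp add: divide_less_eq)
  finally have "(norm (i - e * i))\<^sup>2 < \<epsilon>\<^sup>2" using norm_defect_square_le[OF e, of i] by linarith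
  hence "norm (i - e * i) < \<epsilon>" by (rule power2_less_imp_less) (use \<epsilon> in auto)
  thus ?thesis using e eI by blast
qed

text \<open>
  One element after the other, by products \<open>(1 - e\<^sub>2)(1 - e\<^sub>1)\<close> with \<open>e\<^sub>2\<close> adapted to \<open>(1 - e\<^sub>1) j\<close>;
  finally \<open>(1 - e)\<^sup>*(1 - e)\<close> is self-adjoint.
\<close>

lemma approximate_unit_finite:
  assumes "finite F" "F \<subseteq> I" "\<epsilon> > 0"
  shows "\<exists>e\<in>I. star e = e \<and> unit_contraction e \<and> (\<forall>i\<in>F. norm (i - e * i) < \<epsilon>)"
proof -
  have "\<exists>e\<in>I. unit_contraction e \<and> (\<forall>i\<in>F. norm (i - e * i) < \<epsilon>)"
    using assms(1,2)
  proof (induction F)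
    case (insert j F)
    then obtain e1 where e1: "e1 \<in> I" "unit_contraction e1" "\<forall>i\<in>F. norm (i - e1 * i) < \<epsilon>" by auto
    have "j - e1 * j \<in> I" using insert by (intro diff_I left_I) auto
    then obtain e2 where e2: "e2 \<in> I" "unit_contraction e2"
        "norm ((j - e1 * j) - e2 * (j - e1 * j)) < \<epsilon>"
      using approximate_unit_single assms(3) by blast
    define e where "e = e1 + e2 - e2 * e1"
    have split: "i - e * i = (i - e1 * i) - e2 * (i - e1 * i)" for i
      by (simp add: e_def algebra_simps)
    have "norm (i - e * i) < \<epsilon>" if "i \<in> insert j F" for i
      using that e2 e1(3) unit_contractionD[OF e2(2), of "i - e1 * i"] unfolding split by force
    thus ?case using e1 e2
      by (intro bexI[of _ e]) (auto simp: e_def intro!: unit_contraction_compose diff_I add_I left_I)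
  qed (auto intro!: bexI[of _ 0] unit_contraction_zero)
  then obtain e where e: "e \<in> I" "unit_contraction e" "\<forall>i\<in>F. norm (i - e * i) < \<epsilon>" by blast
  define f where "f = e + star e - star e * e"
  have split: "i - f * i = (i - e * i) - star e * (i - e * i)" for i
    by (simp add: f_def algebra_simps)
  have "norm (i - f * i) < \<epsilon>" if "i \<in> F" for i
    using that e(3) unit_contractionD[OF unit_contraction_star[OF e(2)], of "i - e * i"]
    unfolding split by force
  moreover have "f \<in> I" unfolding f_def using e(1) by (intro diff_I add_I left_I star_I)
  moreover have "unit_contraction f"
    unfolding f_def using e by (intro unit_contraction_compose unit_contraction_star)
  moreover have "star f = f" by (simp add: f_def star_diff star_add star_mult star_star)
  ultimately show ?thesis by blast
qed

text \<open>
  For \<open>i\<close> in the ideal and \<open>e\<close> far out in an approximate unit,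
  \<open>i [e, x] = (i e) x - (i x) e \<approx> i x - i x = 0\<close>.  Hence commutators with \<open>x\<close> of successively
  chosen elements of the approximate unit are almost orthogonal, so their sum stays bounded and
  their mean tends to \<open>0\<close>.
\<close>

lemma quasicentral_finite:
  assumes "finite F" "F \<subseteq> I" "finite G" "\<epsilon> > 0"
  shows "\<exists>e\<in>I. star e = e \<and> unit_contraction e \<and> (\<forall>i\<in>F. norm (i - e * i) < \<epsilon>) \<and>
           (\<forall>x\<in>G. norm (e * x - x * e) < \<epsilon>)"
proof -
  define R where "R = (\<Sum>x\<in>G. norm x)"
  have R: "norm x \<le> R" if "x \<in> G" for x
    unfolding R_def using that assms(3) by (intro member_le_sum) auto
  have R0: "R \<ge> 0" unfolding R_def by (intro sum_nonneg) auto
  obtain n :: nat where n: "(4 * R + 1) / \<epsilon> < real n" using reals_Archimedean2 by blast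
  moreover have "0 < (4 * R + 1) / \<epsilon>" using R0 assms by (intro divide_pos_pos) auto
  ultimately have n0: "n > 0" by (cases n) auto
  obtain \<delta> where \<delta>: "max_norm_tolerance TYPE('d) (4 * R * real n + 4 * R + 1) (1 / real n) \<delta>"
    using max_norm_tolerance_exists[of "1 / real n" "4 * R * real n + 4 * R + 1"] n0 R0
    by (auto simp: add_nonneg_pos)
  hence \<delta>0: "\<delta> > 0" by (simp add: max_norm_tolerance_def)
  define \<tau> where "\<tau> = \<delta> / (real n * (R + 1))"
  have \<tau>: "\<tau> > 0" using n0 R0 \<delta>0 by (simp add: \<tau>_def)
  define w where "w = (\<lambda>e x. e * x - x * (e::'d))"
  define P where "P = (\<lambda>f (k::nat) e. e \<in> I \<and> star e = e \<and> unit_contraction e \<and>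
      (\<forall>i\<in>F. norm (i - e * i) < \<epsilon>/2) \<and>
      (\<forall>j<k. \<forall>x\<in>G. norm (w (f j) x - e * w (f j) x) < \<tau> \<and>
        norm (star (w (f j) x) - e * star (w (f j) x)) < \<tau> \<and>
        norm (star (star (w (f j) x) * x) - e * star (star (w (f j) x) * x)) < \<tau> \<and>
        norm (star (w (f j) x * star x) - e * star (w (f j) x * star x)) < \<tau>))"
  have "\<exists>e. \<forall>k. P e k (e k)"
  proof (rule dependent_wellorder_choice)
    fix r :: 'd and f g :: "nat \<Rightarrow> 'd" and k :: nat
    assume "\<And>y. y < k \<Longrightarrow> f y = g y"
    thus "P f k r = P g k r" by (simp add: P_def)
  next
    fix k :: nat and f :: "nat \<Rightarrow> 'd"
    assume prev: "\<And>y. y < k \<Longrightarrow> P f y (f y)"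
    have wI: "w (f j) x \<in> I" if "j < k" for j x
      using prev[OF that] unfolding P_def w_def by (intro commutator_I) auto
    define H where "H = F \<union> (\<Union>j\<in>{..<k}. \<Union>x\<in>G. {w (f j) x, star (w (f j) x),
        star (star (w (f j) x) * x), star (w (f j) x * star x)})"
    have "finite H" "H \<subseteq> I"
      unfolding H_def using assms wI by (auto intro!: star_I right_I)
    then obtain e where "e \<in> I" "star e = e" "unit_contraction e"
        "\<forall>i\<in>H. norm (i - e * i) < min (\<epsilon>/2) \<tau>"
      using approximate_unit_finite[of H "min (\<epsilon>/2) \<tau>"] \<tau> assms(4) by auto
    thus "\<exists>e. P f k e" by (intro exI[of _ e]) (auto simp: P_def H_def)
  qed
  then obtain e where P: "\<And>k. P e k (e k)" by blast
  have e: "e k \<in> I" "star (e k) = e k" "unit_contraction (e k)"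
      "\<And>i. i \<in> F \<Longrightarrow> norm (i - e k * i) < \<epsilon>/2" for k
    using P[of k] by (auto simp: P_def)
  have right: "norm (i - i * e k) < \<tau>" if "norm (star i - e k * star i) < \<tau>" for i k
  proof -
    have "norm (i - i * e k) = norm (star (i - i * e k))" by (rule norm_star[symmetric])
    thus ?thesis using that by (simp add: star_diff star_mult e del: norm_star)
  qed
  have unit_on: "norm (star (w (e j) x) - star (w (e j) x) * e k) < \<tau>"
      "norm (star (w (e j) x) * x - star (w (e j) x) * x * e k) < \<tau>"
      "norm (w (e j) x - w (e j) x * e k) < \<tau>"
      "norm (w (e j) x * star x - w (e j) x * star x * e k) < \<tau>" if "j < k" "x \<in> G" for j k x
  proof -
    have "norm (w (e j) x - e k * w (e j) x) < \<tau>"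
      "norm (star (w (e j) x) - e k * star (w (e j) x)) < \<tau>"
      "norm (star (star (w (e j) x) * x) - e k * star (star (w (e j) x) * x)) < \<tau>"
      "norm (star (w (e j) x * star x) - e k * star (w (e j) x * star x)) < \<tau>"
      using P[of k] that unfolding P_def by blast+
    thus "norm (star (w (e j) x) - star (w (e j) x) * e k) < \<tau>"
      "norm (star (w (e j) x) * x - star (w (e j) x) * x * e k) < \<tau>"
      "norm (w (e j) x - w (e j) x * e k) < \<tau>"
      "norm (w (e j) x * star x - w (e j) x * star x * e k) < \<tau>"
      using right[of "star (w (e j) x)" k] right[of "star (w (e j) x) * x" k]
        right[of "w (e j) x" k] right[of "w (e j) x * star x" k]
      by (simp_all only: star_star)
  qed
  define f where "f = (1 / real n) *\<^sub>R (\<Sum>k<n. e k)"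
  have comm: "norm (f * x - x * f) < \<epsilon>" if x: "x \<in> G" for x
  proof -
    define v where "v k = w (e k) x" for k
    have v4: "norm (v k) \<le> 4 * R" for k
    proof -
      have "norm (v k) \<le> norm (e k * x) + norm (x * e k)" unfolding v_def w_def by (rule norm_triangle_ineq4)
      also have "\<dots> \<le> 2 * R + R * 2"
        using norm_unit_contraction[OF e(3)] R[OF x] by (intro add_mono norm_mult_le) auto
      finally show ?thesis by simp
    qed
    have orth1: "norm (star (v j) * v k) \<le> \<tau> * (R + 1)" if "j < k" for j k
    proof -
      have "star (v j) * v k = (star (v j) * x - star (v j) * x * e k) - (star (v j) - star (v j) * e k) * x"
        by (simp add: v_def[of k] w_def algebra_simps)
      also have "norm \<dots> \<le> \<tau> + \<tau> * R"
        using unit_on[OF that x] R[OF x] unfolding v_def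
        by (intro norm_diff_le norm_mult_le) auto
      finally show ?thesis by (simp add: algebra_simps)
    qed
    have orth2: "norm (v j * star (v k)) \<le> \<tau> * (R + 1)" if "j < k" for j k
    proof -
      have "v j * star (v k) = (v j - v j * e k) * star x - (v j * star x - v j * star x * e k)"
        by (simp add: v_def[of k] w_def star_diff star_mult e algebra_simps)
      also have "norm \<dots> \<le> \<tau> * R + \<tau>"
        using unit_on[OF that x] R[OF x] unfolding v_def
        by (intro norm_diff_le norm_mult_le) auto
      finally show ?thesis by (simp add: algebra_simps)
    qed
    have \<delta>_eq: "real n * (\<tau> * (R + 1)) = \<delta>" using n0 R0 by (simp add: \<tau>_def)
    have count: "real k * c \<le> real n * c" if "k < n" "c \<ge> 0" for k c
      using that by (intro mult_right_mono) auto
    have "norm (\<Sum>k<n. v k) \<le> 4 * R + (\<Sum>k<n. 1 / real n)"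
    proof (rule norm_sum_almost_orthogonal[where \<delta> = "\<lambda>_. \<delta>" and R = "\<lambda>_. 4 * R * real n + 4 * R + 1"])
      fix k assume k: "k < n"
      show "norm (star (\<Sum>j<k. v j) * v k) \<le> \<delta>"
      proof -
        have "norm (star (\<Sum>j<k. v j) * v k) = norm (\<Sum>j<k. star (v j) * v k)"
          by (simp add: star_sum sum_distrib_right)
        also have "\<dots> \<le> (\<Sum>j<k. \<tau> * (R + 1))" by (intro sum_norm_le orth1) auto
        also have "\<dots> \<le> \<delta>" using count[OF k, of "\<tau> * (R + 1)"] \<tau> R0 \<delta>_eq by simp
        finally show ?thesis .
      qed
      show "norm ((\<Sum>j<k. v j) * star (v k)) \<le> \<delta>"
      proof -
        have "norm ((\<Sum>j<k. v j) * star (v k)) = norm (\<Sum>j<k. v j * star (v k))"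
          by (simp add: sum_distrib_right)
        also have "\<dots> \<le> (\<Sum>j<k. \<tau> * (R + 1))" by (intro sum_norm_le orth2) auto
        also have "\<dots> \<le> \<delta>" using count[OF k, of "\<tau> * (R + 1)"] \<tau> R0 \<delta>_eq by simp
        finally show ?thesis .
      qed
      have "norm (\<Sum>j<k. v j) \<le> (\<Sum>j<k. 4 * R)" by (intro sum_norm_le v4)
      also have "\<dots> \<le> 4 * R * real n" using count[OF k, of "4 * R"] R0 by (simp add: mult_ac)
      finally show "norm (\<Sum>j<k. v j) \<le> 4 * R * real n + 4 * R + 1" using R0 by linarith
      show "norm (v k) \<le> 4 * R * real n + 4 * R + 1"
        using v4[of k] R0 mult_nonneg_nonneg[of "4 * R" "real n"] by linarith
    qed (use \<delta> v4 R0 in simp_all)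
    also have "\<dots> = 4 * R + 1" using n0 by simp
    finally have sum: "norm (\<Sum>k<n. v k) \<le> 4 * R + 1" .
    have "f * x - x * f = (1 / real n) *\<^sub>R (\<Sum>k<n. v k)"
      by (simp add: f_def v_def w_def sum_subtractf sum_distrib_left sum_distrib_right scaleR_diff_right)
    hence "norm (f * x - x * f) \<le> (4 * R + 1) / real n"
      using sum n0 by (simp add: divide_right_mono)
    also have "\<dots> < \<epsilon>" using n n0 assms(4) by (simp add: field_simps)
    finally show ?thesis .
  qed
  have "norm (i - f * i) < \<epsilon>" if "i \<in> F" for i
  proof -
    have "norm (i - f * i) \<le> \<epsilon>/2"
      unfolding f_def by (rule norm_mean_defect_le) (use n0 e(4)[OF that] in \<open>auto intro: less_imp_le\<close>)
    thus ?thesis using assms(4) by linarith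
  qed
  moreover have "f \<in> I" unfolding f_def by (intro scaleR_I sum_I e)
  moreover have "star f = f" by (simp add: f_def star_scaleR star_sum e)
  moreover have "unit_contraction f" unfolding f_def using n0 e(3) by (intro unit_contraction_mean) auto
  ultimately show ?thesis using comm by blast
qed

lemma quasicentral_compact:
  assumes "compact F" "F \<subseteq> I" "compact G" "\<epsilon> > 0"
  shows "\<exists>e\<in>I. star e = e \<and> unit_contraction e \<and> (\<forall>i\<in>F. norm (i - e * i) \<le> \<epsilon>) \<and>
           (\<forall>x\<in>G. norm (e * x - x * e) \<le> \<epsilon>)"
proof -
  have net: "\<exists>k. finite k \<and> k \<subseteq> K \<and> K \<subseteq> (\<Union>x\<in>k. ball x (\<epsilon>/8))" if "compact K" for K :: "'d set"
  proof -
    have "K \<subseteq> (\<Union>x\<in>K. ball x (\<epsilon>/8))" using assms(4) by force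
    with that obtain k where "k \<subseteq> K" "finite k" "K \<subseteq> (\<Union>x\<in>k. ball x (\<epsilon>/8))"
      by (rule compactE_image[OF _ open_ball])
    thus ?thesis by (intro exI[of _ k] conjI)
  qed
  obtain F' where F': "finite F'" "F' \<subseteq> F" "F \<subseteq> (\<Union>x\<in>F'. ball x (\<epsilon>/8))"
    using net[OF assms(1)] by blast
  obtain G' where G': "finite G'" "G' \<subseteq> G" "G \<subseteq> (\<Union>x\<in>G'. ball x (\<epsilon>/8))"
    using net[OF assms(3)] by blast
  have F'I: "F' \<subseteq> I" using F'(2) assms(2) by (rule order_trans)
  have half: "\<epsilon>/2 > 0" using assms(4) by simp
  obtain e where e: "e \<in> I" "star e = e" "unit_contraction e" "\<forall>i\<in>F'. norm (i - e * i) < \<epsilon>/2"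
      "\<forall>x\<in>G'. norm (e * x - x * e) < \<epsilon>/2"
    using quasicentral_finite[OF F'(1) F'I G'(1) half] by blast
  have "norm (i - e * i) \<le> \<epsilon>" if iF: "i \<in> F" for i
  proof -
    obtain j where j: "j \<in> F'" "i \<in> ball j (\<epsilon>/8)" using subsetD[OF F'(3) iF] by (rule UN_E)
    hence ji: "norm (j - i) < \<epsilon>/8" by (simp add: dist_norm)
    have "norm (i - e * i) = norm ((j - e * j) - ((j - i) - e * (j - i)))" by (simp add: algebra_simps)
    also have "\<dots> \<le> norm (j - e * j) + norm ((j - i) - e * (j - i))" by (rule norm_triangle_ineq4)
    finally have "norm (i - e * i) \<le> norm (j - e * j) + norm ((j - i) - e * (j - i))" .
    moreover have "norm (j - e * j) < \<epsilon>/2" using e j by blast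
    ultimately show ?thesis using ji unit_contractionD[OF e(3), of "j - i"] assms(4) by linarith
  qed
  moreover have "norm (e * x - x * e) \<le> \<epsilon>" if xG: "x \<in> G" for x
  proof -
    obtain y where y: "y \<in> G'" "x \<in> ball y (\<epsilon>/8)" using subsetD[OF G'(3) xG] by (rule UN_E)
    hence yx: "norm (y - x) < \<epsilon>/8" by (simp add: dist_norm)
    have "norm (e * x - x * e) = norm ((e * y - y * e) - (e * (y - x) - (y - x) * e))"
      by (simp add: algebra_simps)
    also have "\<dots> \<le> norm (e * y - y * e) + norm (e * (y - x) - (y - x) * e)"
      by (rule norm_triangle_ineq4)
    finally have "norm (e * x - x * e) \<le> norm (e * y - y * e) + norm (e * (y - x) - (y - x) * e)" .
    moreover have "norm (e * (y - x) - (y - x) * e) \<le> 2 * (\<epsilon>/8) + (\<epsilon>/8) * 2"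
      using yx norm_unit_contraction[OF e(3)]
      by (intro norm_diff_le norm_mult_le) auto
    moreover have "norm (e * y - y * e) < \<epsilon>/2" using e(5) y(1) by blast
    ultimately show ?thesis using assms(4) by linarith
  qed
  ultimately show ?thesis using e(1-3) by (intro bexI[of _ e]) simp_all
qed

lemma quasicentral_sequence:
  fixes F G :: "nat \<Rightarrow> 'd set" and \<epsilon> :: "nat \<Rightarrow> real"
  assumes "\<And>k. compact (F k)" "\<And>k. F k \<subseteq> I" "\<And>k. compact (G k)" "\<And>k. \<epsilon> k > 0"
  shows "\<exists>e. \<forall>k. e k \<in> I \<and> star (e k) = e k \<and> unit_contraction (e k) \<and>
      (\<forall>i\<in>F k. norm (i - e k * i) \<le> \<epsilon> k) \<and> (\<forall>x\<in>G k. norm (e k * x - x * e k) \<le> \<epsilon> k) \<and>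
      (\<forall>j<k. norm (e j - e k * e j) \<le> \<epsilon> k)"
proof -
  define P where "P = (\<lambda>f k e. e \<in> I \<and> star e = e \<and> unit_contraction e \<and>
      (\<forall>i\<in>F k. norm (i - e * i) \<le> \<epsilon> k) \<and> (\<forall>x\<in>G k. norm (e * x - x * e) \<le> \<epsilon> k) \<and>
      (\<forall>j<k. norm (f j - e * f j) \<le> \<epsilon> k))"
  have "\<exists>e. \<forall>k. P e k (e k)"
  proof (rule dependent_wellorder_choice)
    fix k :: nat and f :: "nat \<Rightarrow> 'd"
    assume prev: "\<And>y. y < k \<Longrightarrow> P f y (f y)"
    have "compact (F k \<union> f ` {..<k})" by (intro compact_Un assms finite_imp_compact) auto
    moreover have "F k \<union> f ` {..<k} \<subseteq> I" using assms(2) prev by (auto simp: P_def)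
    ultimately obtain e where "e \<in> I" "star e = e" "unit_contraction e"
        "\<forall>i\<in>F k \<union> f ` {..<k}. norm (i - e * i) \<le> \<epsilon> k" "\<forall>x\<in>G k. norm (e * x - x * e) \<le> \<epsilon> k"
      using quasicentral_compact[of "F k \<union> f ` {..<k}" "G k" "\<epsilon> k"] assms(3,4) by blast
    thus "\<exists>e. P f k e" unfolding P_def by (intro exI[of _ e]) blast
  qed (simp add: P_def)
  thus ?thesis unfolding P_def by blast
qed

lemma infdist_le_norm: "i \<in> I \<Longrightarrow> infdist x I \<le> norm (x - i)"
  using infdist_le[of i I x] by (simp add: dist_norm)

lemma infdist_approx:
  assumes "\<epsilon> > 0"
  shows "\<exists>i\<in>I. norm (x - i) < infdist x I + \<epsilon>"
proof -
  have "I \<noteq> {}" using zero_I by blast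
  moreover have "Inf (dist x ` I) < infdist x I + \<epsilon>"
    using assms by (simp add: infdist_notempty[OF calculation])
  ultimately obtain y where "y \<in> dist x ` I" "y < infdist x I + \<epsilon>"
    using cInf_lessD[of "dist x ` I"] by auto
  thus ?thesis by (auto simp: dist_norm)
qed

lemma infdist_eq_0D: "infdist x I = 0 \<Longrightarrow> x \<in> I"
  using in_closed_iff_infdist_zero[OF closed_I] zero_I by blast

lemma le_infdistI:
  assumes "\<And>\<epsilon>. \<epsilon> > 0 \<Longrightarrow> r \<le> infdist x I + \<epsilon>"
  shows "r \<le> infdist x I"
  using assms by (rule field_le_epsilon)

end

text \<open>
  The C*-identity passes to the quotient since the distance of \<open>x\<close> to the ideal is approached by
  \<open>\<parallel>x (1 - e)\<parallel>\<close>, and \<open>\<parallel>x (1 - e)\<parallel>\<^sup>2 \<le> \<parallel>x\<^sup>*x (1 - e)\<parallel>\<close>.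
\<close>

sublocale star_ideal \<subseteq> quot: cstar_seminorm "\<lambda>x. infdist x I"
proof
  fix x y :: 'd and c
  show "0 \<le> infdist x I" by (rule infdist_nonneg)
  show "infdist (x + y) I \<le> infdist x I + infdist y I"
  proof (rule field_le_epsilon)
    fix \<epsilon> :: real assume \<epsilon>: "\<epsilon> > 0"
    obtain i j where ij: "i \<in> I" "norm (x - i) < infdist x I + \<epsilon>/2" "j \<in> I" "norm (y - j) < infdist y I + \<epsilon>/2"
      using infdist_approx[of "\<epsilon>/2"] \<epsilon> half_gt_zero by metis
    have "infdist (x + y) I \<le> norm ((x + y) - (i + j))" by (intro infdist_le_norm add_I ij)
    also have "\<dots> \<le> norm (x - i) + norm (y - j)" by (simp add: norm_diff_triangle_ineq)
    finally show "infdist (x + y) I \<le> infdist x I + infdist y I + \<epsilon>" using ij by linarith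
  qed
  show "infdist (c *\<^sub>C x) I = cmod c * infdist x I"
  proof -
    have le: "infdist (d *\<^sub>C z) I \<le> cmod d * infdist z I" for d z
    proof (rule field_le_epsilon)
      fix \<epsilon> :: real assume \<epsilon>: "\<epsilon> > 0"
      define \<epsilon>' where "\<epsilon>' = \<epsilon> / (cmod d + 1)"
      have \<epsilon>': "\<epsilon>' > 0" using \<epsilon> by (auto simp: \<epsilon>'_def intro!: divide_pos_pos add_nonneg_pos)
      obtain i where i: "i \<in> I" "norm (z - i) < infdist z I + \<epsilon>'" using infdist_approx \<epsilon>' by blast
      have "infdist (d *\<^sub>C z) I \<le> norm (d *\<^sub>C z - d *\<^sub>C i)" by (intro infdist_le_norm scaleC_I i)
      also have "\<dots> = cmod d * norm (z - i)" by (simp add: norm_scaleC flip: scaleC_diff_right)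
      also have "\<dots> \<le> cmod d * (infdist z I + \<epsilon>')" using i by (intro mult_left_mono) auto
      also have "\<dots> \<le> cmod d * infdist z I + (cmod d + 1) * \<epsilon>'"
        using \<epsilon>' by (simp add: algebra_simps)
      also have "(cmod d + 1) * \<epsilon>' = \<epsilon>" by (simp add: \<epsilon>'_def add_nonneg_eq_0_iff)
      finally show "infdist (d *\<^sub>C z) I \<le> cmod d * infdist z I + \<epsilon>" .
    qed
    show ?thesis
    proof (cases "c = 0")
      case True
      hence "c *\<^sub>C x = 0" using norm_scaleC[of c x] by simp
      thus ?thesis using True by simp
    next
      case False
      have "infdist x I = infdist (inverse c *\<^sub>C c *\<^sub>C x) I" using False by (simp add: scaleC_scaleC)
      also have "\<dots> \<le> cmod (inverse c) * infdist (c *\<^sub>C x) I" by (rule le)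
      finally have "cmod c * infdist x I \<le> infdist (c *\<^sub>C x) I"
        using False by (simp add: norm_inverse norm_divide field_simps)
      thus ?thesis using le[of c x] by linarith
    qed
  qed
  show "infdist (x * y) I \<le> infdist x I * infdist y I"
  proof -
    have *: "infdist (x * y) I \<le> (infdist x I + \<epsilon>) * (infdist y I + \<epsilon>)" if \<epsilon>: "\<epsilon> > 0" for \<epsilon>
    proof -
      obtain i j where ij: "i \<in> I" "norm (x - i) < infdist x I + \<epsilon>" "j \<in> I" "norm (y - j) < infdist y I + \<epsilon>"
        using infdist_approx[OF \<epsilon>] by metis
      have "x * y - (x - i) * (y - j) \<in> I"
      proof -
        have "x * y - (x - i) * (y - j) = i * y + (x - i) * j" by (simp add: algebra_simps)
        thus ?thesis using ij by (auto intro: add_I left_I right_I)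
      qed
      hence "infdist (x * y) I \<le> norm ((x - i) * (y - j))"
        using infdist_le_norm[of _ "x * y"] by force
      also have "\<dots> \<le> (infdist x I + \<epsilon>) * (infdist y I + \<epsilon>)" using ij by (intro norm_mult_le) auto
      finally show ?thesis .
    qed
    have "((\<lambda>\<epsilon>. (infdist x I + \<epsilon>) * (infdist y I + \<epsilon>)) \<longlongrightarrow> (infdist x I + 0) * (infdist y I + 0)) (at_right 0)"
      by (intro tendsto_intros)
    hence "infdist (x * y) I \<le> (infdist x I + 0) * (infdist y I + 0)"
      by (rule tendsto_lowerbound) (auto intro!: * eventually_at_right_less[THEN eventually_mono])
    thus ?thesis by simp
  qed
  show "infdist (star x) I \<le> infdist x I"
  proof (rule le_infdistI)
    fix \<epsilon> :: real assume \<epsilon>: "\<epsilon> > 0"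
    obtain i where i: "i \<in> I" "norm (x - i) < infdist x I + \<epsilon>" using infdist_approx \<epsilon> by blast
    have "infdist (star x) I \<le> norm (star x - star i)" by (intro infdist_le_norm star_I i)
    also have "\<dots> = norm (x - i)" by (simp flip: star_diff)
    finally show "infdist (star x) I \<le> infdist x I + \<epsilon>" using i by linarith
  qed
  show "(infdist x I)\<^sup>2 \<le> infdist (star x * x) I"
  proof (rule le_infdistI)
    fix \<epsilon> :: real assume \<epsilon>: "\<epsilon> > 0"
    obtain i where i: "i \<in> I" "norm (star x * x - i) < infdist (star x * x) I + \<epsilon>/2"
      using infdist_approx[of "\<epsilon>/2"] \<epsilon> by auto
    obtain e where e: "e \<in> I" "star e = e" "unit_contraction e" "norm (star i - e * star i) < \<epsilon>/2"
      using approximate_unit_finite[of "{star i}" "\<epsilon>/2"] \<epsilon> i star_I by auto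
    have ie: "norm (i - i * e) < \<epsilon>/2"
      using e(4) norm_star[of "i - i * e"] by (simp add: star_diff star_mult e(2) del: norm_star)
    define z where "z = star x * x - star x * x * e"
    have "(infdist x I)\<^sup>2 \<le> (norm (x - x * e))\<^sup>2"
      by (intro power_mono infdist_le_norm left_I e infdist_nonneg)
    also have "\<dots> = norm (star (x - x * e) * (x - x * e))" by (simp add: cstar_identity)
    also have "star (x - x * e) * (x - x * e) = z - e * z"
      by (simp add: z_def star_diff star_mult e(2) algebra_simps)
    also have "norm \<dots> \<le> norm z" by (rule unit_contractionD[OF e(3)])
    also have "z = ((star x * x - i) - (star x * x - i) * e) + (i - i * e)"
      by (simp add: z_def algebra_simps)
    also have "norm \<dots> \<le> norm (star x * x - i) + \<epsilon>/2"
      using unit_contraction_right[OF e(3), of "star x * x - i"] ie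
      by (intro order_trans[OF norm_triangle_ineq] add_mono) auto
    also have "\<dots> \<le> infdist (star x * x) I + \<epsilon>" using i by linarith
    finally show "(infdist x I)\<^sup>2 \<le> infdist (star x * x) I + \<epsilon>" .
  qed
qed

section \<open>Countable dense subalgebras\<close>

definition rational_scalars :: "complex set" where
  "rational_scalars = (\<lambda>(p, q). Complex (of_rat p) (of_rat q)) ` UNIV"

lemma countable_rational_scalars: "countable rational_scalars"
  unfolding rational_scalars_def by (intro countable_image countableI_type)

lemma of_rat_rational_scalar: "complex_of_real (of_rat q) \<in> rational_scalars"
  unfolding rational_scalars_def by (auto simp: complex_eq_iff intro!: image_eqI[of _ _ "(q, 0)"])

lemma rational_scalars_dense:
  assumes "\<epsilon> > 0"
  shows "\<exists>c'\<in>rational_scalars. cmod (c - c') < \<epsilon>"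
proof -
  obtain p where p: "Re c < real_of_rat p" "real_of_rat p < Re c + \<epsilon>/2"
    using of_rat_dense[of "Re c" "Re c + \<epsilon>/2"] assms by auto
  obtain q where q: "Im c < real_of_rat q" "real_of_rat q < Im c + \<epsilon>/2"
    using of_rat_dense[of "Im c" "Im c + \<epsilon>/2"] assms by auto
  have "cmod (c - Complex (of_rat p) (of_rat q)) \<le> \<bar>Re c - of_rat p\<bar> + \<bar>Im c - of_rat q\<bar>"
    using cmod_le[of "c - Complex (of_rat p) (of_rat q)"] by simp
  also have "\<dots> < \<epsilon>" using p q by linarith
  finally show ?thesis by (intro bexI[of _ "Complex (of_rat p) (of_rat q)"]) (auto simp: rational_scalars_def)
qed

text \<open>
  Besides the operations of a \<open>*\<close>-algebra over the rational complex numbers, closure under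
  \<open>a \<mapsto> 1 - (1 - a\<^sup>2)\<^bsup>1/2\<^esup>\<close> is required: it makes asymptotic homomorphisms that are
  defined on the set only asymptotically contractive.
\<close>

definition cosine_subalgebra :: "'b::cstar_algebra set \<Rightarrow> bool" where
  "cosine_subalgebra C \<longleftrightarrow>
    (\<forall>a\<in>C. \<forall>b\<in>C. a + b \<in> C \<and> a * b \<in> C) \<and> (\<forall>a\<in>C. star a \<in> C) \<and>
    (\<forall>c\<in>rational_scalars. \<forall>a\<in>C. c *\<^sub>C a \<in> C) \<and>
    (\<forall>a\<in>C. star a = a \<longrightarrow> norm a < 1 \<longrightarrow> (\<exists>b\<in>C. is_cosine_complement a b))"

lemma cosine_subalgebra_UNIV: "cosine_subalgebra UNIV"
  unfolding cosine_subalgebra_def using cosine_complement_exists by blast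

lemma cosine_subalgebra_minus:
  assumes "cosine_subalgebra C" "a \<in> C"
  shows "- a \<in> C"
proof -
  have "(-1::complex) \<in> rational_scalars" using of_rat_rational_scalar[of "-1"] by simp
  hence "(-1) *\<^sub>C a \<in> C" using assms unfolding cosine_subalgebra_def by blast
  thus ?thesis by simp
qed

lemma countable_cosine_subalgebra:
  assumes "countable (S :: 'b::cstar_algebra set)"
  shows "\<exists>C. S \<subseteq> C \<and> countable C \<and> cosine_subalgebra C"
proof -
  define g where "g = (\<lambda>a::'b. SOME b. is_cosine_complement a b)"
  have g: "is_cosine_complement a (g a)" if "star a = a" "norm a < 1" for a
    unfolding g_def using cosine_complement_exists[OF that] by (rule someI_ex)
  define step where "step = (\<lambda>X. X \<union> (\<lambda>(x, y). x + y) ` (X \<times> X) \<union> (\<lambda>(x, y). x * y) ` (X \<times> X) \<union>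
      star ` X \<union> (\<lambda>(c, x). c *\<^sub>C x) ` (rational_scalars \<times> X) \<union> g ` X)"
  define C where "C = (\<Union>n. (step ^^ n) S)"
  have "countable ((step ^^ n) S)" for n
    by (induction n) (auto simp: assms step_def intro!: countable_rational_scalars)
  hence "countable C" unfolding C_def by auto
  moreover have "S \<subseteq> C" unfolding C_def by (rule UN_I[of 0, THEN subsetI]) auto
  moreover have "cosine_subalgebra C"
  proof -
    have step_ops: "x \<in> X \<Longrightarrow> y \<in> X \<Longrightarrow> x + y \<in> step X" "x \<in> X \<Longrightarrow> y \<in> X \<Longrightarrow> x * y \<in> step X"
        "x \<in> X \<Longrightarrow> star x \<in> step X" "x \<in> X \<Longrightarrow> c \<in> rational_scalars \<Longrightarrow> c *\<^sub>C x \<in> step X"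
        "x \<in> X \<Longrightarrow> g x \<in> step X" for x y X c
      unfolding step_def by (auto intro: image_eqI[of _ _ "(x, y)"] image_eqI[of _ _ "(c, x)"])
    have mono: "(step ^^ m) S \<subseteq> (step ^^ n) S" if "m \<le> n" for m n
      by (rule lift_Suc_mono_le[OF _ that]) (auto simp: step_def)
    have step: "step ((step ^^ n) S) \<subseteq> C" for n
      unfolding C_def using UN_upper[of "Suc n" UNIV "\<lambda>n. (step ^^ n) S"] by simp
    have two: "\<exists>n. x \<in> (step ^^ n) S \<and> y \<in> (step ^^ n) S" if xy: "x \<in> C" "y \<in> C" for x y
    proof -
      obtain m n where "x \<in> (step ^^ m) S" "y \<in> (step ^^ n) S" using xy unfolding C_def by blast
      thus ?thesis using mono[of m "max m n"] mono[of n "max m n"]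
        by (intro exI[of _ "max m n"]) auto
    qed
    show ?thesis unfolding cosine_subalgebra_def
    proof (intro conjI ballI impI)
      fix a b assume ab: "a \<in> C" "b \<in> C"
      obtain n where n: "a \<in> (step ^^ n) S" "b \<in> (step ^^ n) S" using two[OF ab] by blast
      show "a + b \<in> C" "a * b \<in> C" using step_ops(1,2)[OF n] step by blast+
    next
      fix a assume a: "a \<in> C"
      obtain n where n: "a \<in> (step ^^ n) S" using two[OF a a] by blast
      show "star a \<in> C" using step_ops(3)[OF n] step by blast
    next
      fix a c assume a: "a \<in> C" and c: "c \<in> rational_scalars"
      obtain n where n: "a \<in> (step ^^ n) S" using two[OF a a] by blast
      show "c *\<^sub>C a \<in> C" using step_ops(4)[OF n c] step by blast
    next
      fix a assume a: "a \<in> C" "star a = a" "norm a < 1"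
      obtain n where n: "a \<in> (step ^^ n) S" using two[OF a(1) a(1)] by blast
      show "\<exists>b\<in>C. is_cosine_complement a b" using step_ops(5)[OF n] step g[OF a(2,3)] by blast
    qed
  qed
  ultimately show ?thesis by blast
qed

lemma countable_dense_cosine_subalgebra:
  assumes "separable_space (euclidean :: 'b::cstar_algebra topology)"
  shows "\<exists>C::'b set. countable C \<and> cosine_subalgebra C \<and> (\<forall>x. \<forall>\<epsilon>>0. \<exists>c\<in>C. norm (x - c) < \<epsilon>)"
proof -
  obtain S :: "'b set" where S: "countable S" "closure S = UNIV"
    using assms by (auto simp: separable_space_def)
  obtain C where C: "S \<subseteq> C" "countable C" "cosine_subalgebra C"
    using countable_cosine_subalgebra[OF S(1)] by blast
  have "\<exists>c\<in>C. norm (x - c) < \<epsilon>" if "\<epsilon> > 0" for x \<epsilon>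
  proof -
    have "x \<in> closure S" using S by simp
    then obtain c where "c \<in> S" "dist c x < \<epsilon>" using \<open>\<epsilon> > 0\<close> unfolding closure_approachable by blast
    thus ?thesis using C by (auto simp: dist_norm norm_minus_commute)
  qed
  thus ?thesis using C by blast
qed

section \<open>Asymptotic homomorphisms are asymptotically contractive\<close>

context cstar_seminorm
begin

text \<open>
  Homogeneity is demanded for rational scalars only, so that a countable set \<open>C\<close> can be closed
  under the operations involved.
\<close>

definition asymptotic_on :: "'i filter \<Rightarrow> 'b::cstar_algebra set \<Rightarrow> ('i \<Rightarrow> 'b \<Rightarrow> 'd) \<Rightarrow> bool" where
  "asymptotic_on \<F> C f \<longleftrightarrow>
    (\<forall>a\<in>C. \<forall>b\<in>C. ((\<lambda>i. p (f i (a + b) - (f i a + f i b))) \<longlongrightarrow> 0) \<F>) \<and>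
    (\<forall>a\<in>C. \<forall>c\<in>rational_scalars. ((\<lambda>i. p (f i (c *\<^sub>C a) - c *\<^sub>C f i a)) \<longlongrightarrow> 0) \<F>) \<and>
    (\<forall>a\<in>C. \<forall>b\<in>C. ((\<lambda>i. p (f i (a * b) - f i a * f i b)) \<longlongrightarrow> 0) \<F>) \<and>
    (\<forall>a\<in>C. ((\<lambda>i. p (f i (star a) - star (f i a))) \<longlongrightarrow> 0) \<F>)"

lemma asymptotic_onD:
  assumes "asymptotic_on \<F> C f" "a \<in> C"
  shows "b \<in> C \<Longrightarrow> ((\<lambda>i. p (f i (a + b) - (f i a + f i b))) \<longlongrightarrow> 0) \<F>"
    and "c \<in> rational_scalars \<Longrightarrow> ((\<lambda>i. p (f i (c *\<^sub>C a) - c *\<^sub>C f i a)) \<longlongrightarrow> 0) \<F>"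
    and "b \<in> C \<Longrightarrow> ((\<lambda>i. p (f i (a * b) - f i a * f i b)) \<longlongrightarrow> 0) \<F>"
    and "((\<lambda>i. p (f i (star a) - star (f i a))) \<longlongrightarrow> 0) \<F>"
  using assms unfolding asymptotic_on_def by blast+

text \<open>
  For \<open>X, Y\<close> almost satisfying the equations of \<open>a\<close> and its cosine complement \<open>b\<close>, the
  self-adjoint parts \<open>d, g\<close> satisfy them up to errors that are a small multiple of their own
  seminorms; the resulting bound absorbs these.
\<close>

lemma seminorm_le_of_almost_cosine:
  assumes s: "p (X - star X) \<le> s" "p (Y - star Y) \<le> s" "s \<le> 1/16"
    and q: "p (X * X + Y * Y - (Y + Y)) \<le> q" and r: "p (X * Y - Y * X) \<le> r"
  shows "p X \<le> 1 + 2 * (q + r + 15 * s) + s"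
proof -
  define d where "d = (1/2) *\<^sub>C (X + star X)"
  define g where "g = (1/2) *\<^sub>C (Y + star Y)"
  have s0: "0 \<le> s" "0 \<le> q" "0 \<le> r" using s q r p_nonneg order_trans by blast+
  have half: "(1/2) *\<^sub>C (z + z) = z" for z :: 'd
    by (simp add: scaleC_add_right flip: scaleC_add_left)
  have sa: "star d = d" "star g = g"
    by (simp_all add: d_def g_def star_scaleC star_add star_star add.commute)
  have near: "p (Z - (1/2) *\<^sub>C (Z + star Z)) \<le> s" if "p (Z - star Z) \<le> s" for Z
  proof -
    have "Z - (1/2) *\<^sub>C (Z + star Z) = (1/2) *\<^sub>C (Z - star Z)"
      using half[of Z] by (simp add: scaleC_add_right scaleC_diff_right algebra_simps)
    thus ?thesis using that s0 by (simp add: p_scaleC)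
  qed
  have Xd: "p (X - d) \<le> s" and Yg: "p (Y - g) \<le> s"
    unfolding d_def g_def by (intro near s)+
  have prod: "p (U * V - u * v) \<le> s * (p u + p v + s)" if "p (U - u) \<le> s" "p (V - v) \<le> s" for U u V v
  proof -
    have "U * V - u * v = (U - u) * V + u * (V - v)" by (simp add: algebra_simps)
    also have "p \<dots> \<le> p ((U - u) * V) + p (u * (V - v))" by (rule p_add)
    also have "\<dots> \<le> p (U - u) * p V + p u * p (V - v)" by (intro add_mono p_mult)
    also have "\<dots> \<le> s * (p v + s) + p u * s"
      using that p_triangle_ge[of V v] p_nonneg s0 by (intro add_mono mult_mono) auto
    finally show ?thesis by (simp add: algebra_simps)
  qed
  have add3: "p (a + b + c) \<le> p a + p b + p c" for a b c
    using p_add[of "a + b" c] p_add[of a b] by linarith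
  define \<delta> where "\<delta> = q + r + s * (4 * p d + 4 * p g + 4 * s + 2)"
  have nn: "0 \<le> s * p d" "0 \<le> s * p g" "0 \<le> s * s" using s0 p_nonneg by auto
  have 1: "p (d * d + g * g - (g + g)) \<le> \<delta>"
  proof -
    have "d * d + g * g - (g + g)
      = (X * X + Y * Y - (Y + Y)) - ((X * X - d * d) + (Y * Y - g * g) + ((g - Y) + (g - Y)))"
      by (simp add: algebra_simps)
    also have "p \<dots> \<le> p (X * X + Y * Y - (Y + Y)) + p ((X * X - d * d) + (Y * Y - g * g) + ((g - Y) + (g - Y)))"
      by (rule p_diff)
    also have "\<dots> \<le> q + (s * (p d + p d + s) + s * (p g + p g + s) + (s + s))"
    proof (intro add_mono q order_trans[OF add3] prod Xd Yg order_trans[OF p_add[of "g - Y"]])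
      show "p (g - Y) \<le> s" using Yg p_minus[of "Y - g"] by simp
      thus "p (g - Y) \<le> s" .
    qed
    also have "\<dots> \<le> \<delta>" unfolding \<delta>_def using s0 nn by (simp add: algebra_simps)
    finally show ?thesis .
  qed
  have 2: "p (d * g - g * d) \<le> \<delta>"
  proof -
    have "d * g - g * d = ((X * Y - Y * X) + (Y * X - g * d)) - (X * Y - d * g)" by simp
    also have "p \<dots> \<le> p ((X * Y - Y * X) + (Y * X - g * d)) + p (X * Y - d * g)" by (rule p_diff)
    also have "\<dots> \<le> (r + s * (p g + p d + s)) + s * (p d + p g + s)"
      by (intro add_mono prod Xd Yg order_trans[OF p_add] r)
    also have "\<dots> \<le> \<delta>" unfolding \<delta>_def using s0 nn by (simp add: algebra_simps)
    finally show ?thesis .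
  qed
  have \<delta>0: "\<delta> \<ge> 0" using 1 p_nonneg order_trans by blast
  have sqrt: "sqrt (1 + 2*\<delta>) \<le> 1 + \<delta>"
    by (rule real_le_lsqrt) (use \<delta>0 in \<open>auto simp: power2_eq_square algebra_simps\<close>)
  have pd: "p d \<le> 1 + \<delta>" and pg: "p g \<le> 2 + \<delta>"
    using seminorm_cosine_sine_norms[OF sa 1 2] sqrt by auto
  have "\<delta> \<le> q + r + s * (4 * (1 + \<delta>) + 4 * (2 + \<delta>) + 4 * (1/16) + 2)"
  proof -
    have "4 * p d + 4 * p g + 4 * s + 2 \<le> 4 * (1 + \<delta>) + 4 * (2 + \<delta>) + 4 * (1/16) + 2"
      using pd pg s(3) by argo
    thus ?thesis unfolding \<delta>_def[symmetric] using s0(1)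
      by (subst \<delta>_def) (intro add_left_mono mult_left_mono)
  qed
  also have "\<dots> = q + r + s * (57/4) + 8 * (s * \<delta>)" by (simp add: algebra_simps)
  finally have "\<delta> \<le> q + r + s * (57/4) + 8 * (s * \<delta>)" .
  moreover have "s * \<delta> \<le> (1/16) * \<delta>" using s \<delta>0 by (intro mult_right_mono) auto
  ultimately have "\<delta> \<le> 2 * (q + r + 15 * s)" using s0 by (simp add: algebra_simps)
  moreover have "p X \<le> p d + p (X - d)" by (rule p_triangle_ge)
  ultimately show ?thesis using pd Xd by linarith
qed

lemma asymptotic_on_selfadjoint_bound:
  assumes C: "cosine_subalgebra C" and f: "asymptotic_on \<F> C f"
    and a: "a \<in> C" "star a = a" "norm a < 1" and "\<epsilon> > 0"
  shows "eventually (\<lambda>i. p (f i a) < 1 + \<epsilon>) \<F>"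
proof -
  obtain b where b: "b \<in> C" "star b = b" "a * b = b * a" "b + b - b * b = a * a"
    using C a unfolding cosine_subalgebra_def is_cosine_complement_def by blast
  have ops: "a * a \<in> C" "b * b \<in> C" "a * b \<in> C" using C a b unfolding cosine_subalgebra_def by auto
  note D = asymptotic_onD[OF f]
  define s where "s i = p (f i a - star (f i a)) + p (f i b - star (f i b))" for i
  define q where "q i = p (f i (a * a) - f i a * f i a) + p (f i (b * b) - f i b * f i b) +
      p (f i (b + b) - (f i b + f i b)) + p (f i (a * a + b * b) - (f i (a * a) + f i (b * b)))" for i
  define r where "r i = p (f i (a * b) - f i a * f i b) + p (f i (b * a) - f i b * f i a)" for i
  have s: "(s \<longlongrightarrow> 0) \<F>"
    unfolding s_def using tendsto_add[OF D(4)[OF a(1)] D(4)[OF b(1)]] by (simp add: a b)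
  have "(q \<longlongrightarrow> 0 + 0 + 0 + 0) \<F>"
    unfolding q_def by (intro tendsto_add D a b ops)
  moreover have "(r \<longlongrightarrow> 0 + 0) \<F>"
    unfolding r_def by (intro tendsto_add D a b)
  ultimately have "((\<lambda>i. 1 + 2 * (q i + r i + 15 * s i) + s i) \<longlongrightarrow> 1 + 2 * (0 + 0 + 15 * 0) + 0) \<F>"
    by (intro tendsto_intros s) simp_all
  hence ev1: "eventually (\<lambda>i. 1 + 2 * (q i + r i + 15 * s i) + s i < 1 + \<epsilon>) \<F>"
    using assms(6) by (intro order_tendstoD(2)) auto
  have ev2: "eventually (\<lambda>i. s i < 1/16) \<F>" using s by (rule order_tendstoD) simp
  show ?thesis using ev1 ev2
  proof eventually_elim
    case (elim i)
    have add4: "p (- u - v + w - z) \<le> p u + p v + p w + p z" for u v w z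
      using p_diff[of "- u - v + w" z] p_add[of "- u - v" w] p_diff[of "-u" v] p_minus[of u] by linarith
    have q: "p (f i a * f i a + f i b * f i b - (f i b + f i b)) \<le> q i"
    proof -
      have eq: "a * a + b * b = b + b" using b(4) by (simp add: algebra_simps)
      have "f i a * f i a + f i b * f i b - (f i b + f i b)
        = - (f i (a * a) - f i a * f i a) - (f i (b * b) - f i b * f i b)
          + (f i (b + b) - (f i b + f i b)) - (f i (a * a + b * b) - (f i (a * a) + f i (b * b)))"
        unfolding eq by simp
      thus ?thesis unfolding q_def by (simp only: add4)
    qed
    have r: "p (f i a * f i b - f i b * f i a) \<le> r i"
    proof -
      have "f i a * f i b - f i b * f i a = (f i (b * a) - f i b * f i a) - (f i (a * b) - f i a * f i b)"
        using b(3) by simp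
      also have "p \<dots> \<le> p (f i (b * a) - f i b * f i a) + p (f i (a * b) - f i a * f i b)"
        by (rule p_diff)
      finally show ?thesis unfolding r_def by linarith
    qed
    have "p (f i a) \<le> 1 + 2 * (q i + r i + 15 * s i) + s i"
      by (rule seminorm_le_of_almost_cosine[OF _ _ _ q r])
         (use elim p_nonneg[of "f i a - star (f i a)"] p_nonneg[of "f i b - star (f i b)"] in \<open>auto simp: s_def\<close>)
    thus ?case using elim by linarith
  qed
qed

text \<open>
  The bound for self-adjoint elements, applied to a rational multiple \<open>a'\<close> of \<open>a\<^sup>*a\<close> with norm just below
  \<open>1\<close>, bounds \<open>\<parallel>f a\<parallel>\<^sup>2 \<approx> \<parallel>f (a\<^sup>*a)\<parallel>\<close>.
\<close>

lemma asymptotic_on_bound: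
  assumes C: "cosine_subalgebra C" and f: "asymptotic_on \<F> C f"
    and a: "a \<in> C" and \<epsilon>: "\<epsilon> > 0"
  shows "eventually (\<lambda>i. p (f i a) \<le> norm a + \<epsilon>) \<F>"
proof -
  define r where "r = norm a"
  define \<kappa> where "\<kappa> = \<epsilon>\<^sup>2/4"
  have \<kappa>: "\<kappa> > 0" using \<epsilon> by (simp add: \<kappa>_def)
  have pos: "r\<^sup>2 + \<kappa>/2 > 0" "r\<^sup>2 + \<kappa> > 0" using \<kappa> by (auto intro: add_nonneg_pos)
  have "1 / (r\<^sup>2 + \<kappa>) < 1 / (r\<^sup>2 + \<kappa>/2)" using pos \<kappa> by (intro divide_strict_left_mono) auto
  then obtain m where m: "1 / (r\<^sup>2 + \<kappa>) < real_of_rat m" "real_of_rat m < 1 / (r\<^sup>2 + \<kappa>/2)"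
    using of_rat_dense by blast
  define \<mu> where "\<mu> = real_of_rat m"
  have "0 < 1 / (r\<^sup>2 + \<kappa>)" using pos by simp
  hence \<mu>0: "\<mu> > 0" using m unfolding \<mu>_def by linarith
  have \<mu>1: "1 / \<mu> < r\<^sup>2 + \<kappa>" using m(1) \<mu>0 pos unfolding \<mu>_def[symmetric]
    by (simp add: field_simps)
  have "\<mu> * (r\<^sup>2 + \<kappa>/2) < 1" using m(2) pos unfolding \<mu>_def[symmetric] by (simp add: field_simps)
  moreover have "\<mu> * (\<kappa>/2) > 0" using \<mu>0 \<kappa> by simp
  ultimately have \<mu>2: "\<mu> * r\<^sup>2 < 1" unfolding distrib_left by linarith
  define c where "c = complex_of_real \<mu>"
  have c: "c \<in> rational_scalars" unfolding c_def \<mu>_def by (rule of_rat_rational_scalar)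
  define a' where "a' = c *\<^sub>C (star a * a)"
  have aC: "star a \<in> C" "star a * a \<in> C" "a' \<in> C"
    using C a c unfolding cosine_subalgebra_def a'_def by auto
  have a': "star a' = a'" "norm a' < 1"
    using \<mu>2 \<mu>0 by (auto simp: a'_def c_def star_scaleC star_mult star_star norm_scaleC cstar_identity r_def)
  define \<eta> where "\<eta> = \<kappa> * \<mu>"
  have \<eta>: "\<eta> > 0" using \<kappa> \<mu>0 by (simp add: \<eta>_def)
  have B: "(1 + \<eta>) / \<mu> < r\<^sup>2 + 2 * \<kappa>" using \<mu>1 \<mu>0 by (simp add: \<eta>_def add_divide_distrib)
  note D = asymptotic_onD[OF f]
  define q1 where "q1 i = p (f i a' - c *\<^sub>C f i (star a * a))" for i
  define q2 where "q2 i = p (f i (star a * a) - f i (star a) * f i a)" for i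
  define s where "s i = p (f i (star a) - star (f i a))" for i
  have "(q1 \<longlongrightarrow> 0) \<F>" "(q2 \<longlongrightarrow> 0) \<F>" "(s \<longlongrightarrow> 0) \<F>"
    unfolding q1_def q2_def s_def a'_def by (intro D a aC c)+
  hence "((\<lambda>i. q1 i / \<mu> + q2 i + s i * (r + \<epsilon>)) \<longlongrightarrow> 0 / \<mu> + 0 + 0 * (r + \<epsilon>)) \<F>"
    using \<mu>0 by (intro tendsto_intros) auto
  hence ev1: "eventually (\<lambda>i. q1 i / \<mu> + q2 i + s i * (r + \<epsilon>) < 2 * \<kappa>) \<F>"
    by (rule order_tendstoD) (use \<kappa> in simp)
  have ev2: "eventually (\<lambda>i. p (f i a') < 1 + \<eta>) \<F>"
    by (rule asymptotic_on_selfadjoint_bound[OF C f aC(3) a' \<eta>])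
  have ev3: "eventually (\<lambda>i. s i < \<epsilon>) \<F>" using \<open>(s \<longlongrightarrow> 0) \<F>\<close> \<epsilon> by (rule order_tendstoD)
  show ?thesis using ev1 ev2 ev3
  proof eventually_elim
    case (elim i)
    define x where "x = p (f i a)"
    have x0: "x \<ge> 0" "s i \<ge> 0" by (auto simp: x_def s_def p_nonneg)
    have "\<mu> * p (f i (star a * a)) = p (c *\<^sub>C f i (star a * a))"
      using \<mu>0 by (simp add: p_scaleC c_def)
    also have "\<dots> \<le> p (f i a') + q1 i"
      unfolding q1_def using p_triangle_ge[of "c *\<^sub>C f i (star a * a)" "f i a'"]
        p_minus[of "f i a' - c *\<^sub>C f i (star a * a)"] by simp
    also have "\<dots> \<le> 1 + \<eta> + q1 i" using elim by simp
    finally have 1: "p (f i (star a * a)) \<le> (1 + \<eta>) / \<mu> + q1 i / \<mu>"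
      using \<mu>0 by (simp add: field_simps)
    have "x\<^sup>2 \<le> p (star (f i a) * f i a)" unfolding x_def by (rule p_cstar)
    also have "star (f i a) * f i a = f i (star a * a) - (f i (star a * a) - f i (star a) * f i a)
        - (f i (star a) - star (f i a)) * f i a" by (simp add: algebra_simps)
    also have "p \<dots> \<le> p (f i (star a * a)) + q2 i + p ((f i (star a) - star (f i a)) * f i a)"
      unfolding q2_def by (intro order_trans[OF p_diff] add_mono p_diff order.refl)
    also have "p ((f i (star a) - star (f i a)) * f i a) \<le> s i * x"
      unfolding s_def x_def by (rule p_mult)
    finally have 2: "x\<^sup>2 \<le> (1 + \<eta>) / \<mu> + q1 i / \<mu> + q2 i + s i * x" using 1 by linarith
    have "x \<le> r + \<epsilon>"
    proof (rule ccontr)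
      \<comment> \<open>as \<open>f a\<close> is not known to be bounded, the error \<open>s x\<close> is absorbed by the left-hand side\<close>
      assume "\<not> x \<le> r + \<epsilon>"
      hence gt: "x > r + \<epsilon>" by simp
      have r0: "r \<ge> 0" by (simp add: r_def)
      have "(r + \<epsilon>) * (r + \<epsilon> - s i) \<le> x * (x - s i)"
        using gt r0 \<epsilon> elim by (intro mult_mono) auto
      hence "(r + \<epsilon>)\<^sup>2 - s i * (r + \<epsilon>) \<le> x\<^sup>2 - s i * x" by (simp add: power2_eq_square algebra_simps)
      hence "(r + \<epsilon>)\<^sup>2 < r\<^sup>2 + 4 * \<kappa>" using 2 B elim by linarith
      moreover have "(r + \<epsilon>)\<^sup>2 \<ge> r\<^sup>2 + \<epsilon>\<^sup>2" using r0 \<epsilon> by (simp add: power2_sum)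
      ultimately show False by (simp add: \<kappa>_def)
    qed
    thus ?case by (simp add: x_def r_def)
  qed
qed

end

section \<open>Homomorphisms modulo an ideal and lifting of paths\<close>

context star_ideal
begin

definition hom_mod :: "('b::cstar_algebra \<Rightarrow> 'd) \<Rightarrow> bool" where
  "hom_mod r \<longleftrightarrow>
    (\<forall>a b. r (a + b) - (r a + r b) \<in> I) \<and> (\<forall>c a. r (c *\<^sub>C a) - c *\<^sub>C r a \<in> I) \<and>
    (\<forall>a b. r (a * b) - r a * r b \<in> I) \<and> (\<forall>a. r (star a) - star (r a) \<in> I)"

lemma hom_modD:
  assumes "hom_mod r"
  shows "r (a + b) - (r a + r b) \<in> I" "r (c *\<^sub>C a) - c *\<^sub>C r a \<in> I"
    "r (a * b) - r a * r b \<in> I" "r (star a) - star (r a) \<in> I"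
  using assms unfolding hom_mod_def by blast+

lemma hom_mod_cong:
  assumes r: "hom_mod r" and eq: "\<And>a. r' a - r a \<in> I"
  shows "hom_mod r'"
  unfolding hom_mod_def
proof (intro conjI allI)
  fix a b c
  have "r' (a + b) - (r' a + r' b)
      = (r' (a + b) - r (a + b)) + (r (a + b) - (r a + r b)) - (r' a - r a) - (r' b - r b)" by simp
  thus "r' (a + b) - (r' a + r' b) \<in> I" by (simp only:) (intro add_I diff_I eq hom_modD[OF r])
  have "r' (c *\<^sub>C a) - c *\<^sub>C r' a
      = (r' (c *\<^sub>C a) - r (c *\<^sub>C a)) + (r (c *\<^sub>C a) - c *\<^sub>C r a) - c *\<^sub>C (r' a - r a)"
    by (simp add: scaleC_diff_right)
  thus "r' (c *\<^sub>C a) - c *\<^sub>C r' a \<in> I" by (simp only:) (intro add_I diff_I scaleC_I eq hom_modD[OF r])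
  have "r' (a * b) - r' a * r' b
      = (r' (a * b) - r (a * b)) + (r (a * b) - r a * r b) - (r' a - r a) * r' b - r a * (r' b - r b)"
    by (simp add: algebra_simps)
  thus "r' (a * b) - r' a * r' b \<in> I"
    by (simp only:) (intro add_I diff_I left_I right_I eq hom_modD[OF r])
  have "r' (star a) - star (r' a)
      = (r' (star a) - r (star a)) + (r (star a) - star (r a)) - star (r' a - r a)"
    by (simp add: star_diff)
  thus "r' (star a) - star (r' a) \<in> I" by (simp only:) (intro add_I diff_I star_I eq hom_modD[OF r])
qed

text \<open>
  A homomorphism into the quotient is a constant asymptotic homomorphism for the quotient seminorm.
\<close>

lemma hom_mod_contractive:
  assumes "hom_mod r"
  shows "infdist (r a) I \<le> norm a"
proof (rule field_le_epsilon)
  fix \<epsilon> :: real assume "\<epsilon> > 0"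
  have "quot.asymptotic_on (top :: unit filter) UNIV (\<lambda>_. r)"
    unfolding quot.asymptotic_on_def using hom_modD[OF assms] by simp
  from quot.asymptotic_on_bound[OF cosine_subalgebra_UNIV this _ \<open>\<epsilon> > 0\<close>, of a]
  show "infdist (r a) I \<le> norm a + \<epsilon>" by simp
qed

lemma hom_mod_diff:
  assumes "hom_mod r"
  shows "r (a - b) - (r a - r b) \<in> I"
proof -
  have "r (a - b) - (r a - r b) = (r (a + (-1) *\<^sub>C b) - (r a + r ((-1) *\<^sub>C b)))
      + (r ((-1) *\<^sub>C b) - (-1) *\<^sub>C r b)" by simp
  thus ?thesis by (simp only:) (intro add_I hom_modD[OF assms])
qed

lemma infdist_hom_mod_diff:
  assumes "hom_mod r"
  shows "infdist (r a - r b) I \<le> norm (a - b)"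
proof -
  have "infdist (r a - r b) I \<le> infdist (r (a - b)) I + infdist ((r a - r b) - r (a - b)) I"
    by (rule quot.p_triangle_ge)
  moreover have "(r a - r b) - r (a - b) \<in> I"
    using minus_I[OF hom_mod_diff[OF assms, of a b]] by simp
  ultimately show ?thesis using hom_mod_contractive[OF assms, of "a - b"] by simp
qed

text \<open>Continuity on \<open>[0,1]\<close> of the path that \<open>G\<close> induces in the quotient.\<close>

definition quotient_continuous :: "(real \<Rightarrow> 'd) \<Rightarrow> bool" where
  "quotient_continuous G \<longleftrightarrow>
    (\<forall>s\<in>{0..1}. ((\<lambda>t. infdist (G t - G s) I) \<longlongrightarrow> 0) (at s within {0..1}))"

lemma quot_sum_le: "infdist (\<Sum>k\<in>A. f k) I \<le> (\<Sum>k\<in>A. infdist (f k) I)"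
  by (induction A rule: infinite_finite_induct)
     (auto intro: order_trans[OF quot.p_add])

lemma quot_scaleR: "infdist (c *\<^sub>R x) I = \<bar>c\<bar> * infdist x I"
  using quot.p_scaleC[of "complex_of_real c" x] by (simp add: scaleC_of_real)

lemma infdist_le_norm': "infdist x I \<le> norm x"
  using infdist_le_norm[OF zero_I, of x] by simp

lemma quotient_continuous_bounded:
  assumes "quotient_continuous G"
  shows "\<exists>M>0. \<forall>t\<in>{0..1}. infdist (G t) I \<le> M"
proof -
  have "continuous_on {0..1} (\<lambda>t. infdist (G t) I)"
    unfolding continuous_on_def
  proof
    fix s :: real assume s: "s \<in> {0..1}"
    have "\<bar>infdist (G t) I - infdist (G s) I\<bar> \<le> infdist (G t - G s) I" for t
      using quot.p_triangle_ge[of "G t" "G s"] quot.p_triangle_ge[of "G s" "G t"]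
        quot.p_minus[of "G t - G s"] by simp
    hence "eventually (\<lambda>t. norm (infdist (G t) I - infdist (G s) I) \<le> infdist (G t - G s) I) (at s within {0..1})"
      by (simp add: always_eventually)
    moreover have "((\<lambda>t. infdist (G t - G s) I) \<longlongrightarrow> 0) (at s within {0..1})"
      using assms s unfolding quotient_continuous_def by blast
    ultimately have "((\<lambda>t. infdist (G t) I - infdist (G s) I) \<longlongrightarrow> 0) (at s within {0..1})"
      by (rule Lim_null_comparison)
    thus "((\<lambda>t. infdist (G t) I) \<longlongrightarrow> infdist (G s) I) (at s within {0..1})"
      by (simp add: LIM_zero_iff)
  qed
  hence "bounded ((\<lambda>t. infdist (G t) I) ` {0..1})"
    by (intro compact_imp_bounded compact_continuous_image compact_Icc)
  then obtain M where "M > 0" "\<forall>x\<in>(\<lambda>t. infdist (G t) I) ` {0..1}. norm x \<le> M"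
    unfolding bounded_pos by blast
  thus ?thesis by (intro exI[of _ M]) auto
qed

text \<open>
  A partition of unity subordinate to small intervals, applied to lifts of almost minimal norm of
  the values at their midpoints.
\<close>

lemma approximate_path_lift:
  assumes G: "quotient_continuous G" and r: "\<forall>t\<in>{0..1}. infdist (G t) I \<le> r" and \<epsilon>: "\<epsilon> > 0"
  shows "\<exists>g. continuous_on {0..1} g \<and> (\<forall>t\<in>{0..1}. norm (g t) \<le> r + \<epsilon> \<and> infdist (G t - g t) I \<le> \<epsilon>)"
proof -
  have "\<exists>\<delta>>0. \<forall>t\<in>{0..1}. \<bar>t - s\<bar> < \<delta> \<longrightarrow> infdist (G t - G s) I < \<epsilon>" if "s \<in> {0..1}" for s
  proof -
    have "eventually (\<lambda>t. infdist (G t - G s) I < \<epsilon>) (at s within {0..1})"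
      by (rule order_tendstoD(2)[OF _ \<epsilon>]) (use G that in \<open>simp add: quotient_continuous_def\<close>)
    then obtain \<delta> where "\<delta> > 0" "\<forall>t\<in>{0..1}. t \<noteq> s \<and> dist t s < \<delta> \<longrightarrow> infdist (G t - G s) I < \<epsilon>"
      unfolding eventually_at by blast
    moreover have "infdist (G s - G s) I < \<epsilon>" using \<epsilon> by simp
    ultimately have "\<forall>t\<in>{0..1}. \<bar>t - s\<bar> < \<delta> \<longrightarrow> infdist (G t - G s) I < \<epsilon>"
      by (metis dist_real_def)
    thus ?thesis using \<open>\<delta> > 0\<close> by blast
  qed
  then obtain \<delta> where \<delta>: "\<And>s. s \<in> {0..1} \<Longrightarrow> \<delta> s > 0"
      "\<And>s t. s \<in> {0..1} \<Longrightarrow> t \<in> {0..1} \<Longrightarrow> \<bar>t - s\<bar> < \<delta> s \<Longrightarrow> infdist (G t - G s) I < \<epsilon>"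
    by metis
  have "\<exists>d. norm d < infdist (G s) I + \<epsilon> \<and> G s - d \<in> I" for s
    using infdist_approx[OF \<epsilon>, of "G s"] by (metis add_diff_cancel_left' diff_add_cancel)
  then obtain d where d: "\<And>s. norm (d s) < infdist (G s) I + \<epsilon>" "\<And>s. G s - d s \<in> I" by metis
  have "{0..1} \<subseteq> (\<Union>s\<in>{0..1}. ball s (\<delta> s))" using \<delta>(1) by force
  with compact_Icc obtain K where K: "K \<subseteq> {0..1}" "finite K" "{0..1} \<subseteq> (\<Union>s\<in>K. ball s (\<delta> s))"
    by (rule compactE_image[OF _ open_ball])
  define \<phi> where "\<phi> s t = max 0 (\<delta> s - \<bar>t - s\<bar>)" for s t
  define \<Phi> where "\<Phi> t = (\<Sum>s\<in>K. \<phi> s t)" for t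
  define u where "u s t = \<phi> s t / \<Phi> t" for s t
  define g where "g t = (\<Sum>s\<in>K. u s t *\<^sub>R d s)" for t
  have \<Phi>: "\<Phi> t > 0" if "t \<in> {0..1}" for t
  proof -
    obtain s where s: "s \<in> K" "t \<in> ball s (\<delta> s)" using K(3) \<open>t \<in> {0..1}\<close> by blast
    have "\<phi> s t \<le> \<Phi> t" unfolding \<Phi>_def by (rule member_le_sum) (use s K in \<open>auto simp: \<phi>_def\<close>)
    moreover have "\<phi> s t > 0" using s by (auto simp: \<phi>_def dist_real_def)
    ultimately show ?thesis by linarith
  qed
  have u: "u s t \<ge> 0" "(\<Sum>s\<in>K. u s t) = 1" if "t \<in> {0..1}" for s t
    using \<Phi>[OF that] by (auto simp: u_def \<phi>_def \<Phi>_def simp flip: sum_divide_distrib)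
  have "continuous_on {0..1} g"
    unfolding g_def u_def \<phi>_def \<Phi>_def
    by (intro continuous_intros) (use \<Phi> in \<open>force simp: \<phi>_def \<Phi>_def\<close>)
  moreover have "norm (g t) \<le> r + \<epsilon>" if t: "t \<in> {0..1}" for t
  proof -
    have "norm (g t) \<le> (\<Sum>s\<in>K. u s t * (r + \<epsilon>))"
      unfolding g_def
    proof (rule sum_norm_le)
      fix s assume "s \<in> K"
      hence "norm (d s) \<le> r + \<epsilon>" using d(1)[of s] r K(1) by force
      thus "norm (u s t *\<^sub>R d s) \<le> u s t * (r + \<epsilon>)" using u(1)[OF t] by (simp add: mult_left_mono)
    qed
    also have "\<dots> = r + \<epsilon>" by (simp add: u(2)[OF t] flip: sum_distrib_right)
    finally show ?thesis .
  qed
  moreover have "infdist (G t - g t) I \<le> \<epsilon>" if t: "t \<in> {0..1}" for t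
  proof -
    have "G t = (\<Sum>s\<in>K. u s t *\<^sub>R G t)" by (simp add: u(2)[OF t] flip: scaleR_sum_left)
    hence "G t - g t = (\<Sum>s\<in>K. u s t *\<^sub>R (G t - d s))"
      by (simp add: g_def sum_subtractf scaleR_diff_right)
    also have "infdist \<dots> I \<le> (\<Sum>s\<in>K. infdist (u s t *\<^sub>R (G t - d s)) I)" by (rule quot_sum_le)
    also have "\<dots> \<le> (\<Sum>s\<in>K. u s t * \<epsilon>)"
    proof (rule sum_mono)
      fix s assume s: "s \<in> K"
      show "infdist (u s t *\<^sub>R (G t - d s)) I \<le> u s t * \<epsilon>"
      proof (cases "u s t = 0")
        case False
        hence "\<phi> s t > 0" by (auto simp: u_def \<phi>_def)
        hence "\<bar>t - s\<bar> < \<delta> s" by (auto simp: \<phi>_def)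
        hence "infdist (G t - G s) I < \<epsilon>" using \<delta>(2)[of s t] s K(1) t by auto
        moreover have "infdist (G t - d s) I \<le> infdist (G t - G s) I + infdist (G s - d s) I"
          using quot.p_add[of "G t - G s" "G s - d s"] by simp
        ultimately have "infdist (G t - d s) I \<le> \<epsilon>" using d(2)[of s] by simp
        thus ?thesis using u(1)[OF t] by (simp add: quot_scaleR mult_left_mono)
      qed simp
    qed
    also have "\<dots> = \<epsilon>" by (simp add: u(2)[OF t] flip: sum_distrib_right)
    finally show ?thesis .
  qed
  ultimately show ?thesis by blast
qed

text \<open>Surjectivity of \<open>C([0,1], D) \<rightarrow> C([0,1], D/I)\<close>, by summing successive corrections.\<close>

lemma path_lift:
  assumes "quotient_continuous G"
  shows "\<exists>g. continuous_on {0..1} g \<and> (\<forall>t\<in>{0..1}. g t - G t \<in> I)"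
proof -
  obtain M where M: "M > 0" "\<forall>t\<in>{0..1}. infdist (G t) I \<le> M"
    using quotient_continuous_bounded[OF assms] by blast
  define \<rho> where "\<rho> n = M * (1/2) ^ n" for n
  have \<rho>: "\<rho> n > 0" for n using M by (simp add: \<rho>_def)
  define P where "P = (\<lambda>(n::nat) H. quotient_continuous H \<and> (\<forall>t\<in>{0..1}. infdist (H t) I \<le> \<rho> n) \<and>
      (n = 0 \<longrightarrow> H = G))"
  define Q where "Q = (\<lambda>(n::nat) (H :: real \<Rightarrow> 'd) H'. continuous_on {0..1} (\<lambda>t. H t - H' t) \<and>
      (\<forall>t\<in>{0..1}. norm (H t - (H' t :: 'd)) \<le> 2 * \<rho> n))"
  have "\<exists>H. \<forall>n. P n (H n) \<and> Q n (H n) (H (Suc n))"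
  proof (rule dependent_nat_choice)
    show "\<exists>H. P 0 H" using assms M by (auto simp: P_def \<rho>_def)
  next
    fix H n assume H: "P n H"
    obtain g where g: "continuous_on {0..1} g"
        "\<And>t. t \<in> {0..1} \<Longrightarrow> norm (g t) \<le> \<rho> n + \<rho> (Suc n)"
        "\<And>t. t \<in> {0..1} \<Longrightarrow> infdist (H t - g t) I \<le> \<rho> (Suc n)"
      using approximate_path_lift[of H "\<rho> n" "\<rho> (Suc n)"] H \<rho> unfolding P_def by metis
    have "quotient_continuous (\<lambda>t. H t - g t)"
      unfolding quotient_continuous_def
    proof
      fix s :: real assume s: "s \<in> {0..1}"
      have "((\<lambda>t. g t - g s) \<longlongrightarrow> 0) (at s within {0..1})"
        using g(1) s unfolding continuous_on_def by (simp add: LIM_zero)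
      hence lim: "((\<lambda>t. infdist (H t - H s) I + norm (g t - g s)) \<longlongrightarrow> 0 + norm (0::'d)) (at s within {0..1})"
        using H s unfolding P_def quotient_continuous_def by (intro tendsto_intros) auto
      have "norm (infdist ((H t - g t) - (H s - g s)) I) \<le> infdist (H t - H s) I + norm (g t - g s)" for t
        using quot.p_diff[of "H t - H s" "g t - g s"] infdist_le_norm'[of "g t - g s"]
        by (simp add: algebra_simps infdist_nonneg)
      hence "eventually (\<lambda>t. norm (infdist ((H t - g t) - (H s - g s)) I)
          \<le> infdist (H t - H s) I + norm (g t - g s)) (at s within {0..1})"
        by (rule always_eventually[OF allI])
      thus "((\<lambda>t. infdist ((H t - g t) - (H s - g s)) I) \<longlongrightarrow> 0) (at s within {0..1})"
        by (rule Lim_null_comparison) (use lim in simp)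
    qed
    moreover have "\<rho> (Suc n) \<le> \<rho> n" using \<rho>[of n] by (simp add: \<rho>_def)
    ultimately show "\<exists>H'. P (Suc n) H' \<and> Q n H H'"
      using g by (intro exI[of _ "\<lambda>t. H t - g t"]) (force simp: P_def Q_def)
  qed
  then obtain H where H: "\<And>n. P n (H n)" "\<And>n. Q n (H n) (H (Suc n))" by blast
  have H0: "H 0 = G" using H(1)[of 0] by (simp add: P_def)
  define g where "g t = (\<Sum>n. H n t - H (Suc n) t)" for t
  have sm: "summable (\<lambda>n. 2 * \<rho> n)"
    unfolding \<rho>_def by (intro summable_mult summable_geometric) auto
  have partial: "(\<Sum>n<N. H n t - H (Suc n) t) = G t - H N t" for N t
    by (induction N) (auto simp: H0)
  have unif: "uniform_limit {0..1} (\<lambda>N t. \<Sum>n<N. H n t - H (Suc n) t) g sequentially"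
    unfolding g_def by (rule Weierstrass_m_test[OF _ sm]) (use H(2) in \<open>auto simp: Q_def\<close>)
  have "continuous_on {0..1} g"
    by (rule uniform_limit_theorem[OF _ unif])
       (use H(2) in \<open>auto simp: Q_def intro!: always_eventually continuous_on_sum\<close>)
  moreover have "g t - G t \<in> I" if t: "t \<in> {0..1}" for t
  proof (rule infdist_eq_0D)
    have lim: "(\<lambda>N. G t - H N t) \<longlonglongrightarrow> g t"
      using tendsto_uniform_limitI[OF unif t] unfolding partial .
    have "(\<lambda>N. norm (g t - (G t - H N t))) \<longlonglongrightarrow> 0"
      using tendsto_norm_zero[OF tendsto_diff[OF tendsto_const lim, of "g t", simplified]] by simp
    moreover have "\<rho> \<longlonglongrightarrow> 0" unfolding \<rho>_def by (rule tendsto_mult_right_zero) (simp add: LIMSEQ_power_zero)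
    ultimately have lim0: "(\<lambda>N. norm (g t - (G t - H N t)) + \<rho> N) \<longlonglongrightarrow> 0 + 0" by (rule tendsto_add)
    moreover have "infdist (g t - G t) I \<le> norm (g t - (G t - H N t)) + \<rho> N" for N
    proof -
      have "infdist (g t - G t) I \<le> infdist (g t - (G t - H N t)) I + infdist (H N t) I"
        using quot.p_diff[of "g t - (G t - H N t)" "H N t"] by simp
      thus ?thesis using infdist_le_norm'[of "g t - (G t - H N t)"] H(1)[of N] t by (force simp: P_def)
    qed
    ultimately have "infdist (g t - G t) I \<le> 0 + 0" by (intro LIMSEQ_le_const[OF lim0]) auto
    thus "infdist (g t - G t) I = 0" using infdist_nonneg[of "g t - G t" I] by linarith
  qed
  ultimately show ?thesis by blast
qed

end

section \<open>Splicing a slowly varying sequence along an approximate unit\<close>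

text \<open>
  By summation by parts this is \<open>\<Sum>\<^bsub>k<M\<^esub> (e\<^sub>k - e\<^bsub>k-1\<^esub>) v\<^sub>k + (1 - e\<^bsub>M-1\<^esub>) v\<^sub>M\<close> with \<open>e\<^bsub>-1\<^esub> = 0\<close>: the
  sequence \<open>v\<close> is followed through the layers of an increasing approximate unit.  The present form
  makes sense in algebras without unit.
\<close>

definition splice_along :: "(nat \<Rightarrow> 'd::cstar_algebra) \<Rightarrow> nat \<Rightarrow> (nat \<Rightarrow> 'd) \<Rightarrow> 'd" where
  "splice_along e M v = v M + (\<Sum>k<M. e k * (v k - v (Suc k)))"

lemma splice_add: "splice_along e M (\<lambda>k. v k + w k) = splice_along e M v + splice_along e M w"
  by (simp add: splice_along_def algebra_simps sum.distrib sum_subtractf)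

lemma splice_diff: "splice_along e M (\<lambda>k. v k - w k) = splice_along e M v - splice_along e M w"
  by (simp add: splice_along_def algebra_simps sum.distrib sum_subtractf)

lemma splice_scaleC: "splice_along e M (\<lambda>k. c *\<^sub>C v k) = c *\<^sub>C splice_along e M v"
proof -
  have "c *\<^sub>C (\<Sum>k\<in>A. f k) = (\<Sum>k\<in>A. c *\<^sub>C f k)" for f :: "nat \<Rightarrow> 'a" and A
    by (induction A rule: infinite_finite_induct) (auto simp: scaleC_add_right)
  thus ?thesis by (simp add: splice_along_def scaleC_add_right scaleC_mult_right flip: scaleC_diff_right)
qed

lemma splice_extend:
  assumes "\<And>k. k \<ge> M \<Longrightarrow> v k = x" "N \<ge> M"
  shows "splice_along e N v = splice_along e M v"
proof -
  have "(\<Sum>k<N. e k * (v k - v (Suc k))) = (\<Sum>k<M. e k * (v k - v (Suc k)))"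
    using assms by (intro sum.mono_neutral_right) auto
  thus ?thesis using assms by (simp add: splice_along_def)
qed

lemma sum_mult_from:
  fixes D :: "nat \<Rightarrow> 'd::cstar_algebra"
  assumes "\<And>k. k < K \<Longrightarrow> D k = 0"
  shows "(\<Sum>k<M. f k * D k) = (\<Sum>k=K..<M. f k * D k)"
  using assms by (intro sum.mono_neutral_right) auto

text \<open>
  Seen from the start of the sequence only the elements \<open>(1 - e\<^sub>k) v\<^sub>k\<close> and \<open>(1 - e\<^sub>k) v\<^bsub>k+1\<^esub>\<close> enter.
\<close>

lemma splice_eq_from_start:
  assumes "K \<le> M" and const: "\<And>k. k < K \<Longrightarrow> v k = v (Suc k)"
  shows "splice_along e M v = v K - (\<Sum>k=K..<M. (v k - e k * v k) - (v (Suc k) - e k * v (Suc k)))"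
proof -
  have "(\<Sum>k=K..<M. v k - v (Suc k)) = v K - v M" using sum_Suc_diff'[OF assms(1), of "\<lambda>k. - v k"] by simp
  moreover have "(\<Sum>k<M. e k * (v k - v (Suc k))) = (\<Sum>k=K..<M. e k * (v k - v (Suc k)))"
    using const by (intro sum_mult_from) simp
  ultimately show ?thesis by (simp add: splice_along_def algebra_simps sum.distrib sum_subtractf)
qed

text \<open>
  The left-hand side is the product of the splices of \<open>v\<close> and \<open>w\<close>, computed as if the \<open>e\<^sub>k\<close> were central
  with \<open>e\<^sub>j e\<^sub>k = e\<^bsub>min j k\<^esub>\<close>, also for \<open>j = k\<close>.
\<close>

lemma splice_multiplicative_identity:
  fixes v w e :: "nat \<Rightarrow> 'd::cstar_algebra"
  shows "v M * w M + (\<Sum>k<M. e k * (v k - v (Suc k)) * w M) + (\<Sum>k<M. e k * v M * (w k - w (Suc k)))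
      + (\<Sum>j<M. \<Sum>k<M. e (min j k) * (v j - v (Suc j)) * (w k - w (Suc k)))
    = splice_along e M (\<lambda>k. v k * w k)"
proof (induction M)
  case (Suc M)
  define D where "D k = v k - v (Suc k)" for k
  define D' where "D' k = w k - w (Suc k)" for k
  have v: "v (Suc M) = v M - D M" and w: "w (Suc M) = w M - D' M" by (auto simp: D_def D'_def)
  have 1: "(\<Sum>j<M. e (min j M) * D j * D' M) = (\<Sum>j<M. e j * D j * D' M)"
    by (intro sum.cong) (auto simp: min_def)
  have 2: "(\<Sum>k<M. e (min M k) * D M * D' k) = (\<Sum>k<M. e k * D M * D' k)"
    by (intro sum.cong) (auto simp: min_def)
  have S: "(\<Sum>j<Suc M. \<Sum>k<Suc M. e (min j k) * D j * D' k)
      = (\<Sum>j<M. \<Sum>k<M. e (min j k) * D j * D' k) + (\<Sum>j<M. e j * D j * D' M)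
        + (\<Sum>k<M. e k * D M * D' k) + e M * D M * D' M"
    by (simp add: sum.distrib 1 2 algebra_simps)
  have A: "(\<Sum>k<Suc M. e k * D k * w (Suc M))
      = (\<Sum>k<M. e k * D k * w M) - (\<Sum>k<M. e k * D k * D' M) + e M * D M * w (Suc M)"
    by (simp add: w right_diff_distrib sum_subtractf)
  have B: "(\<Sum>k<Suc M. e k * v (Suc M) * D' k)
      = (\<Sum>k<M. e k * v M * D' k) - (\<Sum>k<M. e k * D M * D' k) + e M * v (Suc M) * D' M"
    by (simp add: v right_diff_distrib left_diff_distrib sum_subtractf)
  have "splice_along e (Suc M) (\<lambda>k. v k * w k) = splice_along e M (\<lambda>k. v k * w k)
      + (v (Suc M) * w (Suc M) - v M * w M) + e M * (v M * w M - v (Suc M) * w (Suc M))"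
    by (simp add: splice_along_def)
  moreover have "e M * (v M * w M - v (Suc M) * w (Suc M))
      = e M * D M * w (Suc M) + e M * v (Suc M) * D' M + e M * D M * D' M"
    unfolding v w by (simp add: algebra_simps)
  moreover have "splice_along e M (\<lambda>k. v k * w k) = v M * w M + (\<Sum>k<M. e k * D k * w M)
      + (\<Sum>k<M. e k * v M * D' k) + (\<Sum>j<M. \<Sum>k<M. e (min j k) * D j * D' k)"
    using Suc.IH by (simp only: D_def D'_def)
  ultimately have "v (Suc M) * w (Suc M) + (\<Sum>k<Suc M. e k * D k * w (Suc M)) + (\<Sum>k<Suc M. e k * v (Suc M) * D' k)
      + (\<Sum>j<Suc M. \<Sum>k<Suc M. e (min j k) * D j * D' k) = splice_along e (Suc M) (\<lambda>k. v k * w k)"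
    unfolding S A B by simp
  thus ?case by (simp only: D_def D'_def)
qed (simp add: splice_along_def)

text \<open>
  The tolerances \<open>\<epsilon> k\<close> are so small that sums over all pairs of indices between \<open>k\<close> and \<open>2k + 6\<close>
  still converge geometrically, and that layers multiplied by coefficients of size up to about \<open>k\<close>
  still count as almost orthogonal.
\<close>

definition tight_sequence :: "(nat \<Rightarrow> 'd::cstar_algebra) \<Rightarrow> (nat \<Rightarrow> real) \<Rightarrow> bool" where
  "tight_sequence e \<epsilon> \<longleftrightarrow>
    (\<forall>k. star (e k) = e k \<and> unit_contraction (e k) \<and> (\<forall>j<k. norm (e j - e k * e j) \<le> \<epsilon> k) \<and>
      \<epsilon> k > 0 \<and> max_norm_tolerance TYPE('d) ((real k + 1)\<^sup>2) ((1/2)^k) ((real k + 1)\<^sup>2 * \<epsilon> k) \<and>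
      (2 * real k + 6) * \<epsilon> k \<le> (1/2)^k)"

lemma norm_sum_le_geometric:
  assumes "\<And>k. K \<le> k \<Longrightarrow> k < M \<Longrightarrow> norm (f k) \<le> c * (1/2)^k" "c \<ge> 0"
  shows "norm (\<Sum>k=K..<M. f k) \<le> 2 * c * (1/2)^K"
proof -
  have "norm (\<Sum>k=K..<M. f k) \<le> (\<Sum>k=K..<M. c * (1/2)^k)" using assms by (intro sum_norm_le) auto
  also have "\<dots> = c * (\<Sum>k=K..<M. (1/2)^k)" by (simp add: sum_distrib_left)
  also have "\<dots> \<le> c * (2 * (1/2::real)^K)"
  proof (rule mult_left_mono)
    show "(\<Sum>k=K..<M. (1/2)^k) \<le> 2 * (1/2::real)^K"
  proof (cases "K \<le> M")
    case True
    have "(\<Sum>k=K..<M. (1/2::real)^k) = (\<Sum>k=K..<M. (- 2 * (1/2)^Suc k) - (- 2 * (1/2)^k))"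
      by (intro sum.cong) auto
    also have "\<dots> = - 2 * (1/2)^M - (- 2 * (1/2)^K)" by (rule sum_Suc_diff'[OF True])
    finally show ?thesis by simp
  qed simp
  qed (rule assms(2))
  finally show ?thesis by (simp add: mult_ac)
qed

context
  fixes e :: "nat \<Rightarrow> 'd::cstar_algebra" and \<epsilon> :: "nat \<Rightarrow> real"
  assumes tight: "tight_sequence e \<epsilon>"
begin

lemma tightD:
  shows "star (e k) = e k" "unit_contraction (e k)" "j < k \<Longrightarrow> norm (e j - e k * e j) \<le> \<epsilon> k" "\<epsilon> k > 0"
    "max_norm_tolerance TYPE('d) ((real k + 1)\<^sup>2) ((1/2)^k) ((real k + 1)\<^sup>2 * \<epsilon> k)"
    "(2 * real k + 6) * \<epsilon> k \<le> (1/2)^k"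
  using tight unfolding tight_sequence_def by blast+

lemma tight_le_geometric: "\<epsilon> k \<le> (1/2)^k"
proof -
  have "1 * \<epsilon> k \<le> (2 * real k + 6) * \<epsilon> k" using tightD(4)[of k] by (intro mult_right_mono) auto
  thus ?thesis using tightD(6)[of k] by simp
qed

lemma tight_right: "j < k \<Longrightarrow> norm (e j - e j * e k) \<le> \<epsilon> k"
  using tightD(3)[of j k] norm_star[of "e j - e j * e k"]
  by (simp add: star_diff star_mult tightD(1) del: norm_star)

lemma tight_norm: "norm (e k) \<le> 2" by (rule norm_unit_contraction[OF tightD(2)])

text \<open>
  By \<open>splice_eq_from_start\<close> all terms but the first are differences of elements \<open>(1 - e\<^sub>k) v\<^sub>j\<close>, and the
  tolerances are summable.
\<close>

lemma norm_splice_killed: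
  assumes "K \<le> M" "\<And>k. k < K \<Longrightarrow> v k = v (Suc k)"
    and "\<And>k j. K \<le> k \<Longrightarrow> k < M \<Longrightarrow> K \<le> j \<Longrightarrow> j \<le> M \<Longrightarrow> norm (v j - e k * v j) \<le> \<epsilon> k"
  shows "norm (splice_along e M v) \<le> norm (v K) + 4 * (1/2)^K"
proof -
  have "norm ((v k - e k * v k) - (v (Suc k) - e k * v (Suc k))) \<le> 2 * (1/2)^k" if "K \<le> k" "k < M" for k
  proof -
    have "norm ((v k - e k * v k) - (v (Suc k) - e k * v (Suc k))) \<le> \<epsilon> k + \<epsilon> k"
      using that by (intro norm_diff_le assms(3)) auto
    thus ?thesis using tight_le_geometric[of k] by linarith
  qed
  hence "norm (\<Sum>k=K..<M. (v k - e k * v k) - (v (Suc k) - e k * v (Suc k))) \<le> 2 * 2 * (1/2)^K"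
    by (intro norm_sum_le_geometric) auto
  hence "norm (v K - (\<Sum>k=K..<M. (v k - e k * v k) - (v (Suc k) - e k * v (Suc k))))
      \<le> norm (v K) + 2 * 2 * (1/2)^K"
    by (rule norm_diff_le[OF order.refl])
  also have "v K - (\<Sum>k=K..<M. (v k - e k * v k) - (v (Suc k) - e k * v (Suc k))) = splice_along e M v"
    by (rule splice_eq_from_start[of K M v e, OF assms(1,2), symmetric])
  finally show ?thesis by simp
qed

lemma norm_splice_star:
  assumes const: "\<And>k. k < K \<Longrightarrow> v k = v (Suc k)"
    and comm: "\<And>k j. K \<le> k \<Longrightarrow> k < M \<Longrightarrow> K \<le> j \<Longrightarrow> j \<le> M \<Longrightarrow> norm (e k * v j - v j * e k) \<le> \<epsilon> k"
  shows "norm (splice_along e M (\<lambda>k. star (v k)) - star (splice_along e M v)) \<le> 4 * (1/2)^K"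
proof -
  define D where "D k = v k - v (Suc k)" for k
  have "splice_along e M (\<lambda>k. star (v k)) - star (splice_along e M v) = (\<Sum>k<M. e k * star (D k) - star (D k) * e k)"
    by (simp add: splice_along_def star_add star_sum star_mult star_diff tightD(1) D_def sum_subtractf)
  also have "\<dots> = (\<Sum>k=K..<M. e k * star (D k) - star (D k) * e k)"
    using const by (intro sum.mono_neutral_right) (auto simp: D_def)
  also have "norm \<dots> \<le> 2 * 2 * (1/2)^K"
  proof (rule norm_sum_le_geometric)
    fix k assume k: "K \<le> k" "k < M"
    have "norm (e k * star (D k) - star (D k) * e k) = norm (star (e k * star (D k) - star (D k) * e k))"
      by (rule norm_star[symmetric])
    also have "star (e k * star (D k) - star (D k) * e k)
        = (e k * v (Suc k) - v (Suc k) * e k) - (e k * v k - v k * e k)"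
      by (simp add: star_diff star_add star_mult star_star tightD(1) D_def algebra_simps)
    also have "norm \<dots> \<le> \<epsilon> k + \<epsilon> k" using k by (intro norm_diff_le comm) auto
    finally show "norm (e k * star (D k) - star (D k) * e k) \<le> 2 * (1/2)^k"
      using tight_le_geometric[of k] by linarith
  qed simp
  finally show ?thesis by simp
qed

lemma norm_commutator_mult_le:
  assumes "norm (g * x - x * g) \<le> c" "norm (g * y - y * (g::'d)) \<le> d" "norm x \<le> r" "norm y \<le> s"
  shows "norm (g * (x * y) - x * y * g) \<le> c * s + r * d"
proof -
  have "g * (x * y) - x * y * g = (g * x - x * g) * y + x * (g * y - y * g)" by (simp add: algebra_simps)
  also have "norm \<dots> \<le> c * s + r * d"
    by (rule norm_triangle_le, rule add_mono; rule norm_mult_le; fact assms)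
  finally show ?thesis .
qed

text \<open>
  The layers \<open>g\<^sub>k = e\<^sub>k - e\<^sub>k\<^sup>2\<close> are almost orthogonal and almost central, so that a sum of
  arbitrarily many terms \<open>g\<^sub>k D\<^sub>k D'\<^sub>k\<close> is about as small as the largest term.
\<close>

lemma norm_layer_sum:
  fixes D D' :: "nat \<Rightarrow> 'd"
  \<comment> \<open>the constant comes from \<open>32 R\<^sup>4 + 640 R\<^sup>3\<close> in the bound for products of two terms\<close>
  assumes R: "R \<ge> 1" and K: "672 * R^4 \<le> real K + 1"
    and bound: "\<And>k. K \<le> k \<Longrightarrow> k < M \<Longrightarrow> norm (D k) \<le> 2 * R \<and> norm (D' k) \<le> 2 * R"
    and comm: "\<And>k j. K \<le> k \<Longrightarrow> k < M \<Longrightarrow> K \<le> j \<Longrightarrow> j < M \<Longrightarrow>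
      norm (e k * D j - D j * e k) \<le> 2 * \<epsilon> k \<and> norm (e k * D' j - D' j * e k) \<le> 2 * \<epsilon> k"
    and small: "\<And>k. K \<le> k \<Longrightarrow> k < M \<Longrightarrow> norm ((e k - e k * e k) * (D k * D' k)) \<le> \<rho>" and \<rho>: "\<rho> \<ge> 0"
  shows "norm (\<Sum>k=K..<M. (e k - e k * e k) * (D k * D' k)) \<le> \<rho> + 2 * (1/2)^K"
proof -
  define g where "g k = e k - e k * e k" for k
  define x where "x k = D k * D' k" for k
  define w where "w k = g k * x k" for k
  have g_star: "star (g k) = g k" for k by (simp add: g_def star_diff star_mult tightD)
  have g2: "norm (g k) \<le> 2" for k
    unfolding g_def using unit_contractionD[OF tightD(2)[of k], of "e k"] tight_norm[of k] by linarith
  have gg: "norm (g j * g k) \<le> 2 * \<epsilon> k" if "j < k" for j k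
  proof -
    define u where "u = (e j - e j * e k) - (e j - e j * e k) * e k"
    have "norm u \<le> norm (e j - e j * e k)" unfolding u_def by (rule unit_contraction_right[OF tightD(2)])
    hence u: "norm u \<le> \<epsilon> k" using tight_right[OF that] by linarith
    define u' where "u' = e j * g k"
    have u': "u' = (e j - (e j - e j * e k)) - (e j - (e j - e j * e k)) * e k"
      by (simp add: u'_def g_def algebra_simps)
    have "u' = (e j - e j * e k) - u" by (simp add: u' u_def algebra_simps)
    hence "norm u' \<le> \<epsilon> k + \<epsilon> k" using u tight_right[OF that] by (simp only:) (intro norm_diff_le)
    moreover have "g j * g k = u' - e j * u'" by (simp add: g_def u'_def algebra_simps)
    hence "norm (g j * g k) \<le> norm u'" using unit_contractionD[OF tightD(2)[of j], of u'] by simp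
    ultimately show ?thesis by linarith
  qed
  have g_comm: "norm (g k * z - z * g k) \<le> 10 * \<epsilon> k" if "norm (e k * z - z * e k) \<le> 2 * \<epsilon> k" for k z
  proof -
    have "g k * z - z * g k = (e k * z - z * e k) - (e k * (e k * z - z * e k) + (e k * z - z * e k) * e k)"
      by (simp add: g_def algebra_simps)
    also have "norm \<dots> \<le> 2 * \<epsilon> k + (2 * (2 * \<epsilon> k) + 2 * \<epsilon> k * 2)"
      using that tight_norm[of k] by (intro norm_diff_le norm_triangle_le add_mono norm_mult_le)
    finally show ?thesis by simp
  qed
  have g_comm_star: "norm (g k * star z - star z * g k) \<le> c" if "norm (g k * z - z * g k) \<le> c" for k z c
  proof -
    have "norm (g k * star z - star z * g k) = norm (star (z * g k - g k * z))"
      by (simp only: star_diff star_mult g_star)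
    thus ?thesis using that by (simp add: norm_minus_commute)
  qed
  have x: "norm (x k) \<le> 4 * R\<^sup>2" if "K \<le> k" "k < M" for k
    using norm_mult_le[of "D k" "2*R" "D' k" "2*R"] bound[OF that] by (simp add: x_def power2_eq_square)
  have xg: "norm (g k * x j - x j * g k) \<le> 40 * R * \<epsilon> k" if "K \<le> k" "k < M" "K \<le> j" "j < M" for j k
  proof -
    have "norm (g k * (D j * D' j) - D j * D' j * g k) \<le> 10 * \<epsilon> k * (2 * R) + 2 * R * (10 * \<epsilon> k)"
      using bound[OF that(3,4)] comm[OF that] by (intro norm_commutator_mult_le g_comm) auto
    thus ?thesis by (simp add: x_def)
  qed
  have w: "norm (w k) \<le> 8 * R\<^sup>2" if "K \<le> k" "k < M" for k
    using norm_mult_le[OF g2 x[OF that]] by (simp add: w_def)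
  have R4: "R\<^sup>2 \<le> R^4" "R^3 \<le> R^4" using R by (auto intro: power_increasing)
  have 16: "4 * R\<^sup>2 * (4 * R\<^sup>2) = 16 * R^4" by (simp flip: power_add)
  have ww1: "norm (star (w j) * w k) \<le> 672 * R^4 * \<epsilon> k" if "K \<le> j" "j < k" "k < M" for j k
  proof -
    have "star (w j) * w k = star (x j) * (g j * g k) * x k"
      by (simp add: w_def star_mult g_star mult.assoc)
    also have "norm \<dots> \<le> 4 * R\<^sup>2 * (2 * \<epsilon> k) * (4 * R\<^sup>2)"
      using that x[of j] x[of k] by (intro norm_mult_le gg) auto
    also have "\<dots> = 32 * (R^4 * \<epsilon> k)" using 16 by (simp add: mult_ac)
    also have "\<dots> \<le> 672 * (R^4 * \<epsilon> k)" using tightD(4)[of k] R by (intro mult_right_mono) auto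
    finally show ?thesis by (simp add: mult_ac)
  qed
  have ww2: "norm (w j * star (w k)) \<le> 672 * R^4 * \<epsilon> k" if "K \<le> j" "j < k" "k < M" for j k
  proof -
    define z where "z = x j * star (x k)"
    have "norm (g k * z - z * g k) \<le> 40 * R * \<epsilon> k * (4 * R\<^sup>2) + 4 * R\<^sup>2 * (40 * R * \<epsilon> k)"
      unfolding z_def using that x[of j] x[of k]
      by (intro norm_commutator_mult_le g_comm_star xg) auto
    also have "\<dots> = 320 * (R^3 * \<epsilon> k)" by (simp add: power3_eq_cube power2_eq_square mult_ac)
    finally have zg: "norm (g k * z - z * g k) \<le> 320 * (R^3 * \<epsilon> k)" .
    have "w j * star (w k) = (g j * g k) * z - g j * (g k * z - z * g k)"
      by (simp add: w_def star_mult g_star z_def algebra_simps)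
    also have "norm \<dots> \<le> (2 * \<epsilon> k) * (4 * R\<^sup>2 * (4 * R\<^sup>2)) + 2 * (320 * (R^3 * \<epsilon> k))"
    proof (rule norm_diff_le[OF norm_mult_le[OF gg] norm_mult_le[OF g2 zg]])
      show "norm z \<le> 4 * R\<^sup>2 * (4 * R\<^sup>2)"
        unfolding z_def using that x[of j] x[of k] by (intro norm_mult_le) auto
    qed (use that in auto)
    also have "\<dots> = 32 * (R^4 * \<epsilon> k) + 640 * (R^3 * \<epsilon> k)" unfolding 16 by simp
    finally have "norm (w j * star (w k)) \<le> 32 * (R^4 * \<epsilon> k) + 640 * (R^3 * \<epsilon> k)" .
    moreover have "R^3 * \<epsilon> k \<le> R^4 * \<epsilon> k" using R4 tightD(4)[of k] by (intro mult_right_mono) auto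
    ultimately show ?thesis by simp
  qed
  have eps: "(\<Sum>j<i. 672 * R^4 * \<epsilon> (K + i)) \<le> (real (K + i) + 1)\<^sup>2 * \<epsilon> (K + i)" for i
  proof -
    have "real i * (672 * R^4) \<le> (real (K + i) + 1) * (real (K + i) + 1)"
      using K R by (intro mult_mono) auto
    hence "(real i * (672 * R^4)) * \<epsilon> (K + i) \<le> (real (K + i) + 1)\<^sup>2 * \<epsilon> (K + i)"
      using tightD(4)[of "K + i"] by (intro mult_right_mono) (auto simp: power2_eq_square)
    thus ?thesis by simp
  qed
  have R8: "8 * R\<^sup>2 \<le> real (K + i) + 1" for i using K R4 by simp
  have sq: "real i * (8 * R\<^sup>2) \<le> (real (K + i) + 1)\<^sup>2" for i
    unfolding power2_eq_square[of "real (K + i) + 1"] using R8[of i] R by (intro mult_mono) auto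
  have "norm (\<Sum>i<M-K. w (K + i)) \<le> \<rho> + (\<Sum>i<M-K. (1/2)^(K+i))"
  proof (rule norm_sum_almost_orthogonal[where R = "\<lambda>i. (real (K + i) + 1)\<^sup>2"
        and \<delta> = "\<lambda>i. (real (K + i) + 1)\<^sup>2 * \<epsilon> (K + i)"])
    fix i assume i: "i < M - K"
    show "max_norm_tolerance TYPE('d) ((real (K + i) + 1)\<^sup>2) ((1/2)^(K+i)) ((real (K + i) + 1)\<^sup>2 * \<epsilon> (K + i))"
      by (rule tightD)
    have "norm (\<Sum>j<i. w (K + j)) \<le> (\<Sum>j<i. 8 * R\<^sup>2)" using i by (intro sum_norm_le w) auto
    also have "\<dots> \<le> (real (K + i) + 1)\<^sup>2" using sq[of i] by simp
    finally show "norm (\<Sum>j<i. w (K + j)) \<le> (real (K + i) + 1)\<^sup>2" .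
    have "norm (w (K + i)) \<le> 8 * R\<^sup>2" using i by (intro w) auto
    also have "\<dots> \<le> 1 * (real (K + i) + 1)" using R8[of i] by simp
    also have "\<dots> \<le> (real (K + i) + 1)\<^sup>2"
      unfolding power2_eq_square[of "real (K + i) + 1"] by (intro mult_right_mono) auto
    finally show "norm (w (K + i)) \<le> (real (K + i) + 1)\<^sup>2" .
    have "norm (star (\<Sum>j<i. w (K + j)) * w (K + i)) = norm (\<Sum>j<i. star (w (K + j)) * w (K + i))"
      by (simp add: star_sum sum_distrib_right)
    also have "\<dots> \<le> (\<Sum>j<i. 672 * R^4 * \<epsilon> (K + i))" using i by (intro sum_norm_le ww1) auto
    finally show "norm (star (\<Sum>j<i. w (K + j)) * w (K + i)) \<le> (real (K + i) + 1)\<^sup>2 * \<epsilon> (K + i)"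
      using eps[of i] by linarith
    have "norm ((\<Sum>j<i. w (K + j)) * star (w (K + i))) = norm (\<Sum>j<i. w (K + j) * star (w (K + i)))"
      by (simp add: sum_distrib_right)
    also have "\<dots> \<le> (\<Sum>j<i. 672 * R^4 * \<epsilon> (K + i))" using i by (intro sum_norm_le ww2) auto
    finally show "norm ((\<Sum>j<i. w (K + j)) * star (w (K + i))) \<le> (real (K + i) + 1)\<^sup>2 * \<epsilon> (K + i)"
      using eps[of i] by linarith
    show "norm (w (K + i)) \<le> \<rho>" using small[of "K + i"] i by (simp add: w_def x_def g_def)
  qed (use \<rho> in auto)
  also have "(\<Sum>i<M-K. (1/2)^(K+i)) \<le> 2 * (1/2::real)^K"
  proof -
    have "(\<Sum>i<M-K. (1/2::real)^i) \<le> 2" using norm_sum_le_geometric[of 0 "M-K" "\<lambda>k. (1/2::real)^k" 1]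
      by (simp add: atLeast0LessThan)
    hence "(1/2::real)^K * (\<Sum>i<M-K. (1/2)^i) \<le> (1/2)^K * 2" by (intro mult_left_mono) auto
    thus ?thesis by (simp add: power_add sum_distrib_left)
  qed
  also have "(\<Sum>i<M-K. w (K + i)) = (\<Sum>k=K..<M. w k)"
    using sum.shift_bounds_nat_ivl[of w 0 K "M - K"]
    by (cases "K \<le> M") (auto simp: atLeast0LessThan add.commute)
  finally show ?thesis by (simp add: w_def x_def g_def)
qed

text \<open>
  Replacing \<open>e\<^sub>j D\<^sub>j e\<^sub>k D'\<^sub>k\<close> by \<open>e\<^bsub>min j k\<^esub> D\<^sub>j D'\<^sub>k\<close> costs a commutator and the defect of
  \<open>e\<^sub>k\<close> as a unit for \<open>e\<^sub>j\<close>, except that on the diagonal the layer \<open>e\<^sub>k - e\<^sub>k\<^sup>2\<close> remains.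
\<close>

lemma norm_splice_mult:
  assumes R: "R \<ge> 1" and K: "672 * R^4 \<le> real K + 1" "K \<le> M" "M \<le> 2 * K + 6"
    and const: "\<And>k. k < K \<Longrightarrow> v k = v (Suc k)" "\<And>k. k < K \<Longrightarrow> w k = w (Suc k)"
    and bound: "\<And>k. K \<le> k \<Longrightarrow> k \<le> M \<Longrightarrow> norm (v k) \<le> R" "\<And>k. K \<le> k \<Longrightarrow> k \<le> M \<Longrightarrow> norm (w k) \<le> R"
    and comm: "\<And>k j. K \<le> k \<Longrightarrow> k < M \<Longrightarrow> K \<le> j \<Longrightarrow> j \<le> M \<Longrightarrow> norm (e k * v j - v j * e k) \<le> \<epsilon> k"
      "\<And>k j. K \<le> k \<Longrightarrow> k < M \<Longrightarrow> K \<le> j \<Longrightarrow> j \<le> M \<Longrightarrow> norm (e k * w j - w j * e k) \<le> \<epsilon> k"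
    and small: "\<And>k. K \<le> k \<Longrightarrow> k < M \<Longrightarrow>
      norm ((e k - e k * e k) * ((v k - v (Suc k)) * (w k - w (Suc k)))) \<le> \<rho>" and \<rho>: "\<rho> \<ge> 0"
  shows "norm (splice_along e M (\<lambda>k. v k * w k) - splice_along e M v * splice_along e M w) \<le> \<rho> + (2 + 40 * R\<^sup>2) * (1/2)^K"
proof -
  define D where "D k = v k - v (Suc k)" for k
  define D' where "D' k = w k - w (Suc k)" for k
  have D0: "D k = 0" "D' k = 0" if "k < K" for k using const that by (auto simp: D_def D'_def)
  have D: "norm (D k) \<le> 2 * R" "norm (D' k) \<le> 2 * R" if "K \<le> k" "k < M" for k
    using that norm_diff_le[OF bound(1)[of k] bound(1)[of "Suc k"]]
      norm_diff_le[OF bound(2)[of k] bound(2)[of "Suc k"]] by (auto simp: D_def D'_def)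
  have D_comm: "norm (e k * D j - D j * e k) \<le> 2 * \<epsilon> k" "norm (e k * D' j - D' j * e k) \<le> 2 * \<epsilon> k"
    if "K \<le> k" "k < M" "K \<le> j" "j < M" for j k
  proof -
    have *: "e k * (a - b) - (a - b) * e k = (e k * a - a * e k) - (e k * b - b * e k)" for a b
      by (simp add: algebra_simps)
    show "norm (e k * D j - D j * e k) \<le> 2 * \<epsilon> k" "norm (e k * D' j - D' j * e k) \<le> 2 * \<epsilon> k"
      unfolding D_def D'_def *
      using norm_diff_le[OF comm(1)[of k j] comm(1)[of k "Suc j"]]
        norm_diff_le[OF comm(2)[of k j] comm(2)[of k "Suc j"]] that by simp_all
  qed
  define E1 where "E1 = (\<Sum>k=K..<M. (v M * e k - e k * v M) * D' k)"
  define E2 where "E2 = (\<Sum>k=K..<M. \<Sum>j=K..<M. e j * (D j * e k - e k * D j) * D' k)"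
  define E3 where "E3 = (\<Sum>k=K..<M. \<Sum>j\<in>{K..<M}-{k}. (e j * e k - e (min j k)) * D j * D' k)"
  define L where "L = (\<Sum>k=K..<M. (e k - e k * e k) * (D k * D' k))"
  have prod_sum: "(a + sum X A) * (b + sum Y A)
      = a * b + (\<Sum>k\<in>A. X k * b) + (\<Sum>k\<in>A. a * Y k) + (\<Sum>j\<in>A. \<Sum>k\<in>A. X j * Y k)"
    for a b :: 'd and X Y :: "nat \<Rightarrow> 'd" and A
    by (simp add: algebra_simps flip: sum_distrib_left sum_distrib_right)
  have expand: "splice_along e M v * splice_along e M w = v M * w M + (\<Sum>k<M. e k * D k * w M)
      + (\<Sum>k<M. v M * e k * D' k) + (\<Sum>j<M. \<Sum>k<M. e j * D j * (e k * D' k))"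
    unfolding splice_along_def D_def[symmetric] D'_def[symmetric]
    unfolding prod_sum by (simp add: mult.assoc)
  have E1: "(\<Sum>k<M. v M * e k * D' k) - (\<Sum>k<M. e k * v M * D' k) = E1"
  proof -
    have "(\<Sum>k<M. v M * e k * D' k) - (\<Sum>k<M. e k * v M * D' k) = (\<Sum>k<M. (v M * e k - e k * v M) * D' k)"
      by (simp add: left_diff_distrib sum_subtractf)
    thus ?thesis unfolding E1_def using D0 by (subst (asm) sum_mult_from[where K = K]) auto
  qed
  have restrict: "(\<Sum>j<M. \<Sum>k<M. F j k) = (\<Sum>k=K..<M. \<Sum>j=K..<M. F j k)"
    if "\<And>j k. j < K \<or> k < K \<Longrightarrow> F j k = 0" for F :: "nat \<Rightarrow> nat \<Rightarrow> 'd"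
  proof -
    have "(\<Sum>j<M. \<Sum>k<M. F j k) = (\<Sum>k<M. \<Sum>j<M. F j k)" by (rule sum.swap)
    also have "\<dots> = (\<Sum>k<M. \<Sum>j=K..<M. F j k)"
      using that by (intro sum.cong refl sum.mono_neutral_right) auto
    also have "\<dots> = (\<Sum>k=K..<M. \<Sum>j=K..<M. F j k)"
      using that by (intro sum.mono_neutral_right) (auto intro!: sum.neutral)
    finally show ?thesis .
  qed
  have E23: "(\<Sum>j<M. \<Sum>k<M. e j * D j * (e k * D' k)) - (\<Sum>j<M. \<Sum>k<M. e (min j k) * D j * D' k) = E2 + E3 - L"
  proof -
    have "(\<Sum>j<M. \<Sum>k<M. e j * D j * (e k * D' k)) - (\<Sum>j<M. \<Sum>k<M. e (min j k) * D j * D' k)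
        = (\<Sum>j<M. \<Sum>k<M. e j * (D j * e k - e k * D j) * D' k + (e j * e k - e (min j k)) * D j * D' k)"
      by (simp add: algebra_simps flip: sum_subtractf)
    also have "\<dots> = (\<Sum>k=K..<M. \<Sum>j=K..<M. e j * (D j * e k - e k * D j) * D' k + (e j * e k - e (min j k)) * D j * D' k)"
      by (rule restrict) (auto simp: D0)
    also have "\<dots> = E2 + (\<Sum>k=K..<M. \<Sum>j=K..<M. (e j * e k - e (min j k)) * D j * D' k)"
      by (simp add: E2_def sum.distrib)
    also have "(\<Sum>k=K..<M. \<Sum>j=K..<M. (e j * e k - e (min j k)) * D j * D' k)
        = (\<Sum>k=K..<M. (e k * e k - e k) * D k * D' k + (\<Sum>j\<in>{K..<M}-{k}. (e j * e k - e (min j k)) * D j * D' k))"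
      by (intro sum.cong refl, subst sum.remove) auto
    also have "\<dots> = E3 - L"
      by (simp add: E3_def L_def sum.distrib algebra_simps sum_subtractf)
    finally show ?thesis by simp
  qed
  have main: "splice_along e M (\<lambda>k. v k * w k) - splice_along e M v * splice_along e M w = L - (E1 + E2 + E3)"
    unfolding expand splice_multiplicative_identity[symmetric] D_def[symmetric] D'_def[symmetric]
    using E1 E23 by (simp add: algebra_simps)
  have card: "real (card {K..<M}) * \<epsilon> k \<le> (1/2)^k" if "K \<le> k" for k
  proof -
    have "real (card {K..<M}) * \<epsilon> k \<le> (2 * real k + 6) * \<epsilon> k"
      using K that tightD(4)[of k] by (intro mult_right_mono) auto
    thus ?thesis using tightD(6)[of k] by linarith
  qed
  have R2: "R \<le> R\<^sup>2" using R by (simp add: power2_eq_square)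
  have nE1: "norm E1 \<le> 2 * (2 * R) * (1/2)^K"
    unfolding E1_def
  proof (rule norm_sum_le_geometric)
    fix k assume k: "K \<le> k" "k < M"
    have "norm ((v M * e k - e k * v M) * D' k) \<le> \<epsilon> k * (2 * R)"
      using comm(1)[of k M] k K D by (intro norm_mult_le) (auto simp: norm_minus_commute)
    also have "\<dots> \<le> (1/2)^k * (2 * R)" using R tight_le_geometric by (intro mult_right_mono) auto
    finally show "norm ((v M * e k - e k * v M) * D' k) \<le> 2 * R * (1/2)^k" by (simp add: mult_ac)
  qed (use R in simp)
  have nE2: "norm E2 \<le> 2 * (8 * R) * (1/2)^K"
    unfolding E2_def
  proof (rule norm_sum_le_geometric)
    fix k assume k: "K \<le> k" "k < M"
    have "norm (\<Sum>j=K..<M. e j * (D j * e k - e k * D j) * D' k) \<le> (\<Sum>j=K..<M. 2 * (2 * \<epsilon> k) * (2 * R))"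
      using D_comm(1)[OF k] D(2)[OF k] tight_norm
      by (intro sum_norm_le norm_mult_le) (auto simp: norm_minus_commute)
    also have "\<dots> = 8 * R * (real (card {K..<M}) * \<epsilon> k)" by simp
    also have "\<dots> \<le> 8 * R * (1/2)^k" using card[OF k(1)] R by (intro mult_left_mono) auto
    finally show "norm (\<Sum>j=K..<M. e j * (D j * e k - e k * D j) * D' k) \<le> 8 * R * (1/2)^k" .
  qed (use R in simp)
  have nE3: "norm E3 \<le> 16 * R\<^sup>2 * (1/2)^K"
  proof -
    have "norm E3 \<le> (\<Sum>k=K..<M. \<Sum>j\<in>{K..<M}-{k}. (\<epsilon> k + \<epsilon> j) * (2 * R) * (2 * R))"
      unfolding E3_def
    proof (intro sum_norm_le norm_mult_le D)
      fix k j assume kj: "k \<in> {K..<M}" "j \<in> {K..<M} - {k}"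
      consider "j < k" | "k < j" using kj by fastforce
      thus "norm (e j * e k - e (min j k)) \<le> \<epsilon> k + \<epsilon> j"
      proof cases
        case 1 thus ?thesis
          using tight_right[OF 1] tightD(4)[of j] by (simp add: norm_minus_commute min_absorb1)
      next
        case 2 thus ?thesis
          using tightD(3)[OF 2] tightD(4)[of k] by (simp add: norm_minus_commute min_absorb2)
      qed
    qed auto
    also have "\<dots> \<le> (\<Sum>k=K..<M. \<Sum>j=K..<M. (\<epsilon> k + \<epsilon> j) * (2 * R) * (2 * R))"
      using tightD(4) R by (intro sum_mono sum_mono2) (auto intro: add_nonneg_nonneg less_imp_le)
    also have "\<dots> = (\<Sum>k=K..<M. \<Sum>j=K..<M. \<epsilon> k + \<epsilon> j) * (2 * R) * (2 * R)"
      by (simp only: sum_distrib_right)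
    also have "(\<Sum>k=K..<M. \<Sum>j=K..<M. \<epsilon> k + \<epsilon> j) = 2 * (real (card {K..<M}) * (\<Sum>k=K..<M. \<epsilon> k))"
      by (simp only: sum.distrib sum_constant sum_distrib_left[symmetric])
    finally have E3: "norm E3 \<le> 2 * (real (card {K..<M}) * (\<Sum>k=K..<M. \<epsilon> k)) * (2 * R) * (2 * R)" .
    have "real (card {K..<M}) * (\<Sum>k=K..<M. \<epsilon> k) = norm (\<Sum>k=K..<M. real (card {K..<M}) * \<epsilon> k)"
      using tightD(4) by (subst sum_distrib_left[symmetric]) (simp add: sum_nonneg less_imp_le K(2))
    also have "\<dots> \<le> 2 * 1 * (1/2)^K"
      using card tightD(4) by (intro norm_sum_le_geometric) (auto simp: abs_mult less_imp_le)
    finally have "2 * (real (card {K..<M}) * (\<Sum>k=K..<M. \<epsilon> k)) * (2 * R) * (2 * R)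
        \<le> 2 * (2 * 1 * (1/2)^K) * (2 * R) * (2 * R)"
      using R by (intro mult_right_mono) auto
    also have "\<dots> = 16 * R\<^sup>2 * (1/2)^K" by (simp add: power2_eq_square)
    finally show ?thesis using E3 by linarith
  qed
  have nL: "norm L \<le> \<rho> + 2 * (1/2)^K"
    unfolding L_def
    by (rule norm_layer_sum[OF R K(1)]) (use D D_comm small \<rho> in \<open>auto simp: D_def D'_def\<close>)
  have "norm (L - (E1 + E2 + E3)) \<le> norm L + (norm E1 + norm E2 + norm E3)"
    by (intro norm_diff_le norm_triangle_le add_mono norm_triangle_ineq order.refl)
  also have "\<dots> \<le> \<rho> + 2 * (1/2)^K + (2 * (2 * R) * (1/2)^K + 2 * (8 * R) * (1/2)^K + 16 * R\<^sup>2 * (1/2)^K)"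
    using nL nE1 nE2 nE3 by linarith
  also have "\<dots> = \<rho> + (2 + 20 * R + 16 * R\<^sup>2) * (1/2)^K" by (simp add: algebra_simps)
  also have "\<dots> \<le> \<rho> + (2 + 40 * R\<^sup>2) * (1/2)^K"
    using R2 R by (intro add_left_mono mult_right_mono) auto
  finally show ?thesis unfolding main .
qed

end

section \<open>Approximate units adapted to countably many families\<close>

lemma max_norm_tolerance_mono:
  "max_norm_tolerance T R \<eta> \<delta> \<Longrightarrow> 0 < \<delta>' \<Longrightarrow> \<delta>' \<le> \<delta> \<Longrightarrow> max_norm_tolerance T R \<eta> \<delta>'"
  unfolding max_norm_tolerance_def by (meson order_trans)

lemma (in star_ideal) tight_sequence_for_arrays:
  fixes Z :: "(nat \<Rightarrow> 'p::topological_space \<Rightarrow> 'd) set" and \<Omega> :: "nat \<Rightarrow> 'p set"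
  assumes "countable Z" "\<And>k. compact (\<Omega> k)" "\<And>z j k. z \<in> Z \<Longrightarrow> continuous_on (\<Omega> k) (z j)"
  shows "\<exists>e \<epsilon>. tight_sequence e \<epsilon> \<and> (\<forall>k. e k \<in> I) \<and>
    (\<forall>z\<in>Z. \<exists>k0. \<forall>k\<ge>k0. \<forall>j\<le>2*k+6. \<forall>p\<in>\<Omega> k. norm (e k * z j p - z j p * e k) \<le> \<epsilon> k \<and>
      (z j p \<in> I \<longrightarrow> norm (z j p - e k * z j p) \<le> \<epsilon> k))"
proof -
  have "\<exists>\<delta>. max_norm_tolerance TYPE('d) ((real k + 1)\<^sup>2) ((1/2)^k) \<delta>" for k
    by (rule max_norm_tolerance_exists) (auto simp: add_nonneg_pos)
  then obtain \<delta> where \<delta>: "\<And>k. max_norm_tolerance TYPE('d) ((real k + 1)\<^sup>2) ((1/2)^k) (\<delta> k)" by metis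
  define \<epsilon> where "\<epsilon> k = min (\<delta> k) ((1/2)^k) / (2 * real k + 6)\<^sup>2" for k
  have \<delta>0: "\<delta> k > 0" for k using \<delta>[of k] by (simp add: max_norm_tolerance_def)
  have \<epsilon>0: "\<epsilon> k > 0" for k unfolding \<epsilon>_def using \<delta>0[of k] by (intro divide_pos_pos) auto
  have \<epsilon>_eq: "(2 * real k + 6)\<^sup>2 * \<epsilon> k = min (\<delta> k) ((1/2)^k)" for k by (simp add: \<epsilon>_def)
  have \<epsilon>1: "(real k + 1)\<^sup>2 * \<epsilon> k \<le> \<delta> k" for k
  proof -
    have "(real k + 1)\<^sup>2 * \<epsilon> k \<le> (2 * real k + 6)\<^sup>2 * \<epsilon> k"
      using \<epsilon>0[of k] by (intro mult_right_mono power_mono) auto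
    thus ?thesis unfolding \<epsilon>_eq by linarith
  qed
  have \<epsilon>2: "(2 * real k + 6) * \<epsilon> k \<le> (1/2)^k" for k
  proof -
    have "(2 * real k + 6) * \<epsilon> k \<le> (2 * real k + 6)\<^sup>2 * \<epsilon> k"
      using \<epsilon>0[of k] by (intro mult_right_mono self_le_power) auto
    thus ?thesis unfolding \<epsilon>_eq by linarith
  qed
  define Z' where "Z' = insert (\<lambda>_ _. 0) Z"
  define z where "z = from_nat_into Z'"
  have Z': "countable Z'" "Z' \<noteq> {}" using assms(1) by (auto simp: Z'_def)
  have z_cont: "continuous_on (\<Omega> k) (z i j)" for i j k
    using from_nat_into[OF Z'(2), of i] assms(3) unfolding z_def Z'_def by (auto simp: continuous_on_const)
  define G where "G k = (\<Union>i\<in>{..k}. \<Union>j\<in>{..2*k+6}. z i j ` \<Omega> k)" for k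
  have G: "compact (G k)" for k
    unfolding G_def by (intro compact_UN finite_atMost compact_continuous_image z_cont assms(2))
  obtain e where e: "\<And>k. e k \<in> I \<and> star (e k) = e k \<and> unit_contraction (e k) \<and>
      (\<forall>i\<in>I \<inter> G k. norm (i - e k * i) \<le> \<epsilon> k) \<and> (\<forall>x\<in>G k. norm (e k * x - x * e k) \<le> \<epsilon> k) \<and>
      (\<forall>j<k. norm (e j - e k * e j) \<le> \<epsilon> k)"
    using quasicentral_sequence[of "\<lambda>k. I \<inter> G k" G \<epsilon>] G \<epsilon>0
    by (metis closed_I closed_Int_compact Int_lower1)
  have "tight_sequence e \<epsilon>"
    unfolding tight_sequence_def using e \<epsilon>0 \<epsilon>2 \<delta> \<epsilon>1
    by (auto intro!: max_norm_tolerance_mono[OF \<delta>])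
  moreover have "\<exists>k0. \<forall>k\<ge>k0. \<forall>j\<le>2*k+6. \<forall>p\<in>\<Omega> k. norm (e k * x j p - x j p * e k) \<le> \<epsilon> k \<and>
      (x j p \<in> I \<longrightarrow> norm (x j p - e k * x j p) \<le> \<epsilon> k)" if "x \<in> Z" for x
  proof -
    obtain i where i: "z i = x"
      using from_nat_into_surj[OF Z'(1), of x] \<open>x \<in> Z\<close> unfolding z_def by (auto simp: Z'_def)
    have "x j p \<in> G k" if "k \<ge> i" "j \<le> 2*k+6" "p \<in> \<Omega> k" for k j p
      unfolding G_def i[symmetric] using that by blast
    thus ?thesis using e by (intro exI[of _ i]) blast
  qed
  ultimately show ?thesis using e by blast
qed

section \<open>Splicing a lift of one end of a homotopy\<close>

text \<open>
  The limit \<open>l \<rightarrow> \<infinity>\<close> in \<open>S\<close>, uniformly in the time \<open>t\<close> of the homotopy; pairs \<open>(l, t)\<close> as index turn a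
  family of paths into a family of elements.
\<close>

definition strip_at_top :: "real set \<Rightarrow> (real \<times> real) filter" where
  "strip_at_top S = inf (filtercomap fst at_top) (principal (S \<times> {0..1}))"

lemma eventually_strip_at_top:
  "eventually P (strip_at_top S) \<longleftrightarrow> (\<exists>L. \<forall>l\<in>S. \<forall>t\<in>{0..1}. l \<ge> L \<longrightarrow> P (l, t))"
proof
  assume "eventually P (strip_at_top S)"
  then obtain Q L where "\<And>l. l \<ge> L \<Longrightarrow> Q l" "\<And>p. Q (fst p) \<Longrightarrow> p \<in> S \<times> {0..1} \<longrightarrow> P p"
    unfolding strip_at_top_def eventually_inf_principal eventually_filtercomap eventually_at_top_linorder
    by blast
  thus "\<exists>L. \<forall>l\<in>S. \<forall>t\<in>{0..1}. l \<ge> L \<longrightarrow> P (l, t)" by (intro exI[of _ L]) auto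
next
  assume "\<exists>L. \<forall>l\<in>S. \<forall>t\<in>{0..1}. l \<ge> L \<longrightarrow> P (l, t)"
  then obtain L where L: "\<And>l t. l \<in> S \<Longrightarrow> t \<in> {0..1} \<Longrightarrow> l \<ge> L \<Longrightarrow> P (l, t)" by blast
  show "eventually P (strip_at_top S)"
    unfolding strip_at_top_def eventually_inf_principal eventually_filtercomap eventually_at_top_linorder
    by (rule exI[of _ "\<lambda>l. l \<ge> L"]) (use L in auto)
qed

lemma eventually_at_top_within:
  "eventually P (inf at_top (principal S)) \<longleftrightarrow> (\<exists>L::real. \<forall>l\<in>S. l \<ge> L \<longrightarrow> P l)"
  unfolding eventually_inf_principal eventually_at_top_linorder by blast

lemma tendsto_zero_strip:
  fixes f :: "real \<times> real \<Rightarrow> real"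
  assumes "\<And>\<eta>. \<eta> > 0 \<Longrightarrow> \<exists>L. \<forall>l\<in>S. \<forall>t\<in>{0..1}. l \<ge> L \<longrightarrow> \<bar>f (l, t)\<bar> < \<eta>"
  shows "(f \<longlongrightarrow> 0) (strip_at_top S)"
  unfolding tendsto_iff eventually_strip_at_top using assms by (simp add: dist_real_def)

text \<open>
  Both depend continuously on \<open>l\<close>, so that the construction does although \<open>k\<close> is discrete.  The weight reaches \<open>0\<close> before the position leaves \<open>0\<close>.
\<close>

definition blend_weight :: "real \<Rightarrow> nat \<Rightarrow> real" where
  "blend_weight l k = max 0 (min 1 (l + 2 - real k))"

definition homotopy_position :: "real \<Rightarrow> nat \<Rightarrow> real" where
  "homotopy_position l k = max 0 (min 1 ((real k - l - 3) / (l + 1)))"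

lemma blend_weight_simps:
  "0 \<le> blend_weight l k" "blend_weight l k \<le> 1" "real k \<le> l + 1 \<Longrightarrow> blend_weight l k = 1"
  "real k \<ge> l + 2 \<Longrightarrow> blend_weight l k = 0"
  by (auto simp: blend_weight_def)

lemma homotopy_position_simps:
  assumes "l \<ge> 0"
  shows "0 \<le> homotopy_position l k" "homotopy_position l k \<le> 1"
    "real k \<le> l + 3 \<Longrightarrow> homotopy_position l k = 0" "real k \<ge> 2 * l + 4 \<Longrightarrow> homotopy_position l k = 1"
    "\<bar>homotopy_position l k - homotopy_position l (Suc k)\<bar> \<le> 1 / (l + 1)"
proof -
  show "0 \<le> homotopy_position l k" "homotopy_position l k \<le> 1" by (auto simp: homotopy_position_def)
  show "homotopy_position l k = 0" if "real k \<le> l + 3"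
  proof -
    have "(real k - l - 3) / (l + 1) \<le> 0" using that assms by (intro divide_nonpos_nonneg) auto
    thus ?thesis by (simp add: homotopy_position_def)
  qed
  show "homotopy_position l k = 1" if "real k \<ge> 2 * l + 4"
  proof -
    have "(real k - l - 3) / (l + 1) \<ge> 1" using that assms by (simp add: le_divide_eq)
    thus ?thesis by (simp add: homotopy_position_def)
  qed
  have lip: "\<bar>max 0 (min 1 x) - max 0 (min 1 y)\<bar> \<le> \<bar>x - y\<bar>" for x y :: real by linarith
  have "(real k - l - 3) / (l + 1) - (real (Suc k) - l - 3) / (l + 1) = - (1 / (l + 1))"
    by (simp add: algebra_simps flip: diff_divide_distrib minus_divide_left)
  thus "\<bar>homotopy_position l k - homotopy_position l (Suc k)\<bar> \<le> 1 / (l + 1)"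
    unfolding homotopy_position_def
    using lip[of "(real k - l - 3) / (l + 1)" "(real (Suc k) - l - 3) / (l + 1)"] assms by simp
qed

text \<open>
  \<open>\<sigma> b\<close> is a path in \<open>D\<close> over the path of the homotopy at \<open>b\<close>, and \<open>h\<close> an asymptotic
  homomorphism over its starting point, with parameters in \<open>S\<close>; the half line and the natural
  numbers are the cases of interest.
\<close>

locale homotopy_lifting = star_ideal I for I :: "'d::cstar_algebra set" +
  fixes S :: "real set" and C :: "'b::cstar_algebra set" and h :: "real \<Rightarrow> 'b \<Rightarrow> 'd" and \<sigma> :: "'b \<Rightarrow> real \<Rightarrow> 'd"
  assumes closed_S: "closed S" and S_nonneg: "S \<subseteq> {0..}"
    and countable_C: "countable C" and cosine_C: "cosine_subalgebra C"
    and \<sigma>_cont: "continuous_on {0..1} (\<sigma> b)"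
    and \<sigma>_hom: "t \<in> {0..1} \<Longrightarrow> hom_mod (\<lambda>b. \<sigma> b t)"
    and h_cont: "continuous_on S (\<lambda>l. h l b)"
    and h_lift: "l \<in> S \<Longrightarrow> h l b - \<sigma> b 0 \<in> I"
    and h_asymp: "norm.asymptotic_on (inf at_top (principal S)) C h"
begin

text \<open>
  For fixed \<open>(l, t)\<close> the sequence stays at \<open>h\<^sub>l\<close> up to \<open>k \<approx> l\<close>, changes over to \<open>\<sigma>\<close> at time \<open>0\<close>
  inside one coset, and then moves to time \<open>t\<close> in steps of length at most \<open>1/(l+1)\<close>.
\<close>

definition stage :: "nat \<Rightarrow> 'b \<Rightarrow> real \<times> real \<Rightarrow> 'd" where
  "stage k b p = blend_weight (fst p) k *\<^sub>R h (fst p) b +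
     (1 - blend_weight (fst p) k) *\<^sub>R \<sigma> b (snd p * homotopy_position (fst p) k)"

lemma position_in: "p \<in> S \<times> {0..1} \<Longrightarrow> snd p * homotopy_position (fst p) k \<in> {0..1}"
  using homotopy_position_simps(1,2)[of "fst p" k] S_nonneg by (fastforce intro: mult_le_one)

lemma stage_cont: "continuous_on (S \<times> {0..1}) (stage k b)"
proof -
  have 1: "continuous_on (S \<times> {0..1}) (\<lambda>p. h (fst p) b)"
    by (rule continuous_on_compose2[OF h_cont]) (auto intro: continuous_intros)
  have 2: "continuous_on (S \<times> {0..1}) (\<lambda>p. \<sigma> b (snd p * homotopy_position (fst p) k))"
  proof (rule continuous_on_compose2[OF \<sigma>_cont])
    have "l + 1 \<noteq> 0" if "l \<in> S" for l using that S_nonneg by force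
    thus "continuous_on (S \<times> {0..1}) (\<lambda>p. snd p * homotopy_position (fst p) k)"
      unfolding homotopy_position_def by (intro continuous_intros) auto
  qed (use position_in in auto)
  show ?thesis
    unfolding stage_def blend_weight_def by (intro continuous_intros 1 2)
qed

lemma stage_lift:
  assumes p: "p \<in> S \<times> {0..1}"
  shows "stage k b p - \<sigma> b (snd p * homotopy_position (fst p) k) \<in> I"
proof (cases "blend_weight (fst p) k = 0")
  case False
  hence "real k < fst p + 2" using blend_weight_simps(4)[of "fst p" k] by linarith
  hence 0: "homotopy_position (fst p) k = 0"
    using S_nonneg p by (intro homotopy_position_simps) auto
  have "stage k b p - \<sigma> b (snd p * homotopy_position (fst p) k) = blend_weight (fst p) k *\<^sub>R (h (fst p) b - \<sigma> b 0)"
    by (simp add: stage_def 0 algebra_simps)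
  thus ?thesis using h_lift[of "fst p" b] p by (auto intro: scaleR_I)
qed (simp add: stage_def)

lemma stage_hom: "p \<in> S \<times> {0..1} \<Longrightarrow> hom_mod (\<lambda>b. stage k b p)"
  by (rule hom_mod_cong[OF \<sigma>_hom[OF position_in] stage_lift])

lemma stage_start: "real k \<le> fst p + 1 \<Longrightarrow> stage k b p = h (fst p) b"
  by (simp add: stage_def blend_weight_simps)

lemma stage_end:
  assumes "p \<in> S \<times> {0..1}" "real k \<ge> 2 * fst p + 4"
  shows "stage k b p = \<sigma> b (snd p)"
proof -
  have "fst p \<ge> 0" using assms S_nonneg by auto
  thus ?thesis using assms homotopy_position_simps(4)[of "fst p" k] blend_weight_simps(4)[of "fst p" k]
    by (simp add: stage_def)
qed

lemma stage_step:
  assumes "\<eta> > 0"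
  shows "\<exists>L. \<forall>p\<in>S \<times> {0..1}. fst p \<ge> L \<longrightarrow>
    (\<forall>k. stage k b p - stage (Suc k) b p \<in> I \<or> norm (stage k b p - stage (Suc k) b p) \<le> \<eta>)"
proof -
  have "uniformly_continuous_on {0..1} (\<sigma> b)"
    by (intro compact_uniformly_continuous \<sigma>_cont compact_Icc)
  then obtain \<delta> where \<delta>: "\<delta> > 0"
    "\<And>x y. x \<in> {0..1} \<Longrightarrow> y \<in> {0..1} \<Longrightarrow> \<bar>x - y\<bar> < \<delta> \<Longrightarrow> norm (\<sigma> b x - \<sigma> b y) < \<eta>"
    using assms unfolding uniformly_continuous_on_def dist_norm real_norm_def by metis
  have "stage k b p - stage (Suc k) b p \<in> I \<or> norm (stage k b p - stage (Suc k) b p) \<le> \<eta>"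
    if p: "p \<in> S \<times> {0..1}" and L: "fst p \<ge> 1 / \<delta>" for p k
  proof (cases "real k \<le> fst p + 2")
    case True
    have "fst p \<ge> 0" using p S_nonneg by auto
    hence "homotopy_position (fst p) k = 0" "homotopy_position (fst p) (Suc k) = 0"
      using True by (intro homotopy_position_simps; simp)+
    hence "stage k b p - \<sigma> b 0 \<in> I" "stage (Suc k) b p - \<sigma> b 0 \<in> I"
      using stage_lift[OF p, of k b] stage_lift[OF p, of "Suc k" b] by auto
    from diff_I[OF this] show ?thesis by simp
  next
    case False
    let ?x = "snd p * homotopy_position (fst p) k" and ?y = "snd p * homotopy_position (fst p) (Suc k)"
    have fst0: "fst p \<ge> 0" and snd: "0 \<le> snd p" "snd p \<le> 1" using p S_nonneg by auto
    have "\<bar>?x - ?y\<bar> = snd p * \<bar>homotopy_position (fst p) k - homotopy_position (fst p) (Suc k)\<bar>"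
      using snd by (simp add: abs_mult flip: right_diff_distrib)
    also have "\<dots> \<le> 1 * (1 / (fst p + 1))"
      using snd homotopy_position_simps(5)[OF fst0] by (intro mult_mono) auto
    also have "\<dots> < \<delta>" using L \<delta>(1) fst0 by (simp add: field_simps add_pos_nonneg)
    finally have "norm (\<sigma> b ?x - \<sigma> b ?y) < \<eta>" by (intro \<delta>(2) position_in p)
    thus ?thesis using False by (simp add: stage_def blend_weight_simps)
  qed
  thus ?thesis by blast
qed

lemma h_bounded:
  assumes "b \<in> C"
  shows "\<exists>R. \<forall>l\<in>S. norm (h l b) \<le> R"
proof -
  obtain L where L: "\<And>l. l \<in> S \<Longrightarrow> l \<ge> L \<Longrightarrow> norm (h l b) \<le> norm b + 1"
    using norm.asymptotic_on_bound[OF cosine_C h_asymp assms, of 1] by (auto simp: eventually_at_top_within)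
  have "bounded ((\<lambda>l. h l b) ` (S \<inter> {0..L}))"
    by (intro compact_imp_bounded compact_continuous_image continuous_on_subset[OF h_cont]
        closed_Int_compact closed_S compact_Icc) auto
  then obtain R where R: "\<And>l. l \<in> S \<Longrightarrow> l \<in> {0..L} \<Longrightarrow> norm (h l b) \<le> R"
    unfolding bounded_iff by blast
  have "norm (h l b) \<le> max R (norm b + 1)" if "l \<in> S" for l
    using L[OF that] R[OF that] that S_nonneg by (cases "l \<ge> L") force+
  thus ?thesis by blast
qed

lemma stage_bounded:
  assumes "b \<in> C"
  shows "\<exists>R\<ge>1. \<forall>p\<in>S \<times> {0..1}. \<forall>k. norm (stage k b p) \<le> R"
proof -
  obtain R1 where R1: "\<And>l. l \<in> S \<Longrightarrow> norm (h l b) \<le> R1" using h_bounded[OF assms] by blast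
  have "bounded (\<sigma> b ` {0..1})"
    by (intro compact_imp_bounded compact_continuous_image \<sigma>_cont compact_Icc)
  then obtain R2 where R2: "\<And>t. t \<in> {0..1} \<Longrightarrow> norm (\<sigma> b t) \<le> R2" unfolding bounded_iff by blast
  define R where "R = Max {1, R1, R2}"
  have R: "R \<ge> 1" "R1 \<le> R" "R2 \<le> R" by (auto simp: R_def)
  have "norm (stage k b p) \<le> R" if p: "p \<in> S \<times> {0..1}" for k p
  proof -
    define c where "c = blend_weight (fst p) k"
    have c: "0 \<le> c" "c \<le> 1" by (auto simp: c_def blend_weight_simps)
    have "norm (stage k b p) \<le> c * R + (1 - c) * R"
      unfolding stage_def c_def[symmetric]
    proof (rule norm_triangle_le, rule add_mono)
      have "norm (h (fst p) b) \<le> R" using R1[of "fst p"] R p by force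
      thus "norm (c *\<^sub>R h (fst p) b) \<le> c * R" using c by (simp add: mult_left_mono)
      have "norm (\<sigma> b (snd p * homotopy_position (fst p) k)) \<le> R"
        using R2[OF position_in[OF p]] R(3) by (rule order_trans)
      thus "norm ((1 - c) *\<^sub>R \<sigma> b (snd p * homotopy_position (fst p) k)) \<le> (1 - c) * R"
        using c by (simp add: mult_left_mono)
    qed
    thus ?thesis by (simp add: algebra_simps)
  qed
  thus ?thesis using R(1) by blast
qed

text \<open>The families whose values the approximate unit has to commute with, or to absorb.\<close>

definition add_defect where "add_defect a b k p = stage k (a + b) p - (stage k a p + stage k b p)"
definition scale_defect where "scale_defect c a k p = stage k (c *\<^sub>C a) p - c *\<^sub>C stage k a p"
definition mult_defect where "mult_defect a b k p = stage k (a * b) p - stage k a p * stage k b p"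
definition star_defect where "star_defect a k p = stage k (star a) p - star (stage k a p)"
definition step_diff where "step_diff a k p = stage k a p - stage (Suc k) a p"

definition relevant_arrays :: "(nat \<Rightarrow> real \<times> real \<Rightarrow> 'd) set" where
  "relevant_arrays = (\<lambda>(a, b). add_defect a b) ` (C \<times> C) \<union> (\<lambda>(c, a). scale_defect c a) ` (rational_scalars \<times> C)
    \<union> (\<lambda>(a, b). mult_defect a b) ` (C \<times> C) \<union> star_defect ` C \<union> step_diff ` C \<union> (\<lambda>a k. stage k a) ` C"

lemma countable_relevant_arrays: "countable relevant_arrays"
  unfolding relevant_arrays_def using countable_C countable_rational_scalars by auto

lemma relevant_arrays_cont: "z \<in> relevant_arrays \<Longrightarrow> continuous_on (S \<times> {0..1}) (z j)"
  unfolding relevant_arrays_def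
  by (auto simp: add_defect_def[abs_def] scale_defect_def[abs_def] mult_defect_def[abs_def]
      star_defect_def[abs_def] step_diff_def[abs_def] intro!: continuous_intros stage_cont)

text \<open>
  The parameter \<open>l\<close> uses the members of the approximate unit with index at least
  \<open>first_index l\<close>, so that those with index \<open>k\<close> have to serve only the parameters up to \<open>k\<close>.
\<close>

definition first_index :: "real \<Rightarrow> nat" where "first_index l = nat \<lceil>l\<rceil>"

lemma first_index: "l \<ge> 0 \<Longrightarrow> l \<le> real (first_index l)" "l \<ge> 0 \<Longrightarrow> real (first_index l) < l + 1"
  unfolding first_index_def by linarith+

lemma first_index_mono: "l \<ge> real k \<Longrightarrow> k \<le> first_index l"
  unfolding first_index_def by linarith

lemma half_power_small:
  assumes "\<eta> > 0"
  shows "\<exists>N. \<forall>k\<ge>N. c * (1/2::real)^k < \<eta>"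
proof -
  have "(\<lambda>k. c * (1/2::real)^k) \<longlonglongrightarrow> c * 0" by (intro tendsto_intros LIMSEQ_power_zero) auto
  hence "eventually (\<lambda>k. c * (1/2::real)^k < \<eta>) sequentially"
    using assms by (intro order_tendstoD(2)[of _ "c * 0"]) auto
  thus ?thesis by (simp add: eventually_sequentially)
qed

context
  fixes e :: "nat \<Rightarrow> 'd" and \<epsilon> :: "nat \<Rightarrow> real"
  assumes tight: "tight_sequence e \<epsilon>" and e_I: "e k \<in> I"
    and adapted: "z \<in> relevant_arrays \<Longrightarrow> \<exists>k0. \<forall>k\<ge>k0. \<forall>j\<le>2*k+6. \<forall>p\<in>(S \<inter> {0..real k}) \<times> {0..1}.
      norm (e k * z j p - z j p * e k) \<le> \<epsilon> k \<and> (z j p \<in> I \<longrightarrow> norm (z j p - e k * z j p) \<le> \<epsilon> k)"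
begin

text \<open>The upper limit is an index from which on the sequence is constant.\<close>

definition spliced :: "real \<times> real \<Rightarrow> 'b \<Rightarrow> 'd" where
  "spliced p b = splice_along e (2 * first_index (fst p) + 6) (\<lambda>k. stage k b p)"

lemma spliced_eq:
  assumes p: "p \<in> S \<times> {0..1}" and M: "real M \<ge> 2 * fst p + 4"
  shows "spliced p b = splice_along e M (\<lambda>k. stage k b p)"
proof -
  have l: "fst p \<ge> 0" using p S_nonneg by auto
  define m where "m = 2 * first_index (fst p) + 6"
  have m: "real m \<ge> 2 * fst p + 4" using first_index(1)[OF l] by (simp add: m_def)
  have "splice_along e (max m M) (\<lambda>k. stage k b p) = splice_along e M (\<lambda>k. stage k b p)"
    using M by (intro splice_extend[of _ _ "\<sigma> b (snd p)"] stage_end[OF p]) auto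
  moreover have "splice_along e (max m M) (\<lambda>k. stage k b p) = splice_along e m (\<lambda>k. stage k b p)"
    using m by (intro splice_extend[of _ _ "\<sigma> b (snd p)"] stage_end[OF p]) auto
  ultimately show ?thesis by (simp add: spliced_def m_def)
qed

text \<open>Near a given parameter the upper limit may be fixed, and the sum is continuous.\<close>

lemma spliced_cont: "continuous_on (S \<times> {0..1}) (\<lambda>p. spliced p b)"
  unfolding continuous_on_eq_continuous_within
proof
  fix p0 assume p0: "p0 \<in> S \<times> {0..1::real}"
  have l0: "fst p0 \<ge> 0" using p0 S_nonneg by auto
  define M where "M = nat \<lceil>2 * (fst p0 + 1) + 4\<rceil>"
  have M: "real M \<ge> 2 * (fst p0 + 1) + 4" unfolding M_def by linarith
  have "continuous_on (S \<times> {0..1}) (\<lambda>p. splice_along e M (\<lambda>k. stage k b p))"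
    unfolding splice_along_def by (intro continuous_intros stage_cont)
  hence "continuous (at p0 within S \<times> {0..1}) (\<lambda>p. splice_along e M (\<lambda>k. stage k b p))"
    using p0 unfolding continuous_on_eq_continuous_within by blast
  thus "continuous (at p0 within S \<times> {0..1}) (\<lambda>p. spliced p b)"
  proof (rule continuous_transform_within[OF _ zero_less_one p0])
    fix p assume p: "p \<in> S \<times> {0..1}" "dist p p0 < 1"
    have "dist (fst p) (fst p0) < 1" using dist_fst_le[of p p0] p(2) by linarith
    hence "fst p \<le> fst p0 + 1" by (simp add: dist_real_def)
    thus "splice_along e M (\<lambda>k. stage k b p) = spliced p b"
      using M by (intro spliced_eq[OF p(1), symmetric]) (simp add: algebra_simps)
  qed
qed

lemma spliced_lift:
  assumes p: "p \<in> S \<times> {0..1}"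
  shows "spliced p b - \<sigma> b (snd p) \<in> I"
proof -
  define M where "M = 2 * first_index (fst p) + 6"
  have "fst p \<ge> 0" using p S_nonneg by auto
  hence "stage M b p = \<sigma> b (snd p)" using first_index(1)[of "fst p"]
    by (intro stage_end[OF p]) (simp add: M_def)
  hence "spliced p b - \<sigma> b (snd p) = (\<Sum>k<M. e k * (stage k b p - stage (Suc k) b p))"
    by (simp add: spliced_def splice_along_def M_def)
  thus ?thesis by (auto intro: sum_I right_I e_I)
qed

lemma adapted_at:
  assumes "z \<in> relevant_arrays"
  shows "\<exists>L. \<forall>l\<in>S. \<forall>t\<in>{0..1}. l \<ge> L \<longrightarrow> (\<forall>k j. first_index l \<le> k \<longrightarrow> j \<le> 2 * first_index l + 6 \<longrightarrow>
    norm (e k * z j (l, t) - z j (l, t) * e k) \<le> \<epsilon> k \<and>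
    (z j (l, t) \<in> I \<longrightarrow> norm (z j (l, t) - e k * z j (l, t)) \<le> \<epsilon> k))"
proof -
  obtain k0 where k0: "\<And>k j p. k \<ge> k0 \<Longrightarrow> j \<le> 2*k+6 \<Longrightarrow> p \<in> (S \<inter> {0..real k}) \<times> {0..1} \<Longrightarrow>
      norm (e k * z j p - z j p * e k) \<le> \<epsilon> k \<and> (z j p \<in> I \<longrightarrow> norm (z j p - e k * z j p) \<le> \<epsilon> k)"
    using adapted[OF assms] by blast
  have "norm (e k * z j (l, t) - z j (l, t) * e k) \<le> \<epsilon> k \<and>
    (z j (l, t) \<in> I \<longrightarrow> norm (z j (l, t) - e k * z j (l, t)) \<le> \<epsilon> k)"
    if "l \<in> S" "t \<in> {0..1}" "l \<ge> real k0" "first_index l \<le> k" "j \<le> 2 * first_index l + 6" for l t k j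
  proof (rule k0)
    have l: "l \<ge> 0" using that S_nonneg by auto
    show "k \<ge> k0" using first_index_mono[of k0 l] that by linarith
    show "j \<le> 2 * k + 6" using that by linarith
    have "l \<le> real k" using first_index(1)[OF l] that(4) by linarith
    thus "(l, t) \<in> (S \<inter> {0..real k}) \<times> {0..1}" using that l by auto
  qed
  thus ?thesis by blast
qed

lemma stage_const:
  assumes "l \<ge> 0" "k < first_index l"
  shows "stage k b (l, t) = h l b" "stage (Suc k) b (l, t) = h l b"
proof -
  have "real (Suc k) \<le> l + 1" using first_index(2)[OF assms(1)] assms(2) by linarith
  thus "stage k b (l, t) = h l b" "stage (Suc k) b (l, t) = h l b"
    using stage_start[of k "(l, t)"] stage_start[of "Suc k" "(l, t)"] by auto
qed

lemma stage_first:
  assumes "l \<ge> 0"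
  shows "stage (first_index l) b (l, t) = h l b"
  using first_index(2)[OF assms(1)] stage_start[of "first_index l" "(l, t)"] by simp

text \<open>
  A family with values in the ideal is absorbed by the approximate unit, except for its initial
  part, which measures the failure of \<open>h\<close> to be a homomorphism.
\<close>

lemma splice_ideal_array_small:
  assumes z: "z \<in> relevant_arrays" and zI: "\<And>p j. p \<in> S \<times> {0..1} \<Longrightarrow> z j p \<in> I"
    and start: "\<And>l t k. l \<in> S \<Longrightarrow> t \<in> {0..1} \<Longrightarrow> k \<le> first_index l \<Longrightarrow> z k (l, t) = d l"
    and d: "((\<lambda>l. norm (d l)) \<longlongrightarrow> 0) (inf at_top (principal S))"
  shows "((\<lambda>p. norm (splice_along e (2 * first_index (fst p) + 6) (\<lambda>k. z k p))) \<longlongrightarrow> 0) (strip_at_top S)"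
proof (rule tendsto_zero_strip)
  fix \<eta> :: real assume \<eta>: "\<eta> > 0"
  obtain N where N: "\<And>k. k \<ge> N \<Longrightarrow> 4 * (1/2::real)^k < \<eta>/2" using half_power_small[of "\<eta>/2" 4] \<eta> by auto
  have "eventually (\<lambda>l. norm (d l) < \<eta>/2) (inf at_top (principal S))"
    using d \<eta> by (intro order_tendstoD(2)[of _ 0]) auto
  then obtain L1 where L1: "\<And>l. l \<in> S \<Longrightarrow> l \<ge> L1 \<Longrightarrow> norm (d l) < \<eta>/2"
    by (auto simp: eventually_at_top_within)
  obtain L2 where L2: "\<And>l t k j. l \<in> S \<Longrightarrow> t \<in> {0..1} \<Longrightarrow> l \<ge> L2 \<Longrightarrow> first_index l \<le> k \<Longrightarrow>
      j \<le> 2 * first_index l + 6 \<Longrightarrow> z j (l, t) \<in> I \<Longrightarrow> norm (z j (l, t) - e k * z j (l, t)) \<le> \<epsilon> k"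
    using adapted_at[OF z] by blast
  have "norm (splice_along e (2 * first_index l + 6) (\<lambda>k. z k (l, t))) < \<eta>"
    if l: "l \<in> S" "l \<ge> L1" "l \<ge> L2" "l \<ge> real N" and t: "t \<in> {0..1}" for l t
  proof -
    have "norm (splice_along e (2 * first_index l + 6) (\<lambda>k. z k (l, t)))
        \<le> norm (z (first_index l) (l, t)) + 4 * (1/2)^first_index l"
    proof (rule norm_splice_killed[OF tight])
      show "z k (l, t) = z (Suc k) (l, t)" if "k < first_index l" for k
        using that l t by (simp add: start)
      show "norm (z j (l, t) - e k * z j (l, t)) \<le> \<epsilon> k"
        if "first_index l \<le> k" "j \<le> 2 * first_index l + 6" for k j
        using that l t zI by (intro L2) auto
    qed auto
    also have "z (first_index l) (l, t) = d l" using l t by (intro start) auto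
    also have "norm (d l) + 4 * (1/2)^first_index l < \<eta>/2 + \<eta>/2"
      using L1[OF l(1,2)] N[OF first_index_mono[of N l]] l by linarith
    finally show ?thesis by simp
  qed
  thus "\<exists>L. \<forall>l\<in>S. \<forall>t\<in>{0..1}. l \<ge> L \<longrightarrow>
      \<bar>norm (splice_along e (2 * first_index (fst (l, t)) + 6) (\<lambda>k. z k (l, t)))\<bar> < \<eta>"
    by (intro exI[of _ "max (max L1 L2) (real N)"]) auto
qed

lemma stage_relevant: "a \<in> C \<Longrightarrow> (\<lambda>k. stage k a) \<in> relevant_arrays"
  and step_relevant: "a \<in> C \<Longrightarrow> step_diff a \<in> relevant_arrays"
  and add_relevant: "a \<in> C \<Longrightarrow> b \<in> C \<Longrightarrow> add_defect a b \<in> relevant_arrays"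
  and mult_relevant: "a \<in> C \<Longrightarrow> b \<in> C \<Longrightarrow> mult_defect a b \<in> relevant_arrays"
  and scale_relevant: "a \<in> C \<Longrightarrow> c \<in> rational_scalars \<Longrightarrow> scale_defect c a \<in> relevant_arrays"
  and star_relevant: "a \<in> C \<Longrightarrow> star_defect a \<in> relevant_arrays"
  unfolding relevant_arrays_def
  by (auto intro: image_eqI[of _ _ "(a, b)"] image_eqI[of _ _ "(c, a)"])

lemma splice_star_small:
  assumes a: "a \<in> C"
  shows "((\<lambda>p. norm (splice_along e (2 * first_index (fst p) + 6) (\<lambda>k. star (stage k a p)) - star (spliced p a)))
    \<longlongrightarrow> 0) (strip_at_top S)"
proof (rule tendsto_zero_strip)
  fix \<eta> :: real assume \<eta>: "\<eta> > 0"
  obtain N where N: "\<And>k. k \<ge> N \<Longrightarrow> 4 * (1/2::real)^k < \<eta>" using half_power_small[of "\<eta>" 4] \<eta> by auto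
  obtain L where L: "\<And>l t k j. l \<in> S \<Longrightarrow> t \<in> {0..1} \<Longrightarrow> l \<ge> L \<Longrightarrow> first_index l \<le> k \<Longrightarrow>
      j \<le> 2 * first_index l + 6 \<Longrightarrow> norm (e k * stage j a (l, t) - stage j a (l, t) * e k) \<le> \<epsilon> k"
    using adapted_at[OF stage_relevant[OF a]] by blast
  have "norm (splice_along e (2 * first_index l + 6) (\<lambda>k. star (stage k a (l, t))) - star (spliced (l, t) a)) < \<eta>"
    if l: "l \<in> S" "l \<ge> L" "l \<ge> real N" and t: "t \<in> {0..1}" for l t
  proof -
    have l0: "l \<ge> 0" using l S_nonneg by auto
    have "norm (splice_along e (2 * first_index l + 6) (\<lambda>k. star (stage k a (l, t))) - star (spliced (l, t) a))
        \<le> 4 * (1/2)^first_index l"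
      unfolding spliced_def fst_conv
      by (rule norm_splice_star[OF tight]) (use l t l0 in \<open>auto simp: stage_const intro: L\<close>)
    also have "\<dots> < \<eta>" using N[OF first_index_mono[of N l]] l by simp
    finally show ?thesis .
  qed
  thus "\<exists>L. \<forall>l\<in>S. \<forall>t\<in>{0..1}. l \<ge> L \<longrightarrow> \<bar>norm (splice_along e (2 * first_index (fst (l, t)) + 6)
      (\<lambda>k. star (stage k a (l, t))) - star (spliced (l, t) a))\<bar> < \<eta>"
    by (intro exI[of _ "max L (real N)"]) auto
qed

text \<open>
  A step of the sequence is either small, or it lies in the ideal and is absorbed by the layer; the
  latter happens where \<open>h\<close> changes over to \<open>\<sigma>\<close>.
\<close>

lemma splice_mult_small:
  assumes a: "a \<in> C" and b: "b \<in> C"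
  shows "((\<lambda>p. norm (splice_along e (2 * first_index (fst p) + 6) (\<lambda>k. stage k a p * stage k b p)
    - spliced p a * spliced p b)) \<longlongrightarrow> 0) (strip_at_top S)"
proof (rule tendsto_zero_strip)
  fix \<eta> :: real assume \<eta>: "\<eta> > 0"
  obtain R1 R2 where R1: "R1 \<ge> 1" "\<And>p k. p \<in> S \<times> {0..1} \<Longrightarrow> norm (stage k a p) \<le> R1"
    and R2: "R2 \<ge> 1" "\<And>p k. p \<in> S \<times> {0..1} \<Longrightarrow> norm (stage k b p) \<le> R2"
    using stage_bounded[OF a] stage_bounded[OF b] by metis
  define R where "R = max R1 R2"
  have R: "R \<ge> 1" "\<And>p k. p \<in> S \<times> {0..1} \<Longrightarrow> norm (stage k a p) \<le> R"
      "\<And>p k. p \<in> S \<times> {0..1} \<Longrightarrow> norm (stage k b p) \<le> R"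
    using R1 R2 unfolding R_def by (force simp: le_max_iff_disj)+
  define \<kappa> where "\<kappa> = \<eta> / (8 * R)"
  have \<kappa>: "\<kappa> > 0" using \<eta> R by (simp add: \<kappa>_def)
  obtain N where N: "\<And>k. k \<ge> N \<Longrightarrow> (4 * R + 2 + 40 * R\<^sup>2) * (1/2::real)^k < \<eta>/2"
    using half_power_small[of "\<eta>/2" "4 * R + 2 + 40 * R\<^sup>2"] \<eta> by auto
  obtain L1 where L1: "\<And>p k. p \<in> S \<times> {0..1} \<Longrightarrow> fst p \<ge> L1 \<Longrightarrow>
      stage k a p - stage (Suc k) a p \<in> I \<or> norm (stage k a p - stage (Suc k) a p) \<le> \<kappa>"
    using stage_step[OF \<kappa>, of a] by blast
  obtain L2 where L2: "\<And>l t k j. l \<in> S \<Longrightarrow> t \<in> {0..1} \<Longrightarrow> l \<ge> L2 \<Longrightarrow> first_index l \<le> k \<Longrightarrow>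
      j \<le> 2 * first_index l + 6 \<Longrightarrow> norm (e k * stage j a (l, t) - stage j a (l, t) * e k) \<le> \<epsilon> k"
    using adapted_at[OF stage_relevant[OF a]] by blast
  obtain L3 where L3: "\<And>l t k j. l \<in> S \<Longrightarrow> t \<in> {0..1} \<Longrightarrow> l \<ge> L3 \<Longrightarrow> first_index l \<le> k \<Longrightarrow>
      j \<le> 2 * first_index l + 6 \<Longrightarrow> norm (e k * stage j b (l, t) - stage j b (l, t) * e k) \<le> \<epsilon> k"
    using adapted_at[OF stage_relevant[OF b]] by blast
  obtain L4 where L4: "\<And>l t k j. l \<in> S \<Longrightarrow> t \<in> {0..1} \<Longrightarrow> l \<ge> L4 \<Longrightarrow> first_index l \<le> k \<Longrightarrow>
      j \<le> 2 * first_index l + 6 \<Longrightarrow> step_diff a j (l, t) \<in> I \<Longrightarrow>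
      norm (step_diff a j (l, t) - e k * step_diff a j (l, t)) \<le> \<epsilon> k"
    using adapted_at[OF step_relevant[OF a]] by blast
  define L where "L = Max {L1, L2, L3, L4, real N, 672 * R^4}"
  have L: "L1 \<le> L" "L2 \<le> L" "L3 \<le> L" "L4 \<le> L" "real N \<le> L" "672 * R^4 \<le> L" by (auto simp: L_def)
  have "norm (splice_along e (2 * first_index l + 6) (\<lambda>k. stage k a (l, t) * stage k b (l, t))
      - spliced (l, t) a * spliced (l, t) b) < \<eta>"
    if l: "l \<in> S" "l \<ge> L" and t: "t \<in> {0..1}" for l t
  proof -
    define K where "K = first_index l"
    have l0: "l \<ge> 0" using l S_nonneg by auto
    have p: "(l, t) \<in> S \<times> {0..1}" using l t by auto
    have K: "l \<le> real K" using first_index(1)[OF l0] by (simp add: K_def)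
    have geom: "(1/2::real)^k \<le> (1/2)^K" if "K \<le> k" for k using that by (intro power_decreasing) auto
    have "norm (splice_along e (2 * K + 6) (\<lambda>k. stage k a (l, t) * stage k b (l, t))
        - spliced (l, t) a * spliced (l, t) b) \<le> 4 * R * ((1/2)^K + \<kappa>) + (2 + 40 * R\<^sup>2) * (1/2)^K"
      unfolding spliced_def fst_conv K_def[symmetric]
    proof (rule norm_splice_mult[OF tight R(1)])
      show "672 * R^4 \<le> real K + 1" using L l K by linarith
      show "0 \<le> 4 * R * ((1/2)^K + \<kappa>)" using R \<kappa> by simp
      fix k assume k: "K \<le> k" "k < 2 * K + 6"
      define D where "D = step_diff a k (l, t)"
      define D' where "D' = stage k b (l, t) - stage (Suc k) b (l, t)"
      have D': "norm D' \<le> 2 * R"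
        using norm_diff_le[OF R(3)[OF p] R(3)[OF p]] by (simp add: D'_def)
      have "D \<in> I \<or> norm D \<le> \<kappa>" using L1[OF p, of k] L l by (simp add: D_def step_diff_def)
      hence "norm ((e k - e k * e k) * D) \<le> 2 * ((1/2)^K + \<kappa>)"
      proof
        assume "D \<in> I"
        hence "norm (D - e k * D) \<le> \<epsilon> k" unfolding D_def using k l t L by (intro L4) (auto simp: K_def)
        also have "\<dots> \<le> (1/2)^K" using tight_le_geometric[OF tight, of k] geom[OF k(1)] by linarith
        finally have "norm (e k * (D - e k * D)) \<le> 2 * (1/2)^K"
          by (intro norm_mult_le tight_norm[OF tight])
        moreover have "(e k - e k * e k) * D = e k * (D - e k * D)" by (simp add: algebra_simps)
        ultimately show ?thesis using \<kappa> by simp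
      next
        assume "norm D \<le> \<kappa>"
        hence "norm (e k * D) \<le> 2 * \<kappa>" by (intro norm_mult_le tight_norm[OF tight])
        moreover have "(e k - e k * e k) * D = e k * D - e k * (e k * D)" by (simp add: algebra_simps)
        ultimately have "norm ((e k - e k * e k) * D) \<le> 2 * \<kappa>"
          using unit_contractionD[OF tightD(2)[OF tight, of k], of "e k * D"] by simp
        moreover have "(0::real) \<le> 2 * (1/2)^K" by simp
        ultimately show ?thesis unfolding distrib_left by linarith
      qed
      hence "norm ((e k - e k * e k) * D * D') \<le> 2 * ((1/2)^K + \<kappa>) * (2 * R)"
        using D' by (rule norm_mult_le)
      thus "norm ((e k - e k * e k) * ((stage k a (l, t) - stage (Suc k) a (l, t)) *
          (stage k b (l, t) - stage (Suc k) b (l, t)))) \<le> 4 * R * ((1/2)^K + \<kappa>)"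
        by (simp add: D_def D'_def step_diff_def mult_ac)
    next
      fix k j assume kj: "K \<le> k" "j \<le> 2 * K + 6"
      show "norm (e k * stage j a (l, t) - stage j a (l, t) * e k) \<le> \<epsilon> k"
        using kj l t L unfolding K_def by (intro L2) auto
      show "norm (e k * stage j b (l, t) - stage j b (l, t) * e k) \<le> \<epsilon> k"
        using kj l t L unfolding K_def by (intro L3) auto
    qed (use R(2,3)[OF p] l0 in \<open>auto simp: K_def stage_const\<close>)
    also have "\<dots> = (4 * R + 2 + 40 * R\<^sup>2) * (1/2)^K + 4 * R * \<kappa>" by (simp add: algebra_simps)
    also have "4 * R * \<kappa> = \<eta>/2" using R by (simp add: \<kappa>_def)
    also have "(4 * R + 2 + 40 * R\<^sup>2) * (1/2)^K < \<eta>/2"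
      unfolding K_def using l L by (intro N first_index_mono) auto
    finally show ?thesis by (simp add: K_def)
  qed
  thus "\<exists>L. \<forall>l\<in>S. \<forall>t\<in>{0..1}. l \<ge> L \<longrightarrow> \<bar>norm (splice_along e (2 * first_index (fst (l, t)) + 6)
      (\<lambda>k. stage k a (l, t) * stage k b (l, t)) - spliced (l, t) a * spliced (l, t) b)\<bar> < \<eta>"
    by (intro exI[of _ L]) auto
qed

lemma tendsto_norm_add_zero:
  assumes "((\<lambda>i. norm (f i)) \<longlongrightarrow> 0) F" "((\<lambda>i. norm (g i)) \<longlongrightarrow> 0) F"
  shows "((\<lambda>i. norm (f i + (g i :: 'a::real_normed_vector))) \<longlongrightarrow> 0) F"
  using assms unfolding tendsto_norm_zero_iff by (rule tendsto_add_zero)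

lemma spliced_asymptotic: "norm.asymptotic_on (strip_at_top S) C spliced"
  unfolding norm.asymptotic_on_def
proof (intro conjI ballI)
  note hD = norm.asymptotic_onD[OF h_asymp]
  have S0: "l \<ge> 0" if "l \<in> S" for l using that S_nonneg by auto
  have start: "stage k b (l, t) = h l b" if "l \<in> S" "k \<le> first_index l" for k b l t
    using that stage_first[OF S0[OF that(1)]] stage_const(1)[OF S0[OF that(1)]] by (cases "k = first_index l") auto
  {
    fix a b assume ab: "a \<in> C" "b \<in> C"
    have "((\<lambda>p. norm (splice_along e (2 * first_index (fst p) + 6) (\<lambda>k. add_defect a b k p))) \<longlongrightarrow> 0) (strip_at_top S)"
      by (rule splice_ideal_array_small[OF add_relevant[OF ab] _ _ hD(1)[OF ab]])
         (auto simp: add_defect_def start intro!: hom_modD[OF stage_hom])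
    thus "((\<lambda>p. norm (spliced p (a + b) - (spliced p a + spliced p b))) \<longlongrightarrow> 0) (strip_at_top S)"
      unfolding add_defect_def splice_diff splice_add spliced_def .
    have "((\<lambda>p. norm (splice_along e (2 * first_index (fst p) + 6) (\<lambda>k. mult_defect a b k p))) \<longlongrightarrow> 0) (strip_at_top S)"
      by (rule splice_ideal_array_small[OF mult_relevant[OF ab] _ _ hD(3)[OF ab]])
         (auto simp: mult_defect_def start intro!: hom_modD[OF stage_hom])
    from tendsto_norm_add_zero[OF this splice_mult_small[OF ab]]
    show "((\<lambda>p. norm (spliced p (a * b) - spliced p a * spliced p b)) \<longlongrightarrow> 0) (strip_at_top S)"
      unfolding mult_defect_def splice_diff by (simp add: spliced_def)
  next
    fix a c assume a: "a \<in> C" and c: "c \<in> rational_scalars"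
    have "((\<lambda>p. norm (splice_along e (2 * first_index (fst p) + 6) (\<lambda>k. scale_defect c a k p))) \<longlongrightarrow> 0) (strip_at_top S)"
      by (rule splice_ideal_array_small[OF scale_relevant[OF a c] _ _ hD(2)[OF a c]])
         (auto simp: scale_defect_def start intro!: hom_modD[OF stage_hom])
    thus "((\<lambda>p. norm (spliced p (c *\<^sub>C a) - c *\<^sub>C spliced p a)) \<longlongrightarrow> 0) (strip_at_top S)"
      unfolding scale_defect_def splice_diff splice_scaleC spliced_def .
  next
    fix a assume a: "a \<in> C"
    have "((\<lambda>p. norm (splice_along e (2 * first_index (fst p) + 6) (\<lambda>k. star_defect a k p))) \<longlongrightarrow> 0) (strip_at_top S)"
      by (rule splice_ideal_array_small[OF star_relevant[OF a] _ _ hD(4)[OF a]])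
         (auto simp: star_defect_def start intro!: hom_modD[OF stage_hom])
    from tendsto_norm_add_zero[OF this splice_star_small[OF a]]
    show "((\<lambda>p. norm (spliced p (star a) - star (spliced p a))) \<longlongrightarrow> 0) (strip_at_top S)"
      unfolding star_defect_def splice_diff by (simp add: spliced_def)
  }
qed

end

lemma lift_on_countable_subalgebra:
  "\<exists>\<Psi>. (\<forall>b. continuous_on (S \<times> {0..1}) (\<lambda>p. \<Psi> p b)) \<and>
     (\<forall>b. \<forall>p\<in>S \<times> {0..1}. \<Psi> p b - \<sigma> b (snd p) \<in> I) \<and> norm.asymptotic_on (strip_at_top S) C \<Psi>"
proof -
  have compact: "compact ((S \<inter> {0..real k}) \<times> {0..1::real})" for k
    by (intro compact_Times closed_Int_compact closed_S compact_Icc)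
  have cont: "continuous_on ((S \<inter> {0..real k}) \<times> {0..1}) (z j)" if "z \<in> relevant_arrays" for z j k
    by (rule continuous_on_subset[OF relevant_arrays_cont[OF that]]) auto
  obtain e \<epsilon> where adapted: "tight_sequence e \<epsilon>" "\<And>k. e k \<in> I"
    "\<And>z. z \<in> relevant_arrays \<Longrightarrow> \<exists>k0. \<forall>k\<ge>k0. \<forall>j\<le>2*k+6. \<forall>p\<in>(S \<inter> {0..real k}) \<times> {0..1}.
      norm (e k * z j p - z j p * e k) \<le> \<epsilon> k \<and> (z j p \<in> I \<longrightarrow> norm (z j p - e k * z j p) \<le> \<epsilon> k)"
    using tight_sequence_for_arrays[of relevant_arrays "\<lambda>k. (S \<inter> {0..real k}) \<times> {0..1::real}"]
      countable_relevant_arrays compact cont by blast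
  from spliced_cont[OF adapted] spliced_lift[OF adapted] spliced_asymptotic[OF adapted] show ?thesis
    by (intro exI[of _ "spliced e"]) blast
qed

end

section \<open>Extension from a dense subalgebra\<close>

text \<open>
  \<open>X\<close> behaves at infinity like the value at \<open>b\<close> of a continuous extension of \<open>\<Psi>\<close> from \<open>C\<close> to its closure;
  such \<open>X\<close> are unique up to null families, and compatible with all operations.
\<close>

definition represents ::
  "'i filter \<Rightarrow> 'b::cstar_algebra set \<Rightarrow> ('i \<Rightarrow> 'b \<Rightarrow> 'd::cstar_algebra) \<Rightarrow> ('i \<Rightarrow> 'd) \<Rightarrow> 'b \<Rightarrow> bool" where
  "represents \<F> C \<Psi> X b \<longleftrightarrow>
    (\<forall>\<eta>>0. \<exists>c\<in>C. norm (b - c) < \<eta> \<and> eventually (\<lambda>p. norm (X p - \<Psi> p c) \<le> \<eta>) \<F>)"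

lemma representsD:
  assumes "represents \<F> C \<Psi> X b" "\<eta> > 0"
  obtains c where "c \<in> C" "norm (b - c) < \<eta>" "eventually (\<lambda>p. norm (X p - \<Psi> p c) \<le> \<eta>) \<F>"
  using assms unfolding represents_def by blast

lemma eventually_norm_le_of_tendsto:
  assumes "((\<lambda>p. norm (f p)) \<longlongrightarrow> 0) \<F>" "\<eta> > 0"
  shows "eventually (\<lambda>p. norm (f p) \<le> \<eta>) \<F>"
  using order_tendstoD(2)[OF assms] by (rule eventually_mono) simp

lemma tendsto_norm_zeroI:
  assumes "\<And>\<eta>. \<eta> > 0 \<Longrightarrow> eventually (\<lambda>p. norm (f p) \<le> \<eta>) \<F>"
  shows "((\<lambda>p. norm (f p)) \<longlongrightarrow> 0) \<F>"
  unfolding tendsto_iff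
proof (intro allI impI)
  fix \<eta> :: real assume "\<eta> > 0"
  hence "eventually (\<lambda>p. norm (f p) \<le> \<eta>/2) \<F>" by (intro assms) simp
  thus "eventually (\<lambda>p. dist (norm (f p)) 0 < \<eta>) \<F>"
    using \<open>\<eta> > 0\<close> by (auto elim!: eventually_mono)
qed

context
  fixes \<F> :: "'i filter" and C :: "'b::cstar_algebra set" and \<Psi> :: "'i \<Rightarrow> 'b \<Rightarrow> 'd::cstar_algebra"
  assumes C: "cosine_subalgebra C" and \<Psi>: "norm.asymptotic_on \<F> C \<Psi>"
begin

lemma C_ops: "a \<in> C \<Longrightarrow> b \<in> C \<Longrightarrow> a + b \<in> C" "a \<in> C \<Longrightarrow> b \<in> C \<Longrightarrow> a * b \<in> C"
  "a \<in> C \<Longrightarrow> star a \<in> C" "a \<in> C \<Longrightarrow> c \<in> rational_scalars \<Longrightarrow> c *\<^sub>C a \<in> C"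
  using C unfolding cosine_subalgebra_def by blast+

text \<open>Asymptotic contractivity in a form that serves maps which are not linear.\<close>

lemma asymptotic_on_diff_bound:
  assumes a: "a \<in> C" and b: "b \<in> C" and \<eta>: "\<eta> > 0"
  shows "eventually (\<lambda>p. norm (\<Psi> p a - \<Psi> p b) \<le> norm (a - b) + \<eta>) \<F>"
proof -
  have diff: "a - b \<in> C" using C_ops(1)[OF a cosine_subalgebra_minus[OF C b]] by simp
  have "((\<lambda>p. norm (\<Psi> p (b + (a - b)) - (\<Psi> p b + \<Psi> p (a - b)))) \<longlongrightarrow> 0) \<F>"
    by (rule norm.asymptotic_onD(1)[OF \<Psi> b diff])
  hence "eventually (\<lambda>p. norm (\<Psi> p (b + (a - b)) - (\<Psi> p b + \<Psi> p (a - b))) \<le> \<eta>/2) \<F>"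
    using \<eta> by (intro eventually_norm_le_of_tendsto) auto
  moreover have "eventually (\<lambda>p. norm (\<Psi> p (a - b)) \<le> norm (a - b) + \<eta>/2) \<F>"
    using \<eta> by (intro norm.asymptotic_on_bound[OF C \<Psi> diff]) auto
  ultimately show ?thesis
  proof eventually_elim
    case (elim p)
    have "\<Psi> p a - \<Psi> p b = (\<Psi> p (b + (a - b)) - (\<Psi> p b + \<Psi> p (a - b))) + \<Psi> p (a - b)" by simp
    hence "norm (\<Psi> p a - \<Psi> p b) \<le> \<eta>/2 + (norm (a - b) + \<eta>/2)"
      using elim by (simp only:) (intro norm_triangle_le add_mono)
    thus ?case by simp
  qed
qed

lemma represents_unique:
  assumes X: "represents \<F> C \<Psi> X b" and Y: "represents \<F> C \<Psi> Y b"
  shows "((\<lambda>p. norm (X p - Y p)) \<longlongrightarrow> 0) \<F>"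
proof (rule tendsto_norm_zeroI)
  fix \<eta> :: real assume \<eta>: "\<eta> > 0"
  hence \<eta>5: "\<eta>/5 > 0" by simp
  obtain c where c: "c \<in> C" "norm (b - c) < \<eta>/5" "eventually (\<lambda>p. norm (X p - \<Psi> p c) \<le> \<eta>/5) \<F>"
    using X \<eta>5 by (rule representsD)
  obtain d where d: "d \<in> C" "norm (b - d) < \<eta>/5" "eventually (\<lambda>p. norm (Y p - \<Psi> p d) \<le> \<eta>/5) \<F>"
    using Y \<eta>5 by (rule representsD)
  have "norm (c - d) \<le> norm (b - d) + norm (b - c)"
    using norm_triangle_ineq4[of "b - d" "b - c"] by simp
  hence cd: "norm (c - d) \<le> 2 * (\<eta>/5)" using c(2) d(2) by linarith
  have "eventually (\<lambda>p. norm (\<Psi> p c - \<Psi> p d) \<le> norm (c - d) + \<eta>/5) \<F>"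
    by (rule asymptotic_on_diff_bound[OF c(1) d(1) \<eta>5])
  with c(3) d(3) show "eventually (\<lambda>p. norm (X p - Y p) \<le> \<eta>) \<F>"
  proof eventually_elim
    case (elim p)
    have "X p - Y p = ((X p - \<Psi> p c) + (\<Psi> p c - \<Psi> p d)) - (Y p - \<Psi> p d)" by simp
    hence "norm (X p - Y p) \<le> (\<eta>/5 + (norm (c - d) + \<eta>/5)) + \<eta>/5"
      using elim by (simp only:) (rule norm_diff_le[OF order_trans[OF norm_triangle_ineq add_mono]])
    thus ?case using cd by linarith
  qed
qed

lemma represents_bound:
  assumes X: "represents \<F> C \<Psi> X b" and \<eta>: "\<eta> > 0"
  shows "eventually (\<lambda>p. norm (X p) \<le> norm b + \<eta>) \<F>"
proof -
  from \<eta> have \<eta>3: "\<eta>/3 > 0" by simp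
  obtain c where c: "c \<in> C" "norm (b - c) < \<eta>/3" "eventually (\<lambda>p. norm (X p - \<Psi> p c) \<le> \<eta>/3) \<F>"
    using X \<eta>3 by (rule representsD)
  have nc: "norm c \<le> norm b + \<eta>/3" using c(2) norm_triangle_ineq2[of c b] by (simp add: norm_minus_commute)
  have "eventually (\<lambda>p. norm (\<Psi> p c) \<le> norm c + \<eta>/3) \<F>"
    by (rule norm.asymptotic_on_bound[OF C \<Psi> c(1) \<eta>3])
  with c(3) show ?thesis
  proof eventually_elim
    case (elim p)
    thus ?case using norm_triangle_ineq2[of "X p" "\<Psi> p c"] nc by linarith
  qed
qed

lemma represents_add:
  assumes X: "represents \<F> C \<Psi> X a" and Y: "represents \<F> C \<Psi> Y b"
  shows "represents \<F> C \<Psi> (\<lambda>p. X p + Y p) (a + b)"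
  unfolding represents_def
proof (intro allI impI)
  fix \<eta> :: real assume \<eta>: "\<eta> > 0"
  hence \<eta>3: "\<eta>/3 > 0" by simp
  obtain c where c: "c \<in> C" "norm (a - c) < \<eta>/3" "eventually (\<lambda>p. norm (X p - \<Psi> p c) \<le> \<eta>/3) \<F>"
    using X \<eta>3 by (rule representsD)
  obtain d where d: "d \<in> C" "norm (b - d) < \<eta>/3" "eventually (\<lambda>p. norm (Y p - \<Psi> p d) \<le> \<eta>/3) \<F>"
    using Y \<eta>3 by (rule representsD)
  have "eventually (\<lambda>p. norm (\<Psi> p (c + d) - (\<Psi> p c + \<Psi> p d)) \<le> \<eta>/3) \<F>"
    by (rule eventually_norm_le_of_tendsto[OF norm.asymptotic_onD(1)[OF \<Psi> c(1) d(1)] \<eta>3])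
  with c(3) d(3) have "eventually (\<lambda>p. norm ((X p + Y p) - \<Psi> p (c + d)) \<le> \<eta>) \<F>"
  proof eventually_elim
    case (elim p)
    have "(X p + Y p) - \<Psi> p (c + d)
        = ((X p - \<Psi> p c) + (Y p - \<Psi> p d)) - (\<Psi> p (c + d) - (\<Psi> p c + \<Psi> p d))" by simp
    hence "norm ((X p + Y p) - \<Psi> p (c + d)) \<le> (\<eta>/3 + \<eta>/3) + \<eta>/3"
      using elim by (simp only:) (intro norm_diff_le norm_triangle_le add_mono)
    thus ?case by simp
  qed
  moreover have "norm ((a + b) - (c + d)) < \<eta>"
    using norm_diff_triangle_ineq[of a b c d] c(2) d(2) \<eta> by linarith
  ultimately show "\<exists>c\<in>C. norm (a + b - c) < \<eta> \<and> eventually (\<lambda>p. norm (X p + Y p - \<Psi> p c) \<le> \<eta>) \<F>"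
    using C_ops(1)[OF c(1) d(1)] by blast
qed

lemma represents_star:
  assumes X: "represents \<F> C \<Psi> X a"
  shows "represents \<F> C \<Psi> (\<lambda>p. star (X p)) (star a)"
  unfolding represents_def
proof (intro allI impI)
  fix \<eta> :: real assume \<eta>: "\<eta> > 0"
  hence \<eta>2: "\<eta>/2 > 0" by simp
  obtain c where c: "c \<in> C" "norm (a - c) < \<eta>/2" "eventually (\<lambda>p. norm (X p - \<Psi> p c) \<le> \<eta>/2) \<F>"
    using X \<eta>2 by (rule representsD)
  have "eventually (\<lambda>p. norm (\<Psi> p (star c) - star (\<Psi> p c)) \<le> \<eta>/2) \<F>"
    by (rule eventually_norm_le_of_tendsto[OF norm.asymptotic_onD(4)[OF \<Psi> c(1)] \<eta>2])
  with c(3) have "eventually (\<lambda>p. norm (star (X p) - \<Psi> p (star c)) \<le> \<eta>) \<F>"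
  proof eventually_elim
    case (elim p)
    have "star (X p) - \<Psi> p (star c) = star (X p - \<Psi> p c) - (\<Psi> p (star c) - star (\<Psi> p c))"
      by (simp add: star_diff)
    hence "norm (star (X p) - \<Psi> p (star c)) \<le> \<eta>/2 + \<eta>/2"
      using elim by (simp only:) (intro norm_diff_le; simp)
    thus ?case by simp
  qed
  moreover have "norm (star a - star c) < \<eta>" using c(2) \<eta> by (simp flip: star_diff)
  ultimately show "\<exists>c\<in>C. norm (star a - c) < \<eta> \<and> eventually (\<lambda>p. norm (star (X p) - \<Psi> p c) \<le> \<eta>) \<F>"
    using C_ops(3)[OF c(1)] by blast
qed

lemma represents_mult:
  assumes X: "represents \<F> C \<Psi> X a" and Y: "represents \<F> C \<Psi> Y b"
  shows "represents \<F> C \<Psi> (\<lambda>p. X p * Y p) (a * b)"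
  unfolding represents_def
proof (intro allI impI)
  fix \<eta> :: real assume \<eta>: "\<eta> > 0"
  define N where "N = norm a + norm b + 2"
  have N: "N > 0" "norm b + 1 \<le> N" "norm a + 2 \<le> N" by (auto simp: N_def intro: add_nonneg_pos)
  define \<delta> where "\<delta> = min 1 (\<eta> / (3 * N))"
  have \<delta>: "\<delta> > 0" "\<delta> \<le> 1" using \<eta> N by (auto simp: \<delta>_def)
  have "N * \<delta> \<le> N * (\<eta> / (3 * N))" unfolding \<delta>_def using N by (intro mult_left_mono) auto
  hence N\<delta>: "N * \<delta> \<le> \<eta>/3" using N by simp
  obtain c where c: "c \<in> C" "norm (a - c) < \<delta>" "eventually (\<lambda>p. norm (X p - \<Psi> p c) \<le> \<delta>) \<F>"
    using X \<delta>(1) by (rule representsD)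
  obtain d where d: "d \<in> C" "norm (b - d) < \<delta>" "eventually (\<lambda>p. norm (Y p - \<Psi> p d) \<le> \<delta>) \<F>"
    using Y \<delta>(1) by (rule representsD)
  have nc: "norm c \<le> norm a + 1"
    using c(2) \<delta>(2) norm_triangle_ineq2[of c a] by (simp add: norm_minus_commute)
  have "eventually (\<lambda>p. norm (\<Psi> p (c * d) - \<Psi> p c * \<Psi> p d) \<le> \<eta>/3) \<F>"
    by (rule eventually_norm_le_of_tendsto[OF norm.asymptotic_onD(3)[OF \<Psi> c(1) d(1)]]) (use \<eta> in simp)
  moreover have "eventually (\<lambda>p. norm (\<Psi> p c) \<le> norm c + 1) \<F>"
    by (rule norm.asymptotic_on_bound[OF C \<Psi> c(1)]) simp
  moreover have "eventually (\<lambda>p. norm (Y p) \<le> norm b + 1) \<F>" by (rule represents_bound[OF Y]) simp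
  ultimately have "eventually (\<lambda>p. norm (X p * Y p - \<Psi> p (c * d)) \<le> \<eta>) \<F>"
    using c(3) d(3)
  proof eventually_elim
    case (elim p)
    have "norm (Y p) \<le> N" "norm (\<Psi> p c) \<le> N" using elim nc N by linarith+
    hence "norm ((X p - \<Psi> p c) * Y p) \<le> \<delta> * N" "norm (\<Psi> p c * (Y p - \<Psi> p d)) \<le> N * \<delta>"
      using elim by (auto intro: norm_mult_le)
    moreover have "X p * Y p - \<Psi> p (c * d)
        = ((X p - \<Psi> p c) * Y p + \<Psi> p c * (Y p - \<Psi> p d)) - (\<Psi> p (c * d) - \<Psi> p c * \<Psi> p d)"
      by (simp add: algebra_simps)
    ultimately have "norm (X p * Y p - \<Psi> p (c * d)) \<le> (\<delta> * N + N * \<delta>) + \<eta>/3"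
      using elim by (simp only:) (intro norm_diff_le norm_triangle_le add_mono)
    thus ?case using N\<delta> by (simp add: mult.commute)
  qed
  moreover have "norm (a * b - c * d) < \<eta>"
  proof -
    have "a * b - c * d = (a - c) * b + c * (b - d)" by (simp add: algebra_simps)
    moreover have "norm ((a - c) * b) \<le> \<delta> * N" "norm (c * (b - d)) \<le> N * \<delta>"
      using c(2) d(2) nc N by (auto intro!: norm_mult_le)
    ultimately have "norm (a * b - c * d) \<le> \<delta> * N + N * \<delta>"
      by (simp only:) (intro norm_triangle_le add_mono)
    thus ?thesis using N\<delta> \<eta> by (simp add: mult.commute)
  qed
  ultimately show "\<exists>c\<in>C. norm (a * b - c) < \<eta> \<and> eventually (\<lambda>p. norm (X p * Y p - \<Psi> p c) \<le> \<eta>) \<F>"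
    using C_ops(2)[OF c(1) d(1)] by blast
qed

lemma represents_scaleC:
  assumes X: "represents \<F> C \<Psi> X a"
  shows "represents \<F> C \<Psi> (\<lambda>p. \<mu> *\<^sub>C X p) (\<mu> *\<^sub>C a)"
  unfolding represents_def
proof (intro allI impI)
  fix \<eta> :: real assume \<eta>: "\<eta> > 0"
  define N where "N = norm a + cmod \<mu> + 1"
  have N: "N > 0" "norm a + 1 \<le> N" "cmod \<mu> + 1 \<le> N" by (auto simp: N_def intro: add_nonneg_pos)
  define \<delta> where "\<delta> = min 1 (\<eta> / (3 * N))"
  have \<delta>: "\<delta> > 0" "\<delta> \<le> 1" using \<eta> N by (auto simp: \<delta>_def)
  have "N * \<delta> \<le> N * (\<eta> / (3 * N))" unfolding \<delta>_def using N by (intro mult_left_mono) auto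
  hence N\<delta>: "N * \<delta> \<le> \<eta>/3" using N by simp
  obtain c where c: "c \<in> C" "norm (a - c) < \<delta>" "eventually (\<lambda>p. norm (X p - \<Psi> p c) \<le> \<delta>) \<F>"
    using X \<delta>(1) by (rule representsD)
  obtain \<nu> where \<nu>: "\<nu> \<in> rational_scalars" "cmod (\<mu> - \<nu>) < \<delta>" using rational_scalars_dense[OF \<delta>(1)] by blast
  have n\<nu>: "cmod \<nu> \<le> N"
    using \<nu>(2) \<delta>(2) N norm_triangle_ineq2[of \<nu> \<mu>] by (simp add: norm_minus_commute)
  have split: "\<mu> *\<^sub>C x - \<nu> *\<^sub>C y = (\<mu> - \<nu>) *\<^sub>C x + \<nu> *\<^sub>C (x - y)" for x y :: "'e::cstar_algebra"
    using scaleC_add_left[of "\<mu> - \<nu>" \<nu> x] by (simp add: scaleC_diff_right)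
  have est: "norm (\<mu> *\<^sub>C x - \<nu> *\<^sub>C y) \<le> \<delta> * N + N * \<delta>" if "norm x \<le> N" "norm (x - y) \<le> \<delta>"
    for x y :: "'e::cstar_algebra"
    unfolding split using that \<nu>(2) n\<nu> \<delta> N
    by (intro norm_triangle_le add_mono) (auto simp: norm_scaleC intro!: mult_mono)
  have "eventually (\<lambda>p. norm (\<Psi> p (\<nu> *\<^sub>C c) - \<nu> *\<^sub>C \<Psi> p c) \<le> \<eta>/3) \<F>"
    by (rule eventually_norm_le_of_tendsto[OF norm.asymptotic_onD(2)[OF \<Psi> c(1) \<nu>(1)]]) (use \<eta> in simp)
  moreover have "eventually (\<lambda>p. norm (X p) \<le> norm a + 1) \<F>" by (rule represents_bound[OF X]) simp
  ultimately have "eventually (\<lambda>p. norm (\<mu> *\<^sub>C X p - \<Psi> p (\<nu> *\<^sub>C c)) \<le> \<eta>) \<F>"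
    using c(3)
  proof eventually_elim
    case (elim p)
    have "\<mu> *\<^sub>C X p - \<Psi> p (\<nu> *\<^sub>C c) = (\<mu> *\<^sub>C X p - \<nu> *\<^sub>C \<Psi> p c) - (\<Psi> p (\<nu> *\<^sub>C c) - \<nu> *\<^sub>C \<Psi> p c)"
      by simp
    also have "norm \<dots> \<le> (\<delta> * N + N * \<delta>) + \<eta>/3"
      using elim N by (intro norm_diff_le est) auto
    finally show ?case using N\<delta> by (simp add: mult.commute)
  qed
  moreover have "norm (\<mu> *\<^sub>C a - \<nu> *\<^sub>C c) < \<eta>"
    using est[of a c] c(2) N N\<delta> \<eta> by (simp add: mult.commute)
  ultimately show "\<exists>c\<in>C. norm (\<mu> *\<^sub>C a - c) < \<eta> \<and> eventually (\<lambda>p. norm (\<mu> *\<^sub>C X p - \<Psi> p c) \<le> \<eta>) \<F>"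
    using C_ops(4)[OF c(1) \<nu>(1)] by blast
qed

end

lemma continuous_on_reparametrize:
  assumes "continuous_on (S \<times> {0..1}) f" "\<Lambda> \<in> S"
  shows "continuous_on (S \<times> {0..1}) (\<lambda>p::real \<times> real. f (max (fst p) \<Lambda>, snd p))"
  by (rule continuous_on_compose2[OF assms(1)])
     (use assms(2) in \<open>auto intro!: continuous_intros split: split_max\<close>)

lemma full_simps [simp]:
  "carr full = UNIV" "add full = (+)" "scl full = (*\<^sub>C)" "mul full = (*)" "adj full = star" "nrm full = norm"
  by (simp_all add: full_def)

locale dense_homotopy_lifting = homotopy_lifting I S C h \<sigma>
  for I :: "'d::cstar_algebra set" and S and C :: "'b::cstar_algebra set" and h \<sigma> +
  assumes dense: "\<eta> > 0 \<Longrightarrow> \<exists>c\<in>C. norm (b - c) < \<eta>"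
    and unbounded: "\<exists>l\<in>S. l \<ge> L"
begin

text \<open>
  \<open>b\<close> is a limit of \<open>s\<^sub>n \<in> C\<close>, and the telescoping series of the \<open>\<Psi> s\<^bsub>n+1\<^esub> - \<Psi> s\<^sub>n\<close> converges
  uniformly once each term is frozen up to a parameter \<open>\<Lambda>\<^sub>n\<close> beyond which it is small.  Freezing
  changes neither the image in the quotient nor the behaviour at infinity.
\<close>

lemma extend_at:
  assumes cont: "\<And>b. continuous_on (S \<times> {0..1}) (\<lambda>p. \<Psi> p b)"
    and lift: "\<And>b p. p \<in> S \<times> {0..1} \<Longrightarrow> \<Psi> p b - \<sigma> b (snd p) \<in> I"
    and asymp: "norm.asymptotic_on (strip_at_top S) C \<Psi>"
  shows "\<exists>X. continuous_on (S \<times> {0..1}) X \<and> (\<forall>p\<in>S \<times> {0..1}. X p - \<sigma> b (snd p) \<in> I) \<and>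
    represents (strip_at_top S) C \<Psi> X b"
proof -
  have "\<forall>n. \<exists>c\<in>C. norm (b - c) < (1/2)^n" by (intro allI dense) simp
  then obtain s where s: "\<And>n::nat. s n \<in> C" "\<And>n. norm (b - s n) < (1/2)^n" by metis
  have "\<exists>\<Lambda>\<in>S. \<forall>l\<in>S. \<forall>t\<in>{0..1}. l \<ge> \<Lambda> \<longrightarrow> norm (\<Psi> (l, t) (s (Suc n)) - \<Psi> (l, t) (s n)) \<le> 4 * (1/2)^n" for n
  proof -
    have "eventually (\<lambda>p. norm (\<Psi> p (s (Suc n)) - \<Psi> p (s n)) \<le> norm (s (Suc n) - s n) + (1/2)^n) (strip_at_top S)"
      by (rule asymptotic_on_diff_bound[OF cosine_C asymp s(1) s(1)]) simp
    then obtain L where L: "\<forall>l\<in>S. \<forall>t\<in>{0..1}. l \<ge> L \<longrightarrow>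
        norm (\<Psi> (l, t) (s (Suc n)) - \<Psi> (l, t) (s n)) \<le> norm (s (Suc n) - s n) + (1/2)^n"
      unfolding eventually_strip_at_top by blast
    obtain \<Lambda> where \<Lambda>: "\<Lambda> \<in> S" "\<Lambda> \<ge> L" using unbounded by blast
    have "norm (s (Suc n) - s n) \<le> norm (b - s n) + norm (b - s (Suc n))"
      using norm_triangle_ineq4[of "b - s n" "b - s (Suc n)"] by simp
    moreover have "(1/2::real)^Suc n \<le> (1/2)^n" by simp
    ultimately have "norm (s (Suc n) - s n) + (1/2)^n \<le> 4 * (1/2)^n"
      using s(2)[of n] s(2)[of "Suc n"] zero_le_power[of "1/2::real" n] by linarith
    hence "norm (\<Psi> (l, t) (s (Suc n)) - \<Psi> (l, t) (s n)) \<le> 4 * (1/2)^n"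
      if "l \<in> S" "t \<in> {0..1}" "l \<ge> \<Lambda>" for l t
      using L[rule_format, OF that(1,2)] that(3) \<Lambda>(2) by linarith
    thus ?thesis using \<Lambda>(1) by blast
  qed
  then obtain \<Lambda> where \<Lambda>: "\<And>n. \<Lambda> n \<in> S" "\<And>n l t. l \<in> S \<Longrightarrow> t \<in> {0..1} \<Longrightarrow> l \<ge> \<Lambda> n \<Longrightarrow>
      norm (\<Psi> (l, t) (s (Suc n)) - \<Psi> (l, t) (s n)) \<le> 4 * (1/2)^n"
    by metis
  define frozen where "frozen n p = (max (fst p) (\<Lambda> n), snd p)" for n and p :: "real \<times> real"
  have frozen_in: "frozen n p \<in> S \<times> {0..1}" if "p \<in> S \<times> {0..1}" for n p
    using that \<Lambda>(1)[of n] by (auto simp: frozen_def max_def)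
  define f where "f n p = \<Psi> (frozen n p) (s (Suc n)) - \<Psi> (frozen n p) (s n)" for n p
  have f_bound: "norm (f n p) \<le> 4 * (1/2)^n" if "p \<in> S \<times> {0..1}" for n p
    unfolding f_def frozen_def using frozen_in[OF that, of n] by (intro \<Lambda>(2)) (auto simp: frozen_def)
  have f_cont: "continuous_on (S \<times> {0..1}) (f n)" for n
    unfolding f_def frozen_def by (intro continuous_intros continuous_on_reparametrize cont \<Lambda>)
  have geo: "summable (\<lambda>n. 4 * (1/2::real)^n)" by (intro summable_mult summable_geometric) simp
  define P where "P N p = \<Psi> p (s 0) + (\<Sum>n<N. f n p)" for N p
  define X where "X p = \<Psi> p (s 0) + (\<Sum>n. f n p)" for p
  have "uniform_limit (S \<times> {0..1}) (\<lambda>N p. \<Sum>n<N. f n p) (\<lambda>p. \<Sum>n. f n p) sequentially"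
    by (rule Weierstrass_m_test[OF f_bound geo])
  hence "continuous_on (S \<times> {0..1}) (\<lambda>p. \<Sum>n. f n p)"
    by (rule uniform_limit_theorem[rotated]) (auto intro!: always_eventually continuous_intros f_cont)
  hence 1: "continuous_on (S \<times> {0..1}) X" unfolding X_def by (intro continuous_intros cont)
  have tail: "norm (X p - P N p) \<le> 8 * (1/2)^N" if p: "p \<in> S \<times> {0..1}" for p N
  proof -
    have sm: "summable (\<lambda>n. f n p)" by (rule summable_comparison_test'[OF geo, of 0]) (use f_bound[OF p] in auto)
    have "X p - P N p = (\<Sum>n. f (n + N) p)"
      unfolding X_def P_def suminf_minus_initial_segment[OF sm] by simp
    also have "norm \<dots> \<le> (\<Sum>n. 4 * (1/2)^N * (1/2)^n)"
    proof (rule norm_suminf_le)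
      show "norm (f (n + N) p) \<le> 4 * (1/2)^N * (1/2)^n" for n
        using f_bound[OF p, of "n + N"] by (simp add: power_add mult_ac)
      show "summable (\<lambda>n. 4 * (1/2::real)^N * (1/2)^n)" by (intro summable_mult summable_geometric) simp
    qed
    also have "\<dots> = 4 * (1/2)^N * 2"
      using suminf_mult[OF summable_geometric[of "1/2::real"], of "4 * (1/2)^N"] suminf_geometric[of "1/2::real"]
      by simp
    finally show ?thesis by simp
  qed
  have P_lift: "P N p - \<sigma> (s N) (snd p) \<in> I" if p: "p \<in> S \<times> {0..1}" for N p
  proof (induction N)
    case 0 show ?case using lift[OF p] by (simp add: P_def)
  next
    case (Suc N)
    have q: "frozen N p \<in> S \<times> {0..1}" "snd (frozen N p) = snd p"
      using frozen_in[OF p] by (auto simp: frozen_def)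
    have "P (Suc N) p - \<sigma> (s (Suc N)) (snd p) = (P N p - \<sigma> (s N) (snd p))
        + (\<Psi> (frozen N p) (s (Suc N)) - \<sigma> (s (Suc N)) (snd p)) - (\<Psi> (frozen N p) (s N) - \<sigma> (s N) (snd p))"
      by (simp add: P_def f_def)
    thus ?case using Suc lift[OF q(1), of "s (Suc N)"] lift[OF q(1), of "s N"] q(2)
      by (simp only:) (rule diff_I[OF add_I])
  qed
  have 2: "X p - \<sigma> b (snd p) \<in> I" if p: "p \<in> S \<times> {0..1}" for p
  proof (rule infdist_eq_0D)
    have hom: "hom_mod (\<lambda>b. \<sigma> b (snd p))" using p by (intro \<sigma>_hom) auto
    have "infdist (X p - \<sigma> b (snd p)) I \<le> 9 * (1/2)^N" for N
    proof -
      have "X p - \<sigma> b (snd p) = (X p - P N p) + (P N p - \<sigma> (s N) (snd p)) - (\<sigma> b (snd p) - \<sigma> (s N) (snd p))"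
        by simp
      hence "infdist (X p - \<sigma> b (snd p)) I \<le> infdist (X p - P N p) I
          + infdist (P N p - \<sigma> (s N) (snd p)) I + infdist (\<sigma> b (snd p) - \<sigma> (s N) (snd p)) I"
        by (simp only:) (intro order_trans[OF quot.p_diff] add_right_mono quot.p_add)
      also have "infdist (P N p - \<sigma> (s N) (snd p)) I = 0" using P_lift[OF p] by simp
      also have "infdist (X p - P N p) I + 0 + infdist (\<sigma> b (snd p) - \<sigma> (s N) (snd p)) I
          \<le> 8 * (1/2)^N + 0 + (1/2)^N"
        using tail[OF p, of N] infdist_le_norm'[of "X p - P N p"] infdist_hom_mod_diff[OF hom, of b "s N"] s(2)[of N]
        by linarith
      finally show ?thesis by simp
    qed
    moreover have lim: "(\<lambda>N. 9 * (1/2::real)^N) \<longlonglongrightarrow> 9 * 0"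
      by (intro tendsto_intros LIMSEQ_power_zero) simp
    ultimately have "infdist (X p - \<sigma> b (snd p)) I \<le> 9 * 0" by (intro LIMSEQ_le_const[OF lim]) blast
    thus "infdist (X p - \<sigma> b (snd p)) I = 0" using infdist_nonneg[of "X p - \<sigma> b (snd p)" I] by linarith
  qed
  have 3: "represents (strip_at_top S) C \<Psi> X b"
    unfolding represents_def
  proof (intro allI impI)
    fix \<eta> :: real assume "\<eta> > 0"
    then obtain N where N: "8 * (1/2::real)^N < \<eta>" using half_power_small[of \<eta> 8] by blast
    define L where "L = Max (\<Lambda> ` {..N})"
    have L: "\<Lambda> n \<le> L" if "n \<le> N" for n unfolding L_def using that by (intro Max_ge) auto
    have "norm (X (l, t) - \<Psi> (l, t) (s N)) \<le> \<eta>" if "l \<in> S" "t \<in> {0..1}" "l \<ge> L" for l t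
    proof -
      have "frozen n (l, t) = (l, t)" if "n \<le> N" for n
        using L[OF that] \<open>l \<ge> L\<close> by (simp add: frozen_def)
      hence "P N (l, t) = \<Psi> (l, t) (s 0) + (\<Sum>n<N. \<Psi> (l, t) (s (Suc n)) - \<Psi> (l, t) (s n))"
        by (simp add: P_def f_def)
      also have "\<dots> = \<Psi> (l, t) (s N)" using sum_lessThan_telescope[of "\<lambda>n. \<Psi> (l, t) (s n)" N] by simp
      finally show ?thesis using tail[of "(l, t)" N] N that by simp
    qed
    hence "eventually (\<lambda>p. norm (X p - \<Psi> p (s N)) \<le> \<eta>) (strip_at_top S)"
      unfolding eventually_strip_at_top by (intro exI[of _ L]) blast
    moreover have "norm (b - s N) < \<eta>"
      using s(2)[of N] N zero_le_power[of "1/2::real" N] by linarith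
    ultimately show "\<exists>c\<in>C. norm (b - c) < \<eta> \<and> eventually (\<lambda>p. norm (X p - \<Psi> p c) \<le> \<eta>) (strip_at_top S)"
      using s(1) by blast
  qed
  from 1 2 3 show ?thesis by blast
qed

lemma lift_of_homotopy:
  obtains X :: "real \<times> real \<Rightarrow> 'b \<Rightarrow> 'd" where
    "\<And>b. continuous_on (S \<times> {0..1}) (\<lambda>p. X p b)"
    "\<And>b p. p \<in> S \<times> {0..1} \<Longrightarrow> X p b - \<sigma> b (snd p) \<in> I"
    "asymptotically_star_hom (strip_at_top S) full full X"
    "\<And>a. \<exists>R. \<forall>p\<in>S \<times> {0..1}. norm (X p a) \<le> R"
proof -
  obtain \<Psi> where \<Psi>: "\<And>b. continuous_on (S \<times> {0..1}) (\<lambda>p. \<Psi> p b)"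
    "\<And>b p. p \<in> S \<times> {0..1} \<Longrightarrow> \<Psi> p b - \<sigma> b (snd p) \<in> I" "norm.asymptotic_on (strip_at_top S) C \<Psi>"
    using lift_on_countable_subalgebra by blast
  have "\<forall>b. \<exists>X. continuous_on (S \<times> {0..1}) X \<and> (\<forall>p\<in>S \<times> {0..1}. X p - \<sigma> b (snd p) \<in> I) \<and>
    represents (strip_at_top S) C \<Psi> X b"
    using extend_at[OF \<Psi>] by blast
  then obtain X' where "\<forall>b. continuous_on (S \<times> {0..1}) (X' b) \<and> (\<forall>p\<in>S \<times> {0..1}. X' b p - \<sigma> b (snd p) \<in> I) \<and>
    represents (strip_at_top S) C \<Psi> (X' b) b"
    by (rule choice[THEN exE])
  note X' = this
  define X where "X p b = X' b p" for p b
  have X: "\<And>b. continuous_on (S \<times> {0..1}) (\<lambda>p. X p b)"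
    "\<And>b p. p \<in> S \<times> {0..1} \<Longrightarrow> X p b - \<sigma> b (snd p) \<in> I"
    "\<And>b. represents (strip_at_top S) C \<Psi> (\<lambda>p. X p b) b"
    unfolding X_def using X' by blast+
  note ops = represents_add[OF cosine_C \<Psi>(3)] represents_mult[OF cosine_C \<Psi>(3)]
    represents_star[OF cosine_C \<Psi>(3)] represents_scaleC[OF cosine_C \<Psi>(3)]
  note unique = represents_unique[OF cosine_C \<Psi>(3) X(3)]
  show thesis
  proof (rule that[of X, OF X(1,2)])
    show "asymptotically_star_hom (strip_at_top S) full full X"
      unfolding asymptotically_star_hom_def ndist_full dist_norm full_simps
      by (intro conjI ballI allI; rule unique) (intro ops X)+
    fix a
    have "eventually (\<lambda>p. norm (X p a) \<le> norm a + 1) (strip_at_top S)"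
      by (rule represents_bound[OF cosine_C \<Psi>(3) X(3)]) simp
    then obtain L where L: "\<And>l t. l \<in> S \<Longrightarrow> t \<in> {0..1} \<Longrightarrow> l \<ge> L \<Longrightarrow> norm (X (l, t) a) \<le> norm a + 1"
      unfolding eventually_strip_at_top by blast
    have "bounded ((\<lambda>p. X p a) ` ((S \<inter> {0..L}) \<times> {0..1}))"
      by (intro compact_imp_bounded compact_continuous_image continuous_on_subset[OF X(1)]
          compact_Times closed_Int_compact closed_S compact_Icc) auto
    then obtain R where R: "\<And>p. p \<in> (S \<inter> {0..L}) \<times> {0..1} \<Longrightarrow> norm (X p a) \<le> R"
      unfolding bounded_iff by blast
    have "norm (X p a) \<le> max R (norm a + 1)" if p: "p \<in> S \<times> {0..1}" for p
    proof (cases "fst p \<ge> L")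
      case True
      thus ?thesis using L[of "fst p" "snd p"] p by force
    next
      case False
      hence "p \<in> (S \<inter> {0..L}) \<times> {0..1}" using p S_nonneg by force
      thus ?thesis using R[of p] by linarith
    qed
    thus "\<exists>R. \<forall>p\<in>S \<times> {0..1}. norm (X p a) \<le> R" by blast
  qed
qed

end

section \<open>Translation to the structures on explicit carriers\<close>

lemma ndist_quotient:
  assumes "closed_two_sided_ideal I"
  shows "ndist (quotient_alg I) (qmap I x) (qmap I y) = infdist (x - y) I"
  unfolding ndist_def by (simp add: quotient_ops[OF assms])

text \<open>
  The involution of the quotient is a union of cosets; that it maps the image of \<open>0\<close>
  to a single coset already forces \<open>I\<close> to be self-adjoint.
\<close>

lemma star_ideal_of_star_hom:
  assumes I: "closed_two_sided_ideal I" and f: "star_hom full (quotient_alg I) f"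
  shows "star_ideal I"
proof
  show "closed_two_sided_ideal I" by (rule I)
  have zero: "0 \<in> I" and scale: "\<And>c x. x \<in> I \<Longrightarrow> c *\<^sub>C x \<in> I" and plus: "\<And>x y. x \<in> I \<Longrightarrow> y \<in> I \<Longrightarrow> x + y \<in> I"
    using I by (auto simp: closed_two_sided_ideal_def)
  have "f 0 \<in> range (qmap I)" using f by (simp add: star_hom_def quotient_alg_def)
  then obtain d where d: "f 0 = qmap I d" by blast
  have "f (star 0) = adj (quotient_alg I) (f 0)" using f unfolding star_hom_def full_simps by blast
  hence eq: "qmap I d = (\<Union>x\<in>qmap I d. qmap I (star x))" by (simp add: d quotient_alg_def)
  have mem: "star (d + i) - d \<in> I" if "i \<in> I" for i
  proof -
    have "d + i \<in> qmap I d" using that by (simp add: qmap_def)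
    moreover have "star (d + i) \<in> qmap I (star (d + i))" using zero by (force simp: qmap_def)
    ultimately have "star (d + i) \<in> qmap I d" by (subst eq) blast
    thus ?thesis by (auto simp: qmap_def)
  qed
  show "star ` I \<subseteq> I"
  proof safe
    fix i assume i: "i \<in> I"
    have "(star (d + i) - d) + (-1) *\<^sub>C (star (d + 0) - d) \<in> I"
      by (intro plus scale mem i zero)
    thus "star i \<in> I" by (simp add: star_add)
  qed
qed

lemma C01_simps:
  "add (C01 E) F G = (\<lambda>t\<in>{0..1}. add E (F t) (G t))" "scl (C01 E) c F = (\<lambda>t\<in>{0..1}. scl E c (F t))"
  "mul (C01 E) F G = (\<lambda>t\<in>{0..1}. mul E (F t) (G t))" "adj (C01 E) F = (\<lambda>t\<in>{0..1}. adj E (F t))"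
  "nrm (C01 E) F = (SUP t\<in>{0..1}. nrm E (F t))"
  by (simp_all add: C01_def)

lemma ndist_C01_le:
  assumes "\<And>t. t \<in> {0..1} \<Longrightarrow> norm (F t - G t) \<le> \<eta>"
  shows "\<bar>ndist (C01 full) F G\<bar> \<le> \<eta>"
proof -
  have "ndist (C01 full) F G = (SUP t\<in>{0..1}. norm (F t - G t))"
    unfolding ndist_def C01_simps full_simps by (intro arg_cong[where f = Sup] image_cong) auto
  moreover have "(SUP t\<in>{0..1}. norm (F t - G t)) \<le> \<eta>" by (rule cSUP_least) (use assms in auto)
  moreover have "norm (F 0 - G 0) \<le> (SUP t\<in>{0..1}. norm (F t - G t))"
    by (rule cSUP_upper2[where x = 0]) (use assms in \<open>auto intro!: bdd_aboveI2[where M = \<eta>]\<close>)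
  hence "0 \<le> (SUP t\<in>{0..1}. norm (F t - G t))" by (rule order_trans[OF norm_ge_zero])
  ultimately show ?thesis by simp
qed

lemma asymptotic_on_of_full:
  assumes "asymptotically_star_hom \<F> full full h" "\<G> \<le> \<F>"
  shows "norm.asymptotic_on \<G> C h"
proof -
  have D: "((\<lambda>i. norm (h i (\<mu> *\<^sub>C a + \<nu> *\<^sub>C b) - (\<mu> *\<^sub>C h i a + \<nu> *\<^sub>C h i b))) \<longlongrightarrow> 0) \<G>"
    "((\<lambda>i. norm (h i (a * b) - h i a * h i b)) \<longlongrightarrow> 0) \<G>" "((\<lambda>i. norm (h i (star a) - star (h i a))) \<longlongrightarrow> 0) \<G>"
    for a b \<mu> \<nu>
    using assms(1) unfolding asymptotically_star_hom_def ndist_full dist_norm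
    by (auto intro: tendsto_mono[OF assms(2)])
  show ?thesis
    unfolding norm.asymptotic_on_def
    using D(1)[of 1 _ 1] D(1)[of _ _ 0] D(2,3) by simp
qed

text \<open>
  From families indexed by \<open>(l, t)\<close> back to families of paths, and to their end points.  The
  reparametrization \<open>r\<close> is the identity of the half line or the inclusion of the natural numbers.
\<close>

context
  fixes S :: "real set" and X :: "real \<times> real \<Rightarrow> 'b::cstar_algebra \<Rightarrow> 'd::cstar_algebra"
    and r :: "'i \<Rightarrow> real" and \<F> :: "'i filter"
  assumes X: "asymptotically_star_hom (strip_at_top S) full full X"
    and r: "filterlim r (inf at_top (principal S)) \<F>"
begin

lemma X_limits:
  "((\<lambda>p. norm (X p (star a) - star (X p a))) \<longlongrightarrow> 0) (strip_at_top S)"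
  "((\<lambda>p. norm (X p (\<mu> *\<^sub>C a + \<nu> *\<^sub>C b) - (\<mu> *\<^sub>C X p a + \<nu> *\<^sub>C X p b))) \<longlongrightarrow> 0) (strip_at_top S)"
  "((\<lambda>p. norm (X p (a * b) - X p a * X p b)) \<longlongrightarrow> 0) (strip_at_top S)"
  using X unfolding asymptotically_star_hom_def ndist_full dist_norm by simp_all

lemma eventually_strip_uniform:
  assumes "((\<lambda>p. norm (g p :: 'd)) \<longlongrightarrow> 0) (strip_at_top S)" "\<eta> > 0"
  shows "eventually (\<lambda>i. \<forall>t\<in>{0..1}. norm (g (r i, t)) \<le> \<eta>) \<F>"
proof -
  have "eventually (\<lambda>l. \<forall>t\<in>{0..1}. norm (g (l, t)) \<le> \<eta>) (inf at_top (principal S))"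
    using eventually_norm_le_of_tendsto[OF assms]
    unfolding eventually_strip_at_top eventually_at_top_within by blast
  thus ?thesis using r by (rule eventually_compose_filterlim)
qed

lemma asymptotically_star_hom_paths:
  "asymptotically_star_hom \<F> full (C01 full) (\<lambda>i b. \<lambda>t\<in>{0..1}. X (r i, t) b)"
proof -
  have *: "((\<lambda>i. ndist (C01 full) (F i) (G i)) \<longlongrightarrow> 0) \<F>"
    if g: "((\<lambda>p. norm (g p :: 'd)) \<longlongrightarrow> 0) (strip_at_top S)" and eq: "\<And>i t. t \<in> {0..1} \<Longrightarrow> F i t - G i t = g (r i, t)" for F G g
    unfolding tendsto_iff
  proof (intro allI impI)
    fix \<eta> :: real assume "\<eta> > 0"
    hence "eventually (\<lambda>i. \<forall>t\<in>{0..1}. norm (g (r i, t)) \<le> \<eta>/2) \<F>" by (intro eventually_strip_uniform g) auto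
    thus "eventually (\<lambda>i. dist (ndist (C01 full) (F i) (G i)) 0 < \<eta>) \<F>"
    proof eventually_elim
      case (elim i)
      have "\<bar>ndist (C01 full) (F i) (G i)\<bar> \<le> \<eta>/2" by (rule ndist_C01_le) (use elim eq in auto)
      thus ?case using \<open>\<eta> > 0\<close> by simp
    qed
  qed
  show ?thesis
    unfolding asymptotically_star_hom_def
    by (intro conjI ballI allI; rule *[OF X_limits(1)] *[OF X_limits(2)] *[OF X_limits(3)]) (auto simp: C01_def)
qed

lemma asymptotically_star_hom_end:
  "asymptotically_star_hom \<F> full full (\<lambda>i b. X (r i, 1) b)"
proof -
  have *: "((\<lambda>i. norm (g (r i, 1))) \<longlongrightarrow> 0) \<F>"
    if g: "((\<lambda>p. norm (g p :: 'd)) \<longlongrightarrow> 0) (strip_at_top S)" for g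
  proof (rule tendsto_norm_zeroI)
    fix \<eta> :: real assume "\<eta> > 0"
    from eventually_strip_uniform[OF g this]
    show "eventually (\<lambda>i. norm (g (r i, 1)) \<le> \<eta>) \<F>" by (rule eventually_mono) simp
  qed
  show ?thesis
    unfolding asymptotically_star_hom_def ndist_full dist_norm
    using *[OF X_limits(1)] *[OF X_limits(2)] *[OF X_limits(3)] by simp
qed

end

lemma restrict_in_C01:
  assumes "continuous_on {0..1} F"
  shows "(\<lambda>t\<in>{0..1}. F t) \<in> carr (C01 full)"
  using continuous_on_cong[of "{0..1}" "{0..1}" "\<lambda>t\<in>{0..1}. F t" F] assms
  by (simp add: C01_def continuous_into_full)

lemma continuous_into_C01:
  fixes F :: "real \<times> real \<Rightarrow> 'd::cstar_algebra"
  assumes "continuous_on ({0..} \<times> {0..1}) F"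
  shows "continuous_into (C01 full) {0..} (\<lambda>l. \<lambda>t\<in>{0..1}. F (l, t))"
  unfolding continuous_into_def
proof (intro conjI ballI)
  fix s :: real assume s: "s \<in> {0..}"
  have "continuous_on {0..1} (\<lambda>t. F (s, t))"
    by (rule continuous_on_compose2[OF assms]) (use s in \<open>auto intro!: continuous_intros\<close>)
  thus "(\<lambda>t\<in>{0..1}. F (s, t)) \<in> carr (C01 full)" by (rule restrict_in_C01)
  have "uniformly_continuous_on ({0..s+1} \<times> {0..1}) F"
    by (intro compact_uniformly_continuous continuous_on_subset[OF assms] compact_Times compact_Icc) auto
  show "((\<lambda>l. ndist (C01 full) (\<lambda>t\<in>{0..1}. F (l, t)) (\<lambda>t\<in>{0..1}. F (s, t))) \<longlongrightarrow> 0) (at s within {0..})"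
    unfolding tendsto_iff
  proof (intro allI impI)
    fix \<eta> :: real assume "\<eta> > 0"
    hence "\<eta>/2 > 0" by simp
    then obtain \<delta> where \<delta>: "\<delta> > 0" "\<And>x y. x \<in> {0..s+1} \<times> {0..1} \<Longrightarrow> y \<in> {0..s+1} \<times> {0..1} \<Longrightarrow>
        dist y x < \<delta> \<Longrightarrow> dist (F y) (F x) < \<eta>/2"
      using \<open>uniformly_continuous_on _ F\<close> unfolding uniformly_continuous_on_def by meson
    have "dist (ndist (C01 full) (\<lambda>t\<in>{0..1}. F (l, t)) (\<lambda>t\<in>{0..1}. F (s, t))) 0 < \<eta>"
      if "l \<in> {0..}" "dist l s < min \<delta> 1" for l
    proof -
      have "norm ((\<lambda>t\<in>{0..1}. F (l, t)) t - (\<lambda>t\<in>{0..1}. F (s, t)) t) \<le> \<eta>/2" if t: "t \<in> {0..1}" for t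
      proof -
        have "dist (F (l, t)) (F (s, t)) < \<eta>/2"
          using \<open>l \<in> {0..}\<close> \<open>dist l s < min \<delta> 1\<close> s t
          by (intro \<delta>(2)) (auto simp: dist_Pair_Pair dist_real_def)
        thus ?thesis using t by (simp add: dist_norm)
      qed
      hence "\<bar>ndist (C01 full) (\<lambda>t\<in>{0..1}. F (l, t)) (\<lambda>t\<in>{0..1}. F (s, t))\<bar> \<le> \<eta>/2" by (rule ndist_C01_le)
      thus ?thesis using \<open>\<eta> > 0\<close> by simp
    qed
    thus "eventually (\<lambda>l. dist (ndist (C01 full) (\<lambda>t\<in>{0..1}. F (l, t)) (\<lambda>t\<in>{0..1}. F (s, t))) 0 < \<eta>) (at s within {0..})"
      using \<delta>(1) unfolding eventually_at by (intro exI[of _ "min \<delta> 1"]) auto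
  qed
qed

lemma nrm_C01_le:
  assumes "\<And>t. t \<in> {0..1} \<Longrightarrow> norm (F t) \<le> R"
  shows "nrm (C01 full) F \<le> R"
  unfolding C01_def by (simp, rule cSUP_least) (use assms in auto)

lemma homotopy_path_lifts:
  assumes I: "star_ideal (I :: 'd::cstar_algebra set)"
    and \<Phi>: "star_hom full (C01 (quotient_alg I)) (\<Phi> :: 'b::cstar_algebra \<Rightarrow> real \<Rightarrow> 'd set)"
  obtains \<sigma> where "\<And>b. continuous_on {0..1} (\<sigma> b)" "\<And>t. t \<in> {0..1} \<Longrightarrow> star_ideal.hom_mod I (\<lambda>b. \<sigma> b t)"
    "\<And>b t. t \<in> {0..1} \<Longrightarrow> qmap I (\<sigma> b t) = \<Phi> b t"
proof -
  interpret star_ideal I by (rule I)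
  note ops = quotient_ops[OF ideal]
  have carr: "\<Phi> b \<in> carr (C01 (quotient_alg I))" for b using \<Phi> by (simp add: star_hom_def)
  define \<rho> where "\<rho> b t = (SOME d. \<Phi> b t = qmap I d)" for b t
  have \<rho>: "\<Phi> b t = qmap I (\<rho> b t)" if "t \<in> {0..1}" for b t
  proof -
    have "\<Phi> b t \<in> range (qmap I)"
      using carr[of b] that by (simp add: C01_def continuous_into_def quotient_alg_def)
    hence "\<exists>d. \<Phi> b t = qmap I d" by blast
    thus ?thesis unfolding \<rho>_def by (rule someI_ex)
  qed
  have "quotient_continuous (\<rho> b)" for b
    unfolding quotient_continuous_def
  proof
    fix s :: real assume s: "s \<in> {0..1}"
    have "((\<lambda>t. ndist (quotient_alg I) (\<Phi> b t) (\<Phi> b s)) \<longlongrightarrow> 0) (at s within {0..1})"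
      using carr[of b] s by (auto simp: C01_def continuous_into_def)
    thus "((\<lambda>t. infdist (\<rho> b t - \<rho> b s) I) \<longlongrightarrow> 0) (at s within {0..1})"
    proof (rule Lim_transform_eventually)
      show "eventually (\<lambda>t. ndist (quotient_alg I) (\<Phi> b t) (\<Phi> b s) = infdist (\<rho> b t - \<rho> b s) I) (at s within {0..1})"
        unfolding eventually_at_filter
        by (rule always_eventually) (use s \<rho> in \<open>auto simp: ndist_quotient[OF ideal]\<close>)
    qed
  qed
  hence "\<forall>b. \<exists>g. continuous_on {0..1} g \<and> (\<forall>t\<in>{0..1}. g t - \<rho> b t \<in> I)" using path_lift by blast
  then obtain \<sigma> where \<sigma>: "\<And>b. continuous_on {0..1} (\<sigma> b)" "\<And>b t. t \<in> {0..1} \<Longrightarrow> \<sigma> b t - \<rho> b t \<in> I" by metis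
  have "hom_mod (\<lambda>b. \<rho> b t)" if t: "t \<in> {0..1}" for t
    unfolding hom_mod_def
  proof (intro conjI allI)
    fix a b c
    have "\<Phi> (a + b) t = add (quotient_alg I) (\<Phi> a t) (\<Phi> b t)"
      "\<Phi> (c *\<^sub>C a) t = scl (quotient_alg I) c (\<Phi> a t)"
      "\<Phi> (a * b) t = mul (quotient_alg I) (\<Phi> a t) (\<Phi> b t)"
      "\<Phi> (star a) t = adj (quotient_alg I) (\<Phi> a t)"
      using \<Phi> t by (simp_all add: star_hom_def C01_def)
    thus "\<rho> (a + b) t - (\<rho> a t + \<rho> b t) \<in> I" "\<rho> (c *\<^sub>C a) t - c *\<^sub>C \<rho> a t \<in> I"
      "\<rho> (a * b) t - \<rho> a t * \<rho> b t \<in> I" "\<rho> (star a) t - star (\<rho> a t) \<in> I"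
      by (simp_all only: \<rho>[OF t] ops(2,3,4) ops(5)[OF star_closed] ops(1))
  qed
  hence hom: "hom_mod (\<lambda>b. \<sigma> b t)" if "t \<in> {0..1}" for t
    by (rule hom_mod_cong) (use that in \<open>auto intro: \<sigma>(2)\<close>)
  have q: "qmap I (\<sigma> b t) = \<Phi> b t" if "t \<in> {0..1}" for b t
    using \<sigma>(2)[OF that, of b] \<rho>[OF that] ops(1) by simp
  show thesis by (intro that[of \<sigma>] \<sigma>(1) hom q)
qed

text \<open>
  The half line and the natural numbers as \<open>S\<close> give the two cases of the theorem.
\<close>

lemma lift_of_homotopy_along:
  fixes I :: "'d::cstar_algebra set" and \<Phi> :: "'b::cstar_algebra \<Rightarrow> real \<Rightarrow> 'd set"
  assumes sep: "separable_space (euclidean :: 'b topology)" and I: "star_ideal I"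
    and \<Phi>: "homotopy_between full (quotient_alg I) \<Phi> \<phi> \<psi>"
    and S: "closed S" "S \<subseteq> {0..}" "\<And>L. \<exists>l\<in>S. l \<ge> L"
    and h: "\<And>b. continuous_on S (\<lambda>l. h l b)" "\<And>l b. l \<in> S \<Longrightarrow> qmap I (h l b) = \<psi> b"
      "\<And>C. norm.asymptotic_on (inf at_top (principal S)) C h"
  obtains X :: "real \<times> real \<Rightarrow> 'b \<Rightarrow> 'd" where
    "\<And>b. continuous_on (S \<times> {0..1}) (\<lambda>p. X p b)"
    "\<And>l. l \<in> S \<Longrightarrow> tensor_id (qmap I) \<circ> (\<lambda>b. \<lambda>t\<in>{0..1}. X (l, t) b) = \<Phi>"
    "\<And>l b. l \<in> S \<Longrightarrow> qmap I (X (l, 1) b) = \<phi> b"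
    "asymptotically_star_hom (strip_at_top S) full full X"
    "\<And>a. \<exists>R. \<forall>p\<in>S \<times> {0..1}. norm (X p a) \<le> R"
proof -
  interpret star_ideal I by (rule I)
  have \<Phi>_hom: "star_hom full (C01 (quotient_alg I)) \<Phi>" and \<Phi>1: "\<Phi> b 1 = \<phi> b" and \<Phi>0: "\<Phi> b 0 = \<psi> b" for b
    using \<Phi> by (auto simp: homotopy_between_def ev_def)
  obtain \<sigma> where \<sigma>: "\<And>b. continuous_on {0..1} (\<sigma> b)" "\<And>t. t \<in> {0..1} \<Longrightarrow> hom_mod (\<lambda>b. \<sigma> b t)"
    "\<And>b t. t \<in> {0..1} \<Longrightarrow> qmap I (\<sigma> b t) = \<Phi> b t"
    using homotopy_path_lifts[OF I \<Phi>_hom] by blast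
  obtain C :: "'b set" where C: "countable C" "cosine_subalgebra C" "\<And>b \<eta>. \<eta> > 0 \<Longrightarrow> \<exists>c\<in>C. norm (b - c) < \<eta>"
    using countable_dense_cosine_subalgebra[OF sep] by blast
  have lift0: "h l b - \<sigma> b 0 \<in> I" if "l \<in> S" for l b
    using h(2)[OF that, of b] \<sigma>(3)[of 0 b] \<Phi>0[of b] quotient_ops(1)[OF ideal, of "h l b" "\<sigma> b 0"] by simp
  interpret dense_homotopy_lifting I S C h \<sigma>
    by unfold_locales (use S C \<sigma> h lift0 in auto)
  show thesis
  proof (rule lift_of_homotopy)
    fix X :: "real \<times> real \<Rightarrow> 'b \<Rightarrow> 'd"
    assume X:
      "\<And>b. continuous_on (S \<times> {0..1}) (\<lambda>p. X p b)"
      "\<And>b p. p \<in> S \<times> {0..1} \<Longrightarrow> X p b - \<sigma> b (snd p) \<in> I"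
      "asymptotically_star_hom (strip_at_top S) full full X"
      "\<And>a. \<exists>R. \<forall>p\<in>S \<times> {0..1}. norm (X p a) \<le> R"
    have q: "qmap I (X (l, t) b) = \<Phi> b t" if "l \<in> S" "t \<in> {0..1}" for l t b
      using X(2)[of "(l, t)" b] \<sigma>(3)[OF that(2), of b] that quotient_ops(1)[OF ideal, of "X (l, t) b" "\<sigma> b t"] by simp
    have "tensor_id (qmap I) \<circ> (\<lambda>b. \<lambda>t\<in>{0..1}. X (l, t) b) = \<Phi>" if l: "l \<in> S" for l
    proof
      fix b
      have "\<Phi> b \<in> extensional {0..1}" using \<Phi>_hom by (simp add: star_hom_def C01_def)
      thus "(tensor_id (qmap I) \<circ> (\<lambda>b. \<lambda>t\<in>{0..1}. X (l, t) b)) b = \<Phi> b"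
        by (intro extensionalityI[of _ "{0..1}"]) (auto simp: tensor_id_def q[OF l])
    qed
    moreover have "qmap I (X (l, 1) b) = \<phi> b" if "l \<in> S" for l b using q[OF that, of 1 b] \<Phi>1 by simp
    ultimately show thesis by (intro that[of X] X)
  qed
qed

lemma asymptotic_homotopy_lifting:
  fixes I :: "'d::cstar_algebra set" and \<Phi> :: "'b::cstar_algebra \<Rightarrow> real \<Rightarrow> 'd set"
  assumes sep: "separable_space (euclidean :: 'b topology)" and I: "star_ideal I"
    and \<Phi>: "homotopy_between full (quotient_alg I) \<Phi> \<phi> \<psi>"
    and \<psi>: "lifts_to_asymptotic_hom full full (qmap I) \<psi>"
  shows "lifts_to_asymptotic_hom full full (qmap I) \<phi>"
    "\<exists>\<Psi>. asymptotic_hom full (C01 full) \<Psi> \<and> (\<forall>l\<ge>0. tensor_id (qmap I) \<circ> \<Psi> l = \<Phi>)"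
proof -
  obtain h where h: "asymptotic_hom full full h" "\<And>l b. l \<ge> 0 \<Longrightarrow> qmap I (h l b) = \<psi> b"
    using \<psi> by (auto simp: lifts_to_asymptotic_hom_def)
  have hc: "continuous_on {0..} (\<lambda>l. h l b)" for b
    using h(1) by (simp add: asymptotic_hom_def continuous_into_full)
  have ha: "norm.asymptotic_on (inf at_top (principal {0..})) C h" for C
    by (rule asymptotic_on_of_full[of at_top]) (use h(1) in \<open>auto simp: asymptotic_hom_def\<close>)
  obtain X :: "real \<times> real \<Rightarrow> 'b \<Rightarrow> 'd" where X:
    "\<And>b. continuous_on ({0..} \<times> {0..1}) (\<lambda>p. X p b)"
    "\<And>l. l \<in> {0..} \<Longrightarrow> tensor_id (qmap I) \<circ> (\<lambda>b. \<lambda>t\<in>{0..1}. X (l, t) b) = \<Phi>"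
    "\<And>l b. l \<in> {0..} \<Longrightarrow> qmap I (X (l, 1) b) = \<phi> b"
    "asymptotically_star_hom (strip_at_top {0..}) full full X"
  proof (rule lift_of_homotopy_along[OF sep I \<Phi>, of "{0..}" h])
    show "\<exists>l\<in>{0..}. l \<ge> L" for L :: real by (intro bexI[of _ "max L 0"]) auto
  qed (use h hc ha in auto)
  have lim: "filterlim (\<lambda>l::real. l) (inf at_top (principal {0..})) at_top"
    unfolding filterlim_inf filterlim_principal using eventually_ge_at_top[of "0::real"] by (simp add: filterlim_ident)
  have "asymptotic_hom full (C01 full) (\<lambda>l b. \<lambda>t\<in>{0..1}. X (l, t) b)"
    unfolding asymptotic_hom_def
    using continuous_into_C01[OF X(1)] asymptotically_star_hom_paths[OF X(4) lim] by simp
  thus "\<exists>\<Psi>. asymptotic_hom full (C01 full) \<Psi> \<and> (\<forall>l\<ge>0. tensor_id (qmap I) \<circ> \<Psi> l = \<Phi>)"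
    using X(2) by (intro exI[of _ "\<lambda>l b. \<lambda>t\<in>{0..1}. X (l, t) b"]) auto
  have "continuous_on {0..} (\<lambda>l. X (l, 1) b)" for b
    by (rule continuous_on_compose2[OF X(1)]) (auto intro!: continuous_intros)
  hence "asymptotic_hom full full (\<lambda>l b. X (l, 1) b)"
    unfolding asymptotic_hom_def continuous_into_full
    using asymptotically_star_hom_end[OF X(4) lim] by simp
  thus "lifts_to_asymptotic_hom full full (qmap I) \<phi>"
    unfolding lifts_to_asymptotic_hom_def using X(3) by (intro exI[of _ "\<lambda>l b. X (l, 1) b"]) auto
qed

text \<open>
  A sequence, extended to real parameters by the floor function, is a continuous family on the discrete
  set \<open>\<nat>\<close>.
\<close>

lemma discrete_homotopy_lifting:
  fixes I :: "'d::cstar_algebra set" and \<Phi> :: "'b::cstar_algebra \<Rightarrow> real \<Rightarrow> 'd set"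
  assumes sep: "separable_space (euclidean :: 'b topology)" and I: "star_ideal I"
    and \<Phi>: "homotopy_between full (quotient_alg I) \<Phi> \<phi> \<psi>"
    and \<psi>: "lifts_to_discrete_asymptotic_hom full full (qmap I) \<psi>"
  shows "lifts_to_discrete_asymptotic_hom full full (qmap I) \<phi>"
    "\<exists>\<Psi>. discrete_asymptotic_hom full (C01 full) \<Psi> \<and> (\<forall>n. tensor_id (qmap I) \<circ> \<Psi> n = \<Phi>)"
proof -
  obtain g where g: "discrete_asymptotic_hom full full g" "\<And>n b. qmap I (g n b) = \<psi> b"
    using \<psi> by (auto simp: lifts_to_discrete_asymptotic_hom_def)
  define h where "h l = g (nat \<lfloor>l\<rfloor>)" for l :: real
  have hc: "continuous_on \<nat> (\<lambda>l. h l b)" for b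
    unfolding continuous_on_iff
  proof (intro ballI allI impI)
    fix l :: real and \<eta> :: real assume l: "l \<in> \<nat>" and "\<eta> > 0"
    show "\<exists>d>0. \<forall>l'\<in>\<nat>. dist l' l < d \<longrightarrow> dist (h l' b) (h l b) < \<eta>"
    proof (intro exI[of _ 1] conjI ballI impI)
      fix l' :: real assume "l' \<in> \<nat>" "dist l' l < 1"
      hence "l' = l" using l by (auto simp: Nats_def dist_real_def)
      thus "dist (h l' b) (h l b) < \<eta>" using \<open>\<eta> > 0\<close> by simp
    qed simp
  qed
  have lim': "filterlim (\<lambda>l::real. nat \<lfloor>l\<rfloor>) sequentially at_top"
    by (rule filterlim_compose[OF filterlim_nat_sequentially filterlim_floor_sequentially])
  have "asymptotically_star_hom at_top full full h"
    using g(1) unfolding discrete_asymptotic_hom_def asymptotically_star_hom_def h_def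
    by (auto intro: filterlim_compose[OF _ lim'])
  hence ha: "norm.asymptotic_on (inf at_top (principal \<nat>)) C h" for C
    by (rule asymptotic_on_of_full) simp
  obtain X :: "real \<times> real \<Rightarrow> 'b \<Rightarrow> 'd" where X:
    "\<And>b. continuous_on (\<nat> \<times> {0..1}) (\<lambda>p. X p b)"
    "\<And>l. l \<in> \<nat> \<Longrightarrow> tensor_id (qmap I) \<circ> (\<lambda>b. \<lambda>t\<in>{0..1}. X (l, t) b) = \<Phi>"
    "\<And>l b. l \<in> \<nat> \<Longrightarrow> qmap I (X (l, 1) b) = \<phi> b"
    "asymptotically_star_hom (strip_at_top \<nat>) full full X"
    "\<And>a. \<exists>R. \<forall>p\<in>\<nat> \<times> {0..1}. norm (X p a) \<le> R"
  proof (rule lift_of_homotopy_along[OF sep I \<Phi>, of \<nat> h])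
    show "\<exists>l\<in>\<nat>. l \<ge> L" for L :: real
      using real_arch_simple[of L] by (auto simp: Nats_def)
    show "\<nat> \<subseteq> {0::real..}" by (auto simp: Nats_def)
  qed (use g hc ha in \<open>auto simp: h_def\<close>)
  have lim: "filterlim real (inf at_top (principal \<nat>)) sequentially"
    unfolding filterlim_inf filterlim_principal by (simp add: filterlim_real_sequentially)
  have cont: "continuous_on {0..1} (\<lambda>t. X (real n, t) b)" for n b
    by (rule continuous_on_compose2[OF X(1)]) (auto intro!: continuous_intros)
  have "bdd_above (range (\<lambda>n. nrm (C01 full) (\<lambda>t\<in>{0..1}. X (real n, t) b)))" for b
  proof -
    obtain R where R: "\<And>p. p \<in> \<nat> \<times> {0..1} \<Longrightarrow> norm (X p b) \<le> R" using X(5) by blast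
    have "nrm (C01 full) (\<lambda>t\<in>{0..1}. X (real n, t) b) \<le> R" for n
      by (rule nrm_C01_le) (use R in auto)
    thus ?thesis by (intro bdd_aboveI2[where M = R])
  qed
  hence "discrete_asymptotic_hom full (C01 full) (\<lambda>n b. \<lambda>t\<in>{0..1}. X (real n, t) b)"
    unfolding discrete_asymptotic_hom_def
    using restrict_in_C01[OF cont] asymptotically_star_hom_paths[OF X(4) lim] by simp
  thus "\<exists>\<Psi>. discrete_asymptotic_hom full (C01 full) \<Psi> \<and> (\<forall>n. tensor_id (qmap I) \<circ> \<Psi> n = \<Phi>)"
    using X(2) by (intro exI[of _ "\<lambda>n b. \<lambda>t\<in>{0..1}. X (real n, t) b"]) auto
  have "bdd_above (range (\<lambda>n. norm (X (real n, 1) b)))" for b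
  proof -
    obtain R where R: "\<And>p. p \<in> \<nat> \<times> {0..1} \<Longrightarrow> norm (X p b) \<le> R" using X(5) by blast
    show ?thesis by (rule bdd_aboveI2[where M = R]) (use R in auto)
  qed
  hence "discrete_asymptotic_hom full full (\<lambda>n b. X (real n, 1) b)"
    unfolding discrete_asymptotic_hom_def
    using asymptotically_star_hom_end[OF X(4) lim] by simp
  thus "lifts_to_discrete_asymptotic_hom full full (qmap I) \<phi>"
    unfolding lifts_to_discrete_asymptotic_hom_def using X(3)
    by (intro exI[of _ "\<lambda>n b. X (real n, 1) b"]) auto
qed

theorem theorem11:
  fixes I :: "'d::cstar_algebra set"
    and \<phi> \<psi> :: "'b::cstar_algebra \<Rightarrow> 'd set"
  assumes "separable_space (euclidean :: 'b topology)"
    and "closed_two_sided_ideal I"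
    and "star_hom full (quotient_alg I) \<phi>"
    and "star_hom full (quotient_alg I) \<psi>"
    and "homotopic full (quotient_alg I) \<phi> \<psi>"
  shows
    "(lifts_to_asymptotic_hom full full (qmap I) \<psi> \<longrightarrow>
        lifts_to_asymptotic_hom full full (qmap I) \<phi> \<and>
        (\<forall>\<Phi>. homotopy_between full (quotient_alg I) \<Phi> \<phi> \<psi> \<longrightarrow>
          (\<exists>\<Psi>. asymptotic_hom full (C01 full) \<Psi> \<and>
               (\<forall>l\<ge>0. tensor_id (qmap I) \<circ> \<Psi> l = \<Phi>)))) \<and>
     (lifts_to_discrete_asymptotic_hom full full (qmap I) \<psi> \<longrightarrow>
        lifts_to_discrete_asymptotic_hom full full (qmap I) \<phi> \<and>
        (\<forall>\<Phi>. homotopy_between full (quotient_alg I) \<Phi> \<phi> \<psi> \<longrightarrow>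
          (\<exists>\<Psi>. discrete_asymptotic_hom full (C01 full) \<Psi> \<and>
               (\<forall>n. tensor_id (qmap I) \<circ> \<Psi> n = \<Phi>))))"
proof -
  have I: "star_ideal I" by (rule star_ideal_of_star_hom[OF assms(2,4)])
  obtain \<Phi> where \<Phi>: "homotopy_between full (quotient_alg I) \<Phi> \<phi> \<psi>"
    using assms(5) by (auto simp: homotopic_def)
  show ?thesis
    using asymptotic_homotopy_lifting[OF assms(1) I] discrete_homotopy_lifting[OF assms(1) I] \<Phi> by blast
qed

end
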